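(* Let $m,n\ge1$ be integers, $\boldsymbol{k}=(k_1,\ldots,k_m)$ with $1\le k_i\le n$, let $\Omega\subset\mathbb{R}^n$ be open and bounded, and let $f:\boldsymbol{\Lambda^k}\to\mathbb{R}$ be weakly continuous on $W^{d,\boldsymbol{\infty}}(\Omega;\boldsymbol{\Lambda^{k-1}})$. Then $f$ is vectorially ext. one affine, and hence is of the form $$f(\boldsymbol{\xi})=\sum_{\boldsymbol{\alpha},\ 0\le|\boldsymbol{k\alpha}|\le n}\langle c_{\boldsymbol{\alpha}};\boldsymbol{\xi^\alpha}\rangle\qquad\text{for all }\boldsymbol{\xi}\in\boldsymbol{\Lambda^k},$$ where $c_{\boldsymbol{\alpha}}\in\Lambda^{|\boldsymbol{k\alpha}|}(\mathbb{R}^n)$ for every $\boldsymbol{\alpha}$ with $0\le|\boldsymbol{k\alpha}|\le n$.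
   Context: $\Lambda^k=\Lambda^k(\mathbb{R}^n)$ is the space of alternating $k$-linear forms on $\mathbb{R}^n$ with its usual scalar product; $\boldsymbol{\Lambda^k}=\prod_{i=1}^m\Lambda^{k_i}$, $\boldsymbol{\Lambda^{k-1}}=\prod_{i=1}^m\Lambda^{k_i-1}$. Multiindices $\boldsymbol{\alpha}=(\alpha_1,\ldots,\alpha_m)$ consist of integers $0\le\alpha_i\le[n/k_i]$; $|\boldsymbol{k\alpha}|=\sum_ik_i\alpha_i$; $\boldsymbol{\xi^\alpha}=\xi_1^{\alpha_1}\wedge\cdots\wedge\xi_m^{\alpha_m}\in\Lambda^{|\boldsymbol{k\alpha}|}$ (wedge powers; a factor with $\alpha_i=0$ is absent, and $\boldsymbol{\xi}^{\boldsymbol 0}=1$). $W^{d,\boldsymbol{\infty}}(\Omega;\boldsymbol{\Lambda^{k-1}})=\prod_iW^{d,\infty}(\Omega;\Lambda^{k_i-1})$, where $W^{d,\infty}(\Omega;\Lambda^{k-1})=\{\omega\in L^\infty(\Omega;\Lambda^{k-1}):d\omega\in L^\infty(\Omega;\Lambda^{k})\}$. A continuous $f:\boldsymbol{\Lambda^k}\to\mathbb{R}$ is weakly continuous on $W^{d,\boldsymbol{\infty}}(\Omega;\boldsymbol{\Lambda^{k-1}})$ if, whenever $\boldsymbol{\omega}^\nu,\boldsymbol{\omega}\in W^{d,\boldsymbol\infty}(\Omega;\boldsymbol{\Lambda^{k-1}})$ satisfy $\omega_i^\nu\stackrel{*}{\rightharpoonup}\omega_i$ and $d\omega_i^\nu\stackrel{*}{\rightharpoonup}d\omega_i$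 in $L^\infty$ for all $1\le i\le m$, then $f(d\omega_1^\nu,\ldots,d\omega_m^\nu)\rightharpoonup f(d\omega_1,\ldots,d\omega_m)$ in $\mathcal{D}'(\Omega)$. $f$ is vectorially ext. one affine if $t\mapsto f(\xi_1+t\,\alpha\wedge\beta_1,\ldots,\xi_m+t\,\alpha\wedge\beta_m)$ is affine on $\mathbb{R}$ for all $\xi_i\in\Lambda^{k_i}$, $\alpha\in\Lambda^1$, $\beta_i\in\Lambda^{k_i-1}$. *)

theory Defs
  imports "HOL-Analysis.Analysis" "HOL-Combinatorics.Combinatorics"
begin

section \<open>Alternating forms on \<open>\<real>\<^sup>n\<close>\<close>

text \<open>
  A form takes the list of its vector arguments and is \<open>0\<close> on lists whose length is not its degree,
  so that a form of degree \<open>k\<close> is determined by its values on lists of length \<open>k\<close>.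
  The dimension is \<open>n = CARD('n)\<close>. On the (finite-dimensional) space \<open>alt_forms k\<close> the topology of
  pointwise convergence, which the function type carries in HOL-Analysis, is the Euclidean one.
\<close>

type_synonym 'n form = "(real ^ 'n) list \<Rightarrow> real"

definition alt_forms :: "nat \<Rightarrow> ('n::finite) form set" where
  "alt_forms k = {\<omega>.
     (\<forall>vs. length vs \<noteq> k \<longrightarrow> \<omega> vs = 0) \<and>
     (\<forall>vs i. length vs = k \<and> i < k \<longrightarrow> linear (\<lambda>v. \<omega> (vs[i := v]))) \<and>
     (\<forall>vs i j. length vs = k \<and> i < j \<and> j < k \<and> vs ! i = vs ! j \<longrightarrow> \<omega> vs = 0)}"

text \<open>
  The scalar product for which the \<open>e\<^sup>I\<close>, \<open>I\<close> increasing of length \<open>k\<close>, are orthonormal. Each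
  increasing multiindex is counted \<open>k!\<close> times among all tuples of basis vectors, and tuples
  with a repetition contribute \<open>0\<close>.
\<close>

definition form_inner :: "nat \<Rightarrow> ('n::finite) form \<Rightarrow> 'n form \<Rightarrow> real" where
  "form_inner k \<omega> \<eta> =
     (\<Sum>I | length I = k. \<omega> (map (\<lambda>i. axis i 1) I) * \<eta> (map (\<lambda>i. axis i 1) I)) / fact k"

definition form_norm :: "nat \<Rightarrow> ('n::finite) form \<Rightarrow> real" where
  "form_norm k \<omega> = sqrt (form_inner k \<omega> \<omega>)"

text \<open>
  The wedge product in the determinant normalisation. If \<open>\<omega>\<close> and \<open>\<eta>\<close> have degrees \<open>p\<close> and \<open>q\<close>, only
  the summand \<open>j = p\<close> survives, and only on lists of length \<open>p + q\<close>; it is the usual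
  \<open>1 / (p! q!)\<close> times the signed sum over all permutations of the \<open>p + q\<close> arguments.
\<close>

definition wedge :: "('n::finite) form \<Rightarrow> 'n form \<Rightarrow> 'n form"  (infixr "\<and>\<^sub>f" 70) where
  "(\<omega> \<and>\<^sub>f \<eta>) vs =
     (\<Sum>j\<le>length vs.
        (\<Sum>\<sigma> | \<sigma> permutes {..<length vs}.
           of_int (sign \<sigma>) * \<omega> (take j (permute_list \<sigma> vs)) * \<eta> (drop j (permute_list \<sigma> vs)))
        / (fact j * fact (length vs - j)))"

definition form_one :: "('n::finite) form" where
  "form_one vs = (if vs = [] then 1 else 0)"

primrec wedge_pow :: "('n::finite) form \<Rightarrow> nat \<Rightarrow> 'n form" where
  "wedge_pow \<xi> 0 = form_one"
| "wedge_pow \<xi> (Suc a) = \<xi> \<and>\<^sub>f wedge_pow \<xi> a"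

definition multi_wedge_pow ::
    "nat \<Rightarrow> (nat \<Rightarrow> ('n::finite) form) \<Rightarrow> (nat \<Rightarrow> nat) \<Rightarrow> 'n form" where
  "multi_wedge_pow m \<xi> \<alpha> = foldr (\<and>\<^sub>f) (map (\<lambda>i. wedge_pow (\<xi> i) (\<alpha> i)) [1..<Suc m]) form_one"

text \<open>
  Families indexed by \<open>1, \<dots>, m\<close> are functions on \<open>nat\<close> that are \<open>undefined\<close> off \<open>{1..m}\<close>.
\<close>

definition form_prod :: "nat \<Rightarrow> (nat \<Rightarrow> nat) \<Rightarrow> (nat \<Rightarrow> ('n::finite) form) set" where
  "form_prod m k = (\<Pi>\<^sub>E i\<in>{1..m}. alt_forms (k i))"

definition multi_degree :: "nat \<Rightarrow> (nat \<Rightarrow> nat) \<Rightarrow> (nat \<Rightarrow> nat) \<Rightarrow> nat" where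
  "multi_degree m k \<alpha> = (\<Sum>i=1..m. k i * \<alpha> i)"

definition multiindices :: "nat \<Rightarrow> nat \<Rightarrow> (nat \<Rightarrow> nat) \<Rightarrow> (nat \<Rightarrow> nat) set" where
  "multiindices n m k = {\<alpha> \<in> (\<Pi>\<^sub>E i\<in>{1..m}. {0..n div k i}). multi_degree m k \<alpha> \<le> n}"


section \<open>Test functions\<close>

definition dir_deriv :: "real ^ 'n \<Rightarrow> (real ^ ('n::finite) \<Rightarrow> real) \<Rightarrow> real ^ 'n \<Rightarrow> real" where
  "dir_deriv v \<phi> x = frechet_derivative \<phi> (at x) v"

text \<open>
  \<open>C\<^sup>\<infinity>\<close>: all iterated directional derivatives exist and are (totally) differentiable, hence continuous.
\<close>

definition smooth :: "(real ^ ('n::finite) \<Rightarrow> real) \<Rightarrow> bool" where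
  "smooth \<phi> \<longleftrightarrow> (\<forall>vs x. fold dir_deriv vs \<phi> differentiable (at x))"

definition test_functions :: "(real ^ ('n::finite)) set \<Rightarrow> (real ^ 'n \<Rightarrow> real) set" where
  "test_functions \<Omega> =
     {\<phi>. smooth \<phi> \<and> compact (closure {x. \<phi> x \<noteq> 0}) \<and> closure {x. \<phi> x \<noteq> 0} \<subseteq> \<Omega>}"

definition distr_converges ::
    "(real ^ ('n::finite)) set \<Rightarrow> (nat \<Rightarrow> real ^ 'n \<Rightarrow> real) \<Rightarrow> (real ^ 'n \<Rightarrow> real) \<Rightarrow> bool" where
  "distr_converges \<Omega> u v \<longleftrightarrow> (\<forall>\<phi>\<in>test_functions \<Omega>.
     (\<lambda>\<nu>. LINT x|lebesgue_on \<Omega>. u \<nu> x * \<phi> x) \<longlonglongrightarrow> (LINT x|lebesgue_on \<Omega>. v x * \<phi> x))"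


section \<open>Spaces of differential forms\<close>

text \<open>
  Elements of Lebesgue spaces are represented by functions, not by classes modulo null sets.
  Representatives take their values in \<open>alt_forms k\<close> everywhere on \<open>\<Omega>\<close>; their values off \<open>\<Omega>\<close> are
  irrelevant.
\<close>

definition L_inf_forms ::
    "(real ^ ('n::finite)) set \<Rightarrow> nat \<Rightarrow> (real ^ 'n \<Rightarrow> 'n form) set" where
  "L_inf_forms \<Omega> k = {\<omega>.
     (\<forall>x\<in>\<Omega>. \<omega> x \<in> alt_forms k) \<and>
     (\<forall>vs. (\<lambda>x. \<omega> x vs) \<in> borel_measurable (lebesgue_on \<Omega>)) \<and>
     (\<exists>C. AE x in lebesgue_on \<Omega>. form_norm k (\<omega> x) \<le> C)}"

definition L_1_forms ::
    "(real ^ ('n::finite)) set \<Rightarrow> nat \<Rightarrow> (real ^ 'n \<Rightarrow> 'n form) set" where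
  "L_1_forms \<Omega> k = {\<psi>.
     (\<forall>x\<in>\<Omega>. \<psi> x \<in> alt_forms k) \<and>
     (\<forall>vs. integrable (lebesgue_on \<Omega>) (\<lambda>x. \<psi> x vs))}"

definition weak_star_converges ::
    "(real ^ ('n::finite)) set \<Rightarrow> nat \<Rightarrow>
     (nat \<Rightarrow> real ^ 'n \<Rightarrow> 'n form) \<Rightarrow> (real ^ 'n \<Rightarrow> 'n form) \<Rightarrow> bool" where
  "weak_star_converges \<Omega> k \<omega>s \<omega> \<longleftrightarrow> (\<forall>\<psi>\<in>L_1_forms \<Omega> k.
     (\<lambda>\<nu>. LINT x|lebesgue_on \<Omega>. form_inner k (\<omega>s \<nu> x) (\<psi> x))
       \<longlonglongrightarrow> (LINT x|lebesgue_on \<Omega>. form_inner k (\<omega> x) (\<psi> x)))"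

text \<open>
  \<open>\<eta> = d\<omega>\<close> in the sense of distributions: for constant vectors \<open>v\<^sub>0, \<dots>, v\<^sub>p\<close>, the formula
  \<open>d\<omega> (v\<^sub>0, \<dots>, v\<^sub>p) = \<Sum>\<^sub>i (-1)\<^sup>i \<partial>\<^bsub>v\<^sub>i\<^esub> (\<omega> (v\<^sub>0, \<dots>, v\<^sub>p without v\<^sub>i))\<close> is tested against \<open>\<phi>\<close>, and the
  derivative is moved to \<open>\<phi>\<close>.
\<close>

definition is_weak_ext_deriv ::
    "(real ^ ('n::finite)) set \<Rightarrow> (real ^ 'n \<Rightarrow> 'n form) \<Rightarrow> (real ^ 'n \<Rightarrow> 'n form) \<Rightarrow> bool" where
  "is_weak_ext_deriv \<Omega> \<omega> \<eta> \<longleftrightarrow> (\<forall>\<phi>\<in>test_functions \<Omega>. \<forall>vs.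
     (LINT x|lebesgue_on \<Omega>. \<eta> x vs * \<phi> x) =
     - (\<Sum>i<length vs. (- 1) ^ i *
          (LINT x|lebesgue_on \<Omega>. \<omega> x (take i vs @ drop (Suc i) vs) * dir_deriv (vs ! i) \<phi> x)))"

definition W_d_inf ::
    "(real ^ ('n::finite)) set \<Rightarrow> nat \<Rightarrow> (real ^ 'n \<Rightarrow> 'n form) set" where
  "W_d_inf \<Omega> p =
     {\<omega> \<in> L_inf_forms \<Omega> p. \<exists>\<eta>\<in>L_inf_forms \<Omega> (Suc p). is_weak_ext_deriv \<Omega> \<omega> \<eta>}"


section \<open>Weak continuity and vectorial ext. one affinity\<close>

text \<open>
  \<open>\<eta>s \<nu> i\<close> and \<open>\<eta> i\<close> range over all bounded representatives of the weak exterior derivatives of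
  \<open>\<omega>s \<nu> i\<close> and \<open>\<omega> i\<close>. These agree almost everywhere, so the choice is immaterial.
\<close>

definition weakly_continuous_W_d_inf ::
    "nat \<Rightarrow> (nat \<Rightarrow> nat) \<Rightarrow> (real ^ ('n::finite)) set \<Rightarrow> ((nat \<Rightarrow> 'n form) \<Rightarrow> real) \<Rightarrow> bool" where
  "weakly_continuous_W_d_inf m k \<Omega> f \<longleftrightarrow>
     continuous_on (form_prod m k) f \<and>
     (\<forall>\<omega>s \<omega> \<eta>s \<eta>.
        (\<forall>i\<in>{1..m}.
           (\<forall>\<nu>. \<omega>s \<nu> i \<in> W_d_inf \<Omega> (k i - 1) \<and>
                 \<eta>s \<nu> i \<in> L_inf_forms \<Omega> (k i) \<and> is_weak_ext_deriv \<Omega> (\<omega>s \<nu> i) (\<eta>s \<nu> i)) \<and>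
           \<omega> i \<in> W_d_inf \<Omega> (k i - 1) \<and>
           \<eta> i \<in> L_inf_forms \<Omega> (k i) \<and> is_weak_ext_deriv \<Omega> (\<omega> i) (\<eta> i) \<and>
           weak_star_converges \<Omega> (k i - 1) (\<lambda>\<nu>. \<omega>s \<nu> i) (\<omega> i) \<and>
           weak_star_converges \<Omega> (k i) (\<lambda>\<nu>. \<eta>s \<nu> i) (\<eta> i))
        \<longrightarrow> distr_converges \<Omega>
              (\<lambda>\<nu> x. f (\<lambda>i\<in>{1..m}. \<eta>s \<nu> i x))
              (\<lambda>x. f (\<lambda>i\<in>{1..m}. \<eta> i x)))"

definition vectorially_ext_one_affine ::
    "nat \<Rightarrow> (nat \<Rightarrow> nat) \<Rightarrow> ((nat \<Rightarrow> ('n::finite) form) \<Rightarrow> real) \<Rightarrow> bool" where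
  "vectorially_ext_one_affine m k f \<longleftrightarrow>
     (\<forall>\<xi>\<in>form_prod m k. \<forall>\<alpha>\<in>alt_forms 1. \<forall>\<beta>\<in>form_prod m (\<lambda>i. k i - 1).
        \<exists>a b. \<forall>t::real.
          f (\<lambda>i\<in>{1..m}. \<lambda>vs. \<xi> i vs + t * (\<alpha> \<and>\<^sub>f \<beta> i) vs) = a + b * t)"

end

theory Submission
  imports Defs "HOL-Library.Function_Algebras"
begin

text \<open>
  Affinity along \<open>\<alpha> \<and> \<beta>\<close>: with \<open>a\<close> the vector representing \<open>\<alpha>\<close>, perturb a potential of the constant
  form \<open>\<xi>\<close> by \<open>(s / N) tri (N a\<bullet>x) \<beta>\<close>, where \<open>tri\<close> is a triangle wave. Its exterior derivative
  \<open>\<xi> \<plusminus> s \<alpha> \<and> \<beta>\<close> takes two values and converges weakly-* to \<open>\<xi>\<close>, so weak continuity yields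
  \<open>f \<xi> = (f (\<xi> + s \<alpha> \<and> \<beta>) + f (\<xi> - s \<alpha> \<and> \<beta>)) / 2\<close>; a continuous midpoint-affine function is affine.

  Representation: for \<open>f\<close> affine in these directions, the iterated difference of \<open>f\<close> along decomposable
  forms \<open>a\<^sub>1 \<and> \<dots> \<and> a\<^sub>k\<close>, \<open>a\<^sub>k\<^sub>+\<^sub>1 \<and> \<dots>\<close>, \<open>\<dots>\<close> is linear in every covector and vanishes as soon as two of
  them, in the same or in different factors, agree. It is therefore an alternating form in all covectors
  together, and its pairing with \<open>\<xi>\<^sup>\<alpha>\<close> is the Taylor coefficient of \<open>f\<close> of multidegree \<open>\<alpha>\<close>. The
  Taylor expansion is finite since alternating forms of degree above the dimension vanish.
\<close>

section \<open>Alternating forms and wedge products\<close>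

text \<open>The representation has no smoothness of \<open>f\<close> to start from, so derivatives
  are manufactured from differences: in a direction along which \<open>f\<close> is affine the unit
  difference is the derivative, and every form is a sum of decomposable ones. A mixed second
  difference along a \<and> \<beta> and a \<and> \<gamma> vanishes because the other diagonal of the
  parallelogram, a \<and> (\<gamma> - \<beta>), is again an admissible direction. For \<beta> and
  \<gamma> in different slots this diagonal moves both slots at once, which is where the vectorial
  form of affinity enters. The coefficients arise as alternating functions of covectors, whereas
  forms take vectors; the Euclidean product identifies the two. Wedge products, defined by sums over
  permutations, are then handled only under a pairing with an alternating form, where they become
  iterated contractions. In the analytic part \<open>f\<close> is nonlinear, and weak limits do not
  pass through it in general. A wave with only two values avoids this: \<open>f\<close> along the
  sequence is an affine function of the wave, whose weak limit is known.\<close>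

lemma alt_forms_length: "\<omega> \<in> alt_forms k \<Longrightarrow> length vs \<noteq> k \<Longrightarrow> \<omega> vs = 0"
  by (simp add: alt_forms_def)

lemma alt_forms_linear:
  "\<omega> \<in> alt_forms k \<Longrightarrow> length vs = k \<Longrightarrow> i < k \<Longrightarrow> linear (\<lambda>v. \<omega> (vs[i := v]))"
  by (simp add: alt_forms_def)

lemma alt_forms_repeat:
  "\<omega> \<in> alt_forms k \<Longrightarrow> i < j \<Longrightarrow> j < length vs \<Longrightarrow> vs ! i = vs ! j \<Longrightarrow> \<omega> vs = 0"
  by (cases "length vs = k") (simp_all add: alt_forms_def, blast)

lemma alt_formsI:
  assumes "\<And>vs. length vs \<noteq> k \<Longrightarrow> \<omega> vs = 0"
    and "\<And>vs i. length vs = k \<Longrightarrow> i < k \<Longrightarrow> linear (\<lambda>v. \<omega> (vs[i := v]))"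
    and "\<And>vs i j. length vs = k \<Longrightarrow> i < j \<Longrightarrow> j < k \<Longrightarrow> vs ! i = vs ! j \<Longrightarrow> \<omega> vs = 0"
  shows "\<omega> \<in> alt_forms k"
  using assms unfolding alt_forms_def by blast

lemma alt_forms_not_distinct:
  assumes "\<omega> \<in> alt_forms k" "\<not> distinct vs"
  shows "\<omega> vs = 0"
proof -
  obtain i j where "i < length vs" "j < length vs" "i \<noteq> j" "vs ! i = vs ! j"
    using assms(2) by (auto simp: distinct_conv_nth)
  then show ?thesis
    using alt_forms_repeat[OF assms(1)] by (metis linorder_neqE_nat)
qed

lemma linear_zero_fun: "linear (\<lambda>v. 0 :: real)"
  by (rule module_hom_zero)

lemma alt_forms_zero: "(\<lambda>vs. 0) \<in> alt_forms k"
  by (auto intro!: alt_formsI linear_zero_fun)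

lemma alt_forms_add:
  "\<omega> \<in> alt_forms k \<Longrightarrow> \<eta> \<in> alt_forms k \<Longrightarrow> (\<lambda>vs. \<omega> vs + \<eta> vs) \<in> alt_forms k"
  by (auto simp: alt_forms_def intro!: linear_compose_add)

lemma alt_forms_scale: "\<omega> \<in> alt_forms k \<Longrightarrow> (\<lambda>vs. c * \<omega> vs) \<in> alt_forms k"
proof -
  have "linear f \<Longrightarrow> linear (\<lambda>x. c * f x)" for f :: "real ^ 'a \<Rightarrow> real"
    using linear_compose_scale_right[of f c] by simp
  then show "\<omega> \<in> alt_forms k \<Longrightarrow> ?thesis"
    by (auto simp: alt_forms_def)
qed

lemma alt_forms_sum:
  "(\<And>x. x \<in> X \<Longrightarrow> \<omega> x \<in> alt_forms k) \<Longrightarrow> (\<lambda>vs. \<Sum>x\<in>X. \<omega> x vs) \<in> alt_forms k"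
  by (induction X rule: infinite_finite_induct)
    (simp_all add: alt_forms_zero alt_forms_add)

lemma alt_forms_append:
  assumes "\<omega> \<in> alt_forms (p + q)" "length ws = q"
  shows "(\<lambda>vs. \<omega> (vs @ ws)) \<in> alt_forms p"
proof (rule alt_formsI)
  show "linear (\<lambda>v. \<omega> (vs[i := v] @ ws))" if "length vs = p" "i < p" for vs i
    using alt_forms_linear[OF assms(1), of "vs @ ws" i] that assms(2)
    by (simp add: list_update_append)
  show "\<omega> (vs @ ws) = 0" if "length vs = p" "i < j" "j < p" "vs ! i = vs ! j" for vs i j
    using that assms by (intro alt_forms_repeat[of \<omega> "p + q" i j]) (auto simp: nth_append)
qed (use assms in \<open>auto intro: alt_forms_length\<close>)

lemma alt_forms_prepend:
  assumes "\<omega> \<in> alt_forms (p + q)" "length us = p"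
  shows "(\<lambda>vs. \<omega> (us @ vs)) \<in> alt_forms q"
proof (rule alt_formsI)
  show "linear (\<lambda>v. \<omega> (us @ vs[i := v]))" if "length vs = q" "i < q" for vs i
    using alt_forms_linear[OF assms(1), of "us @ vs" "p + i"] that assms(2)
    by (simp add: list_update_append)
  show "\<omega> (us @ vs) = 0" if "length vs = q" "i < j" "j < q" "vs ! i = vs ! j" for vs i j
    using that assms
    by (intro alt_forms_repeat[of \<omega> "p + q" "p + i" "p + j"]) (auto simp: nth_append)
qed (use assms in \<open>auto intro: alt_forms_length\<close>)

lemma alt_forms_Cons: "\<omega> \<in> alt_forms (Suc k) \<Longrightarrow> (\<lambda>vs. \<omega> (v # vs)) \<in> alt_forms k"
  using alt_forms_prepend[of \<omega> 1 k "[v]"] by simp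

lemma alt_forms_linear_hd: "\<omega> \<in> alt_forms k \<Longrightarrow> linear (\<lambda>v. \<omega> (v # vs))"
proof (cases "length (v # vs) = k")
  case True
  then show "\<omega> \<in> alt_forms k \<Longrightarrow> ?thesis"
    using alt_forms_linear[of \<omega> k "v # vs" 0] by auto
next
  case False
  then show "\<omega> \<in> alt_forms k \<Longrightarrow> ?thesis"
    by (simp add: alt_forms_length linear_zero_fun)
qed

text \<open>Polarisation: as a bilinear function of the entries \<open>i\<close> and
  \<open>j\<close>, the form vanishes on the diagonal, so expanding it at the sum of the two entries
  leaves only the mixed terms.\<close>

lemma alt_forms_swap:
  assumes "\<omega> \<in> alt_forms k" "length vs = k" "i < k" "j < k" "i \<noteq> j"
  shows "\<omega> (vs[i := vs ! j, j := vs ! i]) = - \<omega> vs"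
proof -
  define L where "L x y = \<omega> (vs[i := x, j := y])" for x y
  have ij: "(vs[i := x, j := x]) ! i = (vs[i := x, j := x]) ! j" for x
    using assms by (simp add: nth_list_update)
  have l1: "linear (\<lambda>x. L x y)" for y
    unfolding L_def using alt_forms_linear[OF assms(1), of "vs[j := y]" i] assms
    by (simp add: list_update_swap)
  have l2: "linear (\<lambda>y. L x y)" for x
    unfolding L_def using alt_forms_linear[OF assms(1), of "vs[i := x]" j] assms by simp
  have d: "L x x = 0" for x
    unfolding L_def using assms ij[of x]
      alt_forms_repeat[OF assms(1), of i j "vs[i := x, j := x]"]
      alt_forms_repeat[OF assms(1), of j i "vs[i := x, j := x]"]
    by (cases "i < j") simp_all
  have "L (vs ! i + vs ! j) (vs ! i + vs ! j) = L (vs ! i) (vs ! j) + L (vs ! j) (vs ! i)"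
    unfolding linear_add[OF l1] linear_add[OF l2] using d[of "vs ! i"] d[of "vs ! j"] by simp
  then have "L (vs ! j) (vs ! i) = - L (vs ! i) (vs ! j)"
    using d by simp
  then show ?thesis
    by (simp add: L_def)
qed

lemma alt_forms_swap_hd:
  assumes "\<omega> \<in> alt_forms k"
  shows "\<omega> (x # y # vs) = - \<omega> (y # x # vs)"
proof (cases "length (x # y # vs) = k")
  case True
  then show ?thesis
    using alt_forms_swap[OF assms, of "y # x # vs" 0 1] by simp
next
  case False
  then show ?thesis
    by (simp add: alt_forms_length[OF assms])
qed

lemma permute_list_transpose:
  assumes "i < length vs" "j < length vs"
  shows "permute_list (Transposition.transpose i j) vs = vs[i := vs ! j, j := vs ! i]"
proof (rule nth_equalityI)
  have p: "Transposition.transpose i j permutes {..<length vs}"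
    using assms by (intro permutes_swap_id) auto
  show "permute_list (Transposition.transpose i j) vs ! l = vs[i := vs ! j, j := vs ! i] ! l"
    if "l < length (permute_list (Transposition.transpose i j) vs)" for l
    using assms that by (simp add: permute_list_nth[OF p] Transposition.transpose_def nth_list_update)
qed simp

lemma alt_forms_permute:
  assumes "\<sigma> permutes {..<length vs}" "\<omega> \<in> alt_forms k"
  shows "\<omega> (permute_list \<sigma> vs) = of_int (sign \<sigma>) * \<omega> vs"
proof (cases "length vs = k")
  case True
  \<comment> \<open>Quantified over \<open>vs\<close>, because the induction hypothesis is applied
    to the list that is already transposed.\<close>
  have "\<forall>vs. length vs = k \<longrightarrow> \<omega> (permute_list \<sigma> vs) = of_int (sign \<sigma>) * \<omega> vs"
    using assms(1)[unfolded True] finite_lessThan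
  proof (induction rule: permutes_induct)
    case id
    then show ?case by simp
  next
    case (swap i j \<sigma>)
    show ?case
    proof (intro allI impI)
      fix vs :: "(real ^ 'a) list"
      assume len: "length vs = k"
      have s: "sign (Transposition.transpose i j \<circ> \<sigma>) = - sign \<sigma>"
        using swap by (simp add: sign_compose sign_swap_id permutation_swap_id
            permutes_imp_permutation[OF finite_lessThan])
      have "\<omega> (permute_list (Transposition.transpose i j \<circ> \<sigma>) vs)
          = \<omega> (permute_list \<sigma> (permute_list (Transposition.transpose i j) vs))"
        using swap len by (simp add: permute_list_compose)
      also have "\<dots> = of_int (sign \<sigma>) * \<omega> (permute_list (Transposition.transpose i j) vs)"
        using swap len by simp
      also have "\<omega> (permute_list (Transposition.transpose i j) vs) = - \<omega> vs"
        using swap len alt_forms_swap[OF assms(2) len] by (simp add: permute_list_transpose)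
      finally show "\<omega> (permute_list (Transposition.transpose i j \<circ> \<sigma>) vs)
          = of_int (sign (Transposition.transpose i j \<circ> \<sigma>)) * \<omega> vs"
        by (simp add: s del: comp_apply)
    qed
  qed
  then show ?thesis using True by blast
next
  case False
  then show ?thesis
    by (simp add: alt_forms_length[OF assms(2)])
qed

lemma alt_forms_move:
  "\<omega> \<in> alt_forms k \<Longrightarrow> \<omega> (x # xs @ ys) = (- 1) ^ length xs * \<omega> (xs @ x # ys)"
proof (induction xs arbitrary: \<omega> k)
  case Nil
  then show ?case by simp
next
  case (Cons y xs)
  show ?case
  proof (cases k)
    case 0
    then show ?thesis using Cons.prems by (simp add: alt_forms_length)
  next
    case (Suc k')
    have "\<omega> (y # x # xs @ ys) = (- 1) ^ length xs * \<omega> (y # xs @ x # ys)"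
      using Cons.IH[OF alt_forms_Cons[OF Cons.prems[unfolded Suc]]] .
    then show ?thesis
      using alt_forms_swap_hd[OF Cons.prems, of x y "xs @ ys"] by simp
  qed
qed

text \<open>The sign is that of the cycle bringing entry \<open>i\<close> to the front. It cancels
  the alternating signs in \<open>ewedge_expand\<close> and in the weak exterior derivative.\<close>

lemma alt_forms_nth_to_front:
  assumes "\<omega> \<in> alt_forms k" "i < length vs"
  shows "(- 1) ^ i * \<omega> (vs ! i # take i vs @ drop (Suc i) vs) = \<omega> vs"
proof -
  have "\<omega> (vs ! i # take i vs @ drop (Suc i) vs)
      = (- 1) ^ i * \<omega> (take i vs @ vs ! i # drop (Suc i) vs)"
    using alt_forms_move[OF assms(1), of "vs ! i" "take i vs"] assms(2) by simp
  then show ?thesis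
    using assms(2) by (simp flip: id_take_nth_drop power_mult_distrib mult.assoc)
qed

text \<open>\<open>a \<and> \<beta>\<close> for a vector \<open>a\<close> regarded as a 1-form.\<close>

fun ewedge :: "real ^ 'n \<Rightarrow> ('n::finite) form \<Rightarrow> 'n form" where
  "ewedge a \<beta> [] = 0"
| "ewedge a \<beta> (v # vs) = (a \<bullet> v) * \<beta> vs - ewedge a (\<lambda>ws. \<beta> (v # ws)) vs"

text \<open>The recursion serves inductions on the argument list; this closed sum serves linearity
  and matches the shape of the weak exterior derivative.\<close>

lemma ewedge_expand:
  "ewedge a \<beta> vs
    = (\<Sum>i<length vs. (- 1) ^ i * (a \<bullet> vs ! i) * \<beta> (take i vs @ drop (Suc i) vs))"
proof (induction vs arbitrary: \<beta>)
  case Nil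
  then show ?case by simp
next
  case (Cons v vs)
  show ?case
    by (simp add: Cons.IH sum.lessThan_Suc_shift sum_negf del: sum.lessThan_Suc)
qed

lemma ewedge_add_left: "ewedge (a + b) \<beta> vs = ewedge a \<beta> vs + ewedge b \<beta> vs"
  by (simp add: ewedge_expand sum.distrib inner_left_distrib algebra_simps)

lemma ewedge_scale_left: "ewedge (c *\<^sub>R a) \<beta> vs = c * ewedge a \<beta> vs"
  by (simp add: ewedge_expand sum_distrib_left algebra_simps)

lemma ewedge_add_right: "ewedge a (\<lambda>vs. \<beta> vs + \<gamma> vs) vs = ewedge a \<beta> vs + ewedge a \<gamma> vs"
  by (simp add: ewedge_expand sum.distrib algebra_simps)

lemma ewedge_scale_right: "ewedge a (\<lambda>vs. c * \<beta> vs) vs = c * ewedge a \<beta> vs"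
  by (simp add: ewedge_expand sum_distrib_left algebra_simps)

lemma ewedge_zero_right: "ewedge a (\<lambda>vs. 0) vs = 0"
  by (simp add: ewedge_expand)

lemma ewedge_sum_right:
  "ewedge a (\<lambda>vs. \<Sum>x\<in>X. \<beta> x vs) vs = (\<Sum>x\<in>X. ewedge a (\<beta> x) vs)"
  by (induction X rule: infinite_finite_induct) (simp_all add: ewedge_zero_right ewedge_add_right)

lemma ewedge_diff_right: "ewedge a (\<lambda>vs. \<beta> vs - \<gamma> vs) vs = ewedge a \<beta> vs - ewedge a \<gamma> vs"
  using ewedge_add_right[of a "\<lambda>vs. \<beta> vs - \<gamma> vs" \<gamma> vs] by simp

text \<open>Unfolding both products at the head \<open>v\<close>, the two terms with
  \<open>a \<bullet> v\<close> cancel, and what remains is the same expression for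
  \<open>\<lambda>ws. \<beta> (v # ws)\<close>.\<close>

lemma ewedge_twice: "ewedge a (ewedge a \<beta>) vs = 0"
proof (induction vs arbitrary: \<beta>)
  case Nil
  then show ?case by simp
next
  case (Cons v vs)
  show ?case
    by (simp add: ewedge_diff_right ewedge_scale_right Cons.IH)
qed

text \<open>Polarisation of \<open>ewedge_twice\<close> at \<open>a + b\<close>.\<close>

lemma ewedge_swap: "ewedge a (ewedge b \<beta>) vs = - ewedge b (ewedge a \<beta>) vs"
proof -
  have "ewedge (a + b) \<beta> = (\<lambda>vs. ewedge a \<beta> vs + ewedge b \<beta> vs)"
    by (simp add: fun_eq_iff ewedge_add_left)
  then have "ewedge (a + b) (ewedge (a + b) \<beta>) vs
      = ewedge a (ewedge b \<beta>) vs + ewedge b (ewedge a \<beta>) vs"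
    by (simp add: ewedge_add_left ewedge_add_right ewedge_twice)
  then show ?thesis
    by (simp add: ewedge_twice)
qed

section \<open>Decomposable forms: \<open>cov as vs\<close> is the determinant of the products of
  covectors and vectors, by Laplace expansion\<close>

fun cov :: "(real ^ 'n) list \<Rightarrow> ('n::finite) form" where
  "cov [] = form_one"
| "cov (a # as) = ewedge a (cov as)"

lemma cov_length: "length vs \<noteq> length as \<Longrightarrow> cov as vs = 0"
  by (induction as arbitrary: vs) (auto simp: form_one_def ewedge_expand intro!: sum.neutral)

lemma cov_linear: "i < length as \<Longrightarrow> linear (\<lambda>a. cov (as[i := a]) vs)"
proof (induction as arbitrary: i vs)
  case Nil
  then show ?case by simp
next
  case (Cons b as)
  show ?case
  proof (cases i)
    case 0
    then show ?thesis
      by (auto intro!: linearI simp: ewedge_add_left ewedge_scale_left)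
  next
    case (Suc j)
    then have *: "linear (\<lambda>a. cov (as[j := a]) vs)" for vs
      using Cons by simp
    have "cov (as[j := a + a']) = (\<lambda>vs. cov (as[j := a]) vs + cov (as[j := a']) vs)"
      "cov (as[j := c *\<^sub>R a]) = (\<lambda>vs. c * cov (as[j := a]) vs)" for a a' c
      by (simp_all add: fun_eq_iff linear_add[OF *] linear_scale[OF *])
    then show ?thesis
      using Suc by (auto intro!: linearI simp: ewedge_add_right ewedge_scale_right)
  qed
qed

lemma cov_mem: "a \<in> set as \<Longrightarrow> ewedge a (cov as) vs = 0"
proof (induction as arbitrary: vs)
  case Nil
  then show ?case by simp
next
  case (Cons b as)
  show ?case
  proof (cases "a = b")
    case True
    then show ?thesis by (simp add: ewedge_twice)
  next
    case False
    then have "ewedge a (cov as) = (\<lambda>vs. 0)"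
      using Cons by auto
    then show ?thesis
      using ewedge_swap[of a b "cov as" vs] by (simp add: ewedge_zero_right)
  qed
qed

lemma cov_not_distinct: "\<not> distinct as \<Longrightarrow> cov as vs = 0"
proof (induction as arbitrary: vs)
  case Nil
  then show ?case by simp
next
  case (Cons b as)
  show ?case
  proof (cases "b \<in> set as")
    case True
    then show ?thesis by (simp add: cov_mem)
  next
    case False
    then have "cov as = (\<lambda>vs. 0)"
      using Cons by auto
    then show ?thesis by (simp add: ewedge_zero_right)
  qed
qed

text \<open>A determinant alternates in its rows as well as in its columns. Fixing \<open>vs\<close>
  and reading the covectors as arguments therefore gives a form that can be paired with wedge
  products.\<close>

lemma cov_alt_in_covectors: "(\<lambda>as. cov as vs) \<in> alt_forms (length vs)"
proof (rule alt_formsI)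
  show "cov as vs = 0" if "length as = length vs" "i < j" "j < length vs" "as ! i = as ! j" for as i j
    using that by (intro cov_not_distinct) (force simp: distinct_conv_nth)
qed (auto intro: cov_length cov_linear)

text \<open>An Euler identity: contracting with a basis vector and wedging with the same covector,
  summed over the basis, multiplies by the degree. Each position \<open>i\<close> rebuilds
  \<open>vs ! i\<close> from its coordinates and returns \<open>\<xi> vs\<close> once.\<close>

lemma alt_forms_ewedge_expand:
  assumes "\<xi> \<in> alt_forms k" "length vs = k"
  shows "(\<Sum>x\<in>UNIV. ewedge (axis x 1) (\<lambda>ws. \<xi> (axis x 1 # ws)) vs) = real k * \<xi> vs"
proof -
  have "(\<Sum>x\<in>UNIV. ewedge (axis x 1) (\<lambda>ws. \<xi> (axis x 1 # ws)) vs)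
      = (\<Sum>i<k. (- 1) ^ i *
          (\<Sum>x\<in>UNIV. (axis x 1 \<bullet> vs ! i) * \<xi> (axis x 1 # take i vs @ drop (Suc i) vs)))"
    by (subst sum_distrib_left, subst sum.swap)
      (simp add: ewedge_expand assms(2) mult.assoc)
  also have "\<dots> = (\<Sum>i<k. \<xi> vs)"
  proof (intro sum.cong refl)
    fix i assume i: "i \<in> {..<k}"
    note l = alt_forms_linear_hd[OF assms(1)]
    have "\<xi> (vs ! i # ws) = (\<Sum>x\<in>UNIV. (axis x 1 \<bullet> vs ! i) * \<xi> (axis x 1 # ws))" for ws
    proof -
      have "vs ! i = (\<Sum>x\<in>UNIV. (vs ! i $ x) *\<^sub>R axis x 1)"
        using basis_expansion[of "vs ! i"] by (simp add: scalar_mult_eq_scaleR)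
      then have "\<xi> (vs ! i # ws) = (\<Sum>x\<in>UNIV. \<xi> ((vs ! i $ x) *\<^sub>R axis x 1 # ws))"
        using linear_sum[OF l] by metis
      then show ?thesis
        using linear_scale[OF l] by (simp add: inner_axis inner_commute[of "axis _ _"])
    qed
    then show "(- 1) ^ i * (\<Sum>x\<in>UNIV. (axis x 1 \<bullet> vs ! i) * \<xi> (axis x 1 # take i vs @ drop (Suc i) vs))
        = \<xi> vs"
      using alt_forms_nth_to_front[OF assms(1), of i vs] i assms(2) by simp
  qed
  finally show ?thesis by simp
qed

section \<open>Expansion in basis covectors\<close>

abbreviation bas :: "'n list \<Rightarrow> (real ^ ('n::finite)) list" where
  "bas \<equiv> map (\<lambda>i. axis i 1)"

lemma finite_lists_length: "finite {I :: ('n::finite) list. length I = k}"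
  using finite_lists_length_eq[of "UNIV :: 'n set" k] by simp

lemma sum_lists_add:
  fixes F :: "('n::finite) list \<Rightarrow> real"
  shows "(\<Sum>I | length I = p + q. F I)
    = (\<Sum>I | length I = p. \<Sum>J | length J = q. F (I @ J))"
proof -
  have "(\<Sum>I | length I = p. \<Sum>J | length J = q. F (I @ J))
      = (\<Sum>(I, J)\<in>{I. length I = p} \<times> {J. length J = q}. F (I @ J))"
    by (simp add: sum.cartesian_product)
  also have "\<dots> = (\<Sum>I | length I = p + q. F I)"
    by (rule sum.reindex_bij_witness[where i = "\<lambda>L. (take p L, drop p L)" and j = "\<lambda>(I, J). I @ J"])
      auto
  finally show ?thesis ..
qed

lemma sum_lists_Suc:
  fixes F :: "('n::finite) list \<Rightarrow> real"
  shows "(\<Sum>I | length I = Suc p. F I) = (\<Sum>x\<in>UNIV. \<Sum>J | length J = p. F (x # J))"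
proof -
  have "(\<Sum>x\<in>UNIV. \<Sum>J | length J = p. F (x # J))
      = (\<Sum>(x, J)\<in>UNIV \<times> {J. length J = p}. F (x # J))"
    by (simp add: sum.cartesian_product)
  also have "\<dots> = (\<Sum>I | length I = Suc p. F I)"
    by (rule sum.reindex_bij_witness[where i = "\<lambda>L. (hd L, tl L)" and j = "\<lambda>(x, J). x # J"])
      (auto simp: length_Suc_conv)
  finally show ?thesis ..
qed

text \<open>Iterates the Euler identity over the degrees k, k - 1, ..., 1, which produces the
  factorial. Equivalently, the sum runs over all tuples and meets each increasing one k!
  times.\<close>

lemma alt_forms_expand:
  assumes "\<xi> \<in> alt_forms k"
  shows "(\<Sum>I | length I = k. \<xi> (bas I) * cov (bas I) vs) = fact k * \<xi> vs"
  using assms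
proof (induction k arbitrary: \<xi> vs)
  case 0
  then show ?case
    by (auto simp: form_one_def alt_forms_length)
next
  case (Suc k)
  have "(\<Sum>I | length I = Suc k. \<xi> (bas I) * cov (bas I) vs)
      = (\<Sum>x\<in>UNIV. ewedge (axis x 1) (\<lambda>ws. \<Sum>J | length J = k. \<xi> (axis x 1 # bas J) * cov (bas J) ws) vs)"
    by (simp add: sum_lists_Suc ewedge_sum_right ewedge_scale_right)
  also have "\<dots> = (\<Sum>x\<in>UNIV. ewedge (axis x 1) (\<lambda>ws. fact k * \<xi> (axis x 1 # ws)) vs)"
    by (simp add: Suc.IH[OF alt_forms_Cons[OF Suc.prems]])
  also have "\<dots> = fact k * (\<Sum>x\<in>UNIV. ewedge (axis x 1) (\<lambda>ws. \<xi> (axis x 1 # ws)) vs)"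
    by (simp add: ewedge_scale_right sum_distrib_left)
  also have "\<dots> = fact (Suc k) * \<xi> vs"
  proof (cases "length vs = Suc k")
    case True
    then show ?thesis
      using alt_forms_ewedge_expand[OF Suc.prems True] by simp
  next
    case False
    then show ?thesis
      using Suc.prems by (auto simp: alt_forms_length ewedge_expand intro!: sum.neutral)
  qed
  finally show ?case .
qed

text \<open>The determinants are a reproducing kernel for the scalar product, so forms can be
  compared through their pairings alone.\<close>

lemma form_inner_cov:
  assumes "\<xi> \<in> alt_forms k"
  shows "form_inner k (\<lambda>as. cov as vs) \<xi> = \<xi> vs"
  using alt_forms_expand[OF assms, of vs] by (simp add: form_inner_def mult.commute)

section \<open>The wedge product and its pairing with alternating forms\<close>

lemma wedge_eq:
  assumes "\<And>us. length us \<noteq> p \<Longrightarrow> \<omega> us = 0" "length vs = p + q"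
  shows "(\<omega> \<and>\<^sub>f \<eta>) vs
    = (\<Sum>\<sigma> | \<sigma> permutes {..<length vs}.
         of_int (sign \<sigma>) * \<omega> (take p (permute_list \<sigma> vs)) * \<eta> (drop p (permute_list \<sigma> vs)))
      / (fact p * fact q)"
proof -
  have "(\<omega> \<and>\<^sub>f \<eta>) vs = (\<Sum>j\<in>{p}.
        (\<Sum>\<sigma> | \<sigma> permutes {..<length vs}.
           of_int (sign \<sigma>) * \<omega> (take j (permute_list \<sigma> vs)) * \<eta> (drop j (permute_list \<sigma> vs)))
        / (fact j * fact (length vs - j)))"
    unfolding wedge_def by (rule sum.mono_neutral_right) (use assms in auto)
  then show ?thesis
    using assms(2) by simp
qed

lemma wedge_length:
  assumes "\<And>us. length us \<noteq> p \<Longrightarrow> \<omega> us = 0" "\<And>us. length us \<noteq> q \<Longrightarrow> \<eta> us = 0"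
    and "length vs \<noteq> p + q"
  shows "(\<omega> \<and>\<^sub>f \<eta>) vs = 0"
proof -
  have "\<omega> (take j (permute_list \<sigma> vs)) * \<eta> (drop j (permute_list \<sigma> vs)) = 0"
    if "j \<le> length vs" for j \<sigma>
  proof (cases "j = p")
    case True
    then show ?thesis
      using assms(2)[of "drop j (permute_list \<sigma> vs)"] assms(3) that by simp
  next
    case False
    then show ?thesis
      using assms(1)[of "take j (permute_list \<sigma> vs)"] that by simp
  qed
  then show ?thesis
    unfolding wedge_def by (auto intro!: sum.neutral simp: mult.assoc)
qed

lemma permute_list_update:
  assumes "\<sigma> permutes {..<length vs}" "i < length vs"
  shows "permute_list \<sigma> (vs[i := v]) = (permute_list \<sigma> vs)[inv \<sigma> i := v]"
proof (rule nth_equalityI)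
  fix l assume "l < length (permute_list \<sigma> (vs[i := v]))"
  then have l: "l < length vs" by simp
  have "\<sigma> l = i \<longleftrightarrow> inv \<sigma> i = l"
    using permutes_inv_eq[OF assms(1)] by metis
  moreover have "\<sigma> permutes {..<length (vs[i := v])}"
    using assms by simp
  ultimately show "permute_list \<sigma> (vs[i := v]) ! l = (permute_list \<sigma> vs)[inv \<sigma> i := v] ! l"
    using l assms permutes_in_image[OF assms(1), of l]
    by (auto simp: permute_list_nth nth_list_update)
qed simp

lemma linear_times_const:
  fixes f :: "'a::real_vector \<Rightarrow> real"
  shows "linear f \<Longrightarrow> linear (\<lambda>v. c * f v * d)"
  by (auto simp: linear_iff algebra_simps)

lemma wedge_alt_forms:
  assumes \<omega>: "\<omega> \<in> alt_forms p" and \<eta>: "\<eta> \<in> alt_forms q"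
  shows "\<omega> \<and>\<^sub>f \<eta> \<in> alt_forms (p + q)"
proof (rule alt_formsI)
  show "(\<omega> \<and>\<^sub>f \<eta>) vs = 0" if "length vs \<noteq> p + q" for vs
    using wedge_length[of p \<omega> q \<eta> vs] alt_forms_length[OF \<omega>] alt_forms_length[OF \<eta>] that by blast
  note eq = wedge_eq[of p \<omega> _ q \<eta>, OF alt_forms_length[OF \<omega>]]
  define F where "F vs = \<omega> (take p vs) * \<eta> (drop p vs)" for vs
  have F: "(\<omega> \<and>\<^sub>f \<eta>) vs = (\<Sum>\<sigma> | \<sigma> permutes {..<p + q}. of_int (sign \<sigma>) * F (permute_list \<sigma> vs))
      / (fact p * fact q)" if "length vs = p + q" for vs
    using eq[of vs] that by (simp add: F_def mult.assoc)
  show "linear (\<lambda>v. (\<omega> \<and>\<^sub>f \<eta>) (vs[i := v]))" if "length vs = p + q" "i < p + q" for vs i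
  proof -
    have lF: "linear (\<lambda>v. F (ws[l := v]))" if "length ws = p + q" "l < p + q" for ws l
    proof (cases "l < p")
      case True
      then show ?thesis
        using linear_times_const[OF alt_forms_linear[OF \<omega>, of "take p ws" l], of 1] that
        by (simp add: F_def take_update_swap)
    next
      case False
      then show ?thesis
        using linear_times_const[OF alt_forms_linear[OF \<eta>, of "drop p ws" "l - p"], of _ 1] that
        by (simp add: F_def drop_update_swap)
    qed
    have "linear (\<lambda>v. F (permute_list \<sigma> (vs[i := v])))" if \<sigma>: "\<sigma> permutes {..<p + q}" for \<sigma>
    proof -
      have "inv \<sigma> i < p + q"
        using permutes_in_image[OF permutes_inv[OF \<sigma>], of i] \<open>i < p + q\<close> by simp
      then show ?thesis
        using lF[of "permute_list \<sigma> vs" "inv \<sigma> i"] \<sigma> \<open>length vs = p + q\<close> \<open>i < p + q\<close>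
        by (simp add: permute_list_update)
    qed
    then have "linear (\<lambda>v. \<Sum>\<sigma> | \<sigma> permutes {..<p + q}.
        of_int (sign \<sigma>) * F (permute_list \<sigma> (vs[i := v])) * 1)"
      by (intro linear_compose_sum ballI linear_times_const) auto
    then show ?thesis
      using linear_times_const[of _ 1 "inverse (fact p * fact q)"] that
      by (simp add: F field_class.field_divide_inverse)
  qed
  show "(\<omega> \<and>\<^sub>f \<eta>) vs = 0"
    if "length vs = p + q" "i < j" "j < p + q" "vs ! i = vs ! j" for vs i j
  proof -
    let ?t = "Transposition.transpose i j"
    let ?S = "\<Sum>\<sigma> | \<sigma> permutes {..<p + q}. of_int (sign \<sigma>) * F (permute_list \<sigma> vs)"
    have t: "?t permutes {..<p + q}"
      using that by (intro permutes_swap_id) auto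
    \<comment> \<open>Composition with the transposition reindexes the permutations, reverses the
      sign and fixes \<open>vs\<close>, so the sum is its own negative.\<close>
    have "?S = (\<Sum>\<sigma> | \<sigma> permutes {..<p + q}.
        of_int (sign (?t \<circ> \<sigma>)) * F (permute_list (?t \<circ> \<sigma>) vs))"
      by (rule setum_permutations_compose_left[OF t])
    also have "\<dots> = (\<Sum>\<sigma> | \<sigma> permutes {..<p + q}. - (of_int (sign \<sigma>) * F (permute_list \<sigma> vs)))"
    proof (intro sum.cong refl)
      fix \<sigma> assume "\<sigma> \<in> {\<sigma>. \<sigma> permutes {..<p + q}}"
      then have \<sigma>: "\<sigma> permutes {..<p + q}" by simp
      have "sign (?t \<circ> \<sigma>) = - sign \<sigma>"
        using that by (simp add: sign_compose sign_swap_id permutation_swap_id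
            permutes_imp_permutation[OF finite_lessThan \<sigma>])
      moreover have "permute_list ?t vs = vs"
        using that by (simp add: permute_list_transpose) (metis list_update_id)
      then have "permute_list (?t \<circ> \<sigma>) vs = permute_list \<sigma> vs"
        using \<sigma> that by (simp add: permute_list_compose del: comp_apply)
      ultimately show "of_int (sign (?t \<circ> \<sigma>)) * F (permute_list (?t \<circ> \<sigma>) vs)
          = - (of_int (sign \<sigma>) * F (permute_list \<sigma> vs))"
        by (simp del: comp_apply)
    qed
    finally have "?S = 0"
      by (simp add: sum_negf)
    then show ?thesis
      using F that by simp
  qed
qed

text \<open>The adjoint form of the wedge product: \<open>C\<close> is contracted first with \<open>\<eta>\<close>, then with \<open>\<omega>\<close>. It avoids
  all shuffle combinatorics below.\<close>

lemma form_inner_wedge: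
  fixes C :: "('n::finite) form"
  assumes C: "C \<in> alt_forms (p + q)" and \<omega>: "\<And>us. length us \<noteq> p \<Longrightarrow> \<omega> us = 0"
  shows "form_inner (p + q) C (\<omega> \<and>\<^sub>f \<eta>)
    = form_inner p (\<lambda>us. form_inner q (\<lambda>vs. C (us @ vs)) \<eta>) \<omega>"
proof -
  let ?N = "p + q" and ?P = "{\<sigma>. \<sigma> permutes {..<p + q}}"
  define H where "H L = \<omega> (bas (take p L)) * \<eta> (bas (drop p L))" for L :: "'n list"
  have W: "(\<omega> \<and>\<^sub>f \<eta>) (bas L) = (\<Sum>\<sigma>\<in>?P. of_int (sign \<sigma>) * H (permute_list \<sigma> L)) / (fact p * fact q)"
    if "length L = ?N" for L
    using wedge_eq[of p \<omega> "bas L" q \<eta>, OF \<omega>] that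
    by (auto simp: H_def permute_list_map take_map drop_map mult.assoc intro!: sum.cong)
  have "(\<Sum>L | length L = ?N. C (bas L) * (\<omega> \<and>\<^sub>f \<eta>) (bas L))
      = (\<Sum>L | length L = ?N. \<Sum>\<sigma>\<in>?P. C (bas (permute_list \<sigma> L)) * H (permute_list \<sigma> L))
        / (fact p * fact q)"
    unfolding sum_divide_distrib
  proof (intro sum.cong refl)
    fix L :: "'n list" assume "L \<in> {L. length L = ?N}"
    then have L: "length L = ?N" by simp
    \<comment> \<open>\<open>C\<close> alternates and absorbs the sign of \<open>\<sigma>\<close>.
      After reindexing, every permutation contributes the same sum, and their number (p + q)!
      cancels the factorial in \<open>form_inner\<close>.\<close>
    have "C (bas (permute_list \<sigma> L)) = of_int (sign \<sigma>) * C (bas L)" if "\<sigma> \<in> ?P" for \<sigma>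
      using alt_forms_permute[OF _ C, of \<sigma> "bas L"] that L by (simp add: permute_list_map)
    then show "C (bas L) * (\<omega> \<and>\<^sub>f \<eta>) (bas L)
        = (\<Sum>\<sigma>\<in>?P. C (bas (permute_list \<sigma> L)) * H (permute_list \<sigma> L) / (fact p * fact q))"
      by (simp add: W[OF L] sum_distrib_left sum_divide_distrib algebra_simps)
  qed
  also have "(\<Sum>L | length L = ?N. \<Sum>\<sigma>\<in>?P. C (bas (permute_list \<sigma> L)) * H (permute_list \<sigma> L))
      = (\<Sum>\<sigma>\<in>?P. \<Sum>L | length L = ?N. C (bas (permute_list \<sigma> L)) * H (permute_list \<sigma> L))"
    by (rule sum.swap)
  also have "\<dots> = (\<Sum>\<sigma>\<in>?P. \<Sum>L | length L = ?N. C (bas L) * H L)"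
  proof (rule sum.cong[OF refl])
    fix \<sigma> assume "\<sigma> \<in> ?P"
    then have \<sigma>: "\<sigma> permutes {..<?N}" by simp
    have inv: "permute_list (inv \<sigma>) (permute_list \<sigma> L) = L"
      "permute_list \<sigma> (permute_list (inv \<sigma>) L) = L" if "length L = ?N" for L :: "'n list"
      using that \<sigma> permutes_inv[OF \<sigma>] permutes_inv_o[OF \<sigma>]
      by (simp_all flip: permute_list_compose)
    show "(\<Sum>L | length L = ?N. C (bas (permute_list \<sigma> L)) * H (permute_list \<sigma> L))
        = (\<Sum>L | length L = ?N. C (bas L) * H L)"
      by (rule sum.reindex_bij_witness[where i = "permute_list (inv \<sigma>)" and j = "permute_list \<sigma>"])
        (auto simp: inv)
  qed
  also have "\<dots> = fact ?N * (\<Sum>L | length L = ?N. C (bas L) * H L)"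
    by (simp add: card_permutations)
  also have "(\<Sum>L | length L = ?N. C (bas L) * H L)
      = (\<Sum>I | length I = p. \<Sum>J | length J = q. C (bas I @ bas J) * \<eta> (bas J) * \<omega> (bas I))"
    unfolding sum_lists_add by (intro sum.cong refl) (simp add: H_def)
  finally show ?thesis
    by (simp add: form_inner_def sum_divide_distrib sum_distrib_right sum_distrib_left field_simps)
qed

lemma ewedge_sum_left: "ewedge (\<Sum>x\<in>X. a x) \<beta> vs = (\<Sum>x\<in>X. ewedge (a x) \<beta> vs)"
proof (induction X rule: infinite_finite_induct)
  case (insert x X)
  then show ?case by (simp add: ewedge_add_left)
qed (simp_all add: ewedge_expand)

text \<open>Both sides are evaluated by pairing with \<open>\<lambda>as. cov as vs\<close>, which reproduces a form's value at \<open>vs\<close>.\<close>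

lemma wedge_one_form:
  fixes \<alpha> \<beta> :: "('n::finite) form"
  assumes \<alpha>: "\<alpha> \<in> alt_forms 1" and \<beta>: "\<beta> \<in> alt_forms k"
  shows "\<alpha> \<and>\<^sub>f \<beta> = ewedge (\<chi> x. \<alpha> [axis x 1]) \<beta>"
proof
  fix vs :: "(real ^ 'n) list"
  note w = wedge_alt_forms[OF \<alpha> \<beta>]
  show "(\<alpha> \<and>\<^sub>f \<beta>) vs = ewedge (\<chi> x. \<alpha> [axis x 1]) \<beta> vs"
  proof (cases "length vs = 1 + k")
    case True
    \<comment> \<open>Pairing over \<open>ws\<close> is a linear combination, so it passes through
      \<open>ewedge a\<close> and meets the reproducing property of \<open>cov\<close>.\<close>
    have e: "form_inner k (\<lambda>ws. ewedge a (cov ws) vs) \<beta> = ewedge a \<beta> vs" for a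
    proof -
      have "form_inner k (\<lambda>ws. ewedge a (cov ws) vs) \<beta>
          = ewedge a (\<lambda>us. form_inner k (\<lambda>ws. cov ws us) \<beta>) vs"
        unfolding form_inner_def divide_inverse mult.commute[of _ "inverse _"]
        by (simp add: ewedge_scale_right ewedge_sum_right mult.commute[of _ "\<beta> _"])
      then show ?thesis
        by (simp add: form_inner_cov[OF \<beta>])
    qed
    have "(\<alpha> \<and>\<^sub>f \<beta>) vs = form_inner (1 + k) (\<lambda>as. cov as vs) (\<alpha> \<and>\<^sub>f \<beta>)"
      by (simp only: form_inner_cov[OF w])
    also have "\<dots> = form_inner 1 (\<lambda>us. form_inner k (\<lambda>ws. cov (us @ ws) vs) \<beta>) \<alpha>"
      using cov_alt_in_covectors[of vs] alt_forms_length[OF \<alpha>] True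
      by (intro form_inner_wedge) auto
    also have "\<dots> = (\<Sum>x\<in>UNIV. \<alpha> [axis x 1] * ewedge (axis x 1) \<beta> vs)"
      using sum_lists_Suc[where p = 0 and F = "\<lambda>I. form_inner k (\<lambda>ws. cov (bas I @ ws) vs) \<beta> * \<alpha> (bas I)"]
      by (simp add: form_inner_def[of "Suc 0"] e mult.commute)
    also have "\<dots> = ewedge (\<Sum>x\<in>UNIV. \<alpha> [axis x 1] *\<^sub>R axis x 1) \<beta> vs"
      by (simp add: ewedge_sum_left ewedge_scale_left)
    also have "(\<Sum>x\<in>UNIV. \<alpha> [axis x 1] *\<^sub>R axis x 1) = (\<chi> x. \<alpha> [axis x 1])"
      using basis_expansion[of "\<chi> x. \<alpha> [axis x 1]"] by (simp add: scalar_mult_eq_scaleR)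
    finally show ?thesis .
  next
    case False
    then show ?thesis
      using alt_forms_length[OF w] alt_forms_length[OF \<beta>]
      by (auto simp: ewedge_expand intro!: sum.neutral)
  qed
qed

lemma cov_singleton: "cov [a] \<in> alt_forms 1" "cov [a] [v] = a \<bullet> v"
proof -
  show *: "cov [a] [v] = a \<bullet> v" for v
    by (simp add: form_one_def)
  have "linear (\<lambda>v. cov [a] (vs[i := v]))" if "length vs = 1" "i < 1" for vs i
  proof -
    obtain w where "vs = [w]"
      using \<open>length vs = 1\<close> by (auto simp: length_Suc_conv)
    then have "(\<lambda>v. cov [a] (vs[i := v])) = (\<lambda>v. a \<bullet> v)"
      using * that by (simp del: cov.simps)
    then show ?thesis
      by (simp add: bounded_linear.linear[OF bounded_linear_inner_right])
  qed
  then show "cov [a] \<in> alt_forms 1"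
    by (intro alt_formsI) (auto intro: cov_length simp del: cov.simps)
qed

lemma ewedge_eq_wedge:
  assumes "\<beta> \<in> alt_forms k"
  shows "ewedge a \<beta> = cov [a] \<and>\<^sub>f \<beta>"
proof -
  have "(\<chi> x. cov [a] [axis x 1]) = a"
    unfolding cov_singleton(2) by (simp add: vec_eq_iff inner_axis)
  then show ?thesis
    using wedge_one_form[OF cov_singleton(1) assms, of a] by (simp del: cov.simps)
qed

text \<open>Alternation is inherited from the wedge product instead of being derived from the
  recursion.\<close>

lemma ewedge_alt_forms: "\<beta> \<in> alt_forms k \<Longrightarrow> ewedge a \<beta> \<in> alt_forms (Suc k)"
  using wedge_alt_forms[OF cov_singleton(1)[of a]] by (simp add: ewedge_eq_wedge del: cov.simps)

lemma form_one_alt_forms: "form_one \<in> alt_forms 0"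
  by (rule alt_formsI) (auto simp: form_one_def)

lemma cov_alt_forms: "cov as \<in> alt_forms (length as)"
  by (induction as) (simp_all add: form_one_alt_forms ewedge_alt_forms)

text \<open>Any factor moves to the front at the cost of a sign, which \<open>\<beta>\<close>
  absorbs. Since \<open>\<beta>\<close> does not depend on \<open>a\<close>, varying one covector of
  a decomposable form stays within the directions a \<and> \<beta> for a single
  \<open>\<beta>\<close>.\<close>

lemma cov_as_ewedge:
  assumes "p < length as"
  obtains \<beta> where "\<beta> \<in> alt_forms (length as - 1)"
    "\<And>a. cov (as[p := a]) = ewedge a \<beta>"
proof
  define \<beta> where "\<beta> vs = (- 1) ^ p * cov (take p as @ drop (Suc p) as) vs" for vs
  have "cov (take p as @ drop (Suc p) as) \<in> alt_forms (length as - 1)"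
    using cov_alt_forms[of "take p as @ drop (Suc p) as"] assms by simp
  then show "\<beta> \<in> alt_forms (length as - 1)"
    unfolding \<beta>_def by (rule alt_forms_scale)
  show "cov (as[p := a]) = ewedge a \<beta>" for a
  proof
    fix vs
    show "cov (as[p := a]) vs = ewedge a \<beta> vs"
      using alt_forms_nth_to_front[OF cov_alt_in_covectors[of vs], of p "as[p := a]"] assms
      unfolding \<beta>_def by (simp add: ewedge_scale_right)
  qed
qed

lemma form_inner_alt_forms:
  assumes "C \<in> alt_forms (p + q)"
  shows "(\<lambda>us. form_inner q (\<lambda>vs. C (us @ vs)) \<eta>) \<in> alt_forms p"
proof -
  have "(\<lambda>us. inverse (fact q) * (\<Sum>J | length J = q. \<eta> (bas J) * C (us @ bas J))) \<in> alt_forms p"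
    using assms by (intro alt_forms_scale alt_forms_sum alt_forms_append) auto
  then show ?thesis
    by (simp add: form_inner_def divide_inverse mult.commute)
qed

text \<open>Associativity is only ever needed under a pairing, and there both sides unfold to the
  same threefold contraction of \<open>C\<close>.\<close>

lemma form_inner_wedge_assoc:
  assumes C: "C \<in> alt_forms (p + (q + r))"
    and \<omega>: "\<And>us. length us \<noteq> p \<Longrightarrow> \<omega> us = 0" and \<eta>: "\<And>us. length us \<noteq> q \<Longrightarrow> \<eta> us = 0"
  shows "form_inner (p + (q + r)) C ((\<omega> \<and>\<^sub>f \<eta>) \<and>\<^sub>f \<theta>) = form_inner (p + (q + r)) C (\<omega> \<and>\<^sub>f (\<eta> \<and>\<^sub>f \<theta>))"
proof -
  have C': "C \<in> alt_forms ((p + q) + r)"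
    using C by (simp add: add.assoc)
  have "form_inner ((p + q) + r) C ((\<omega> \<and>\<^sub>f \<eta>) \<and>\<^sub>f \<theta>)
      = form_inner (p + q) (\<lambda>us. form_inner r (\<lambda>vs. C (us @ vs)) \<theta>) (\<omega> \<and>\<^sub>f \<eta>)"
    by (rule form_inner_wedge[OF C']) (rule wedge_length[of p \<omega> q \<eta>, OF \<omega> \<eta>])
  also have "\<dots> = form_inner p (\<lambda>us. form_inner q (\<lambda>ws. form_inner r (\<lambda>vs. C (us @ (ws @ vs))) \<theta>) \<eta>) \<omega>"
    by (subst form_inner_wedge[OF form_inner_alt_forms[OF C'] \<omega>]) simp_all
  also have "\<dots> = form_inner p (\<lambda>us. form_inner (q + r) (\<lambda>ws. C (us @ ws)) (\<eta> \<and>\<^sub>f \<theta>)) \<omega>"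
    unfolding form_inner_def[of p]
    by (intro arg_cong2[where f = "(/)"] sum.cong refl arg_cong2[where f = "(*)"]
        form_inner_wedge[symmetric] alt_forms_prepend[OF C] \<eta>) auto
  also have "\<dots> = form_inner (p + (q + r)) C (\<omega> \<and>\<^sub>f (\<eta> \<and>\<^sub>f \<theta>))"
    by (rule form_inner_wedge[OF C \<omega>, symmetric])
  finally show ?thesis
    by (simp add: add.assoc)
qed

lemma wedge_pow_length:
  assumes "\<And>vs. length vs \<noteq> k \<Longrightarrow> \<xi> vs = 0"
  shows "length vs \<noteq> k * a \<Longrightarrow> wedge_pow \<xi> a vs = 0"
proof (induction a arbitrary: vs)
  case 0
  then show ?case by (simp add: form_one_def)
next
  case (Suc a)
  show ?case
    using wedge_length[OF assms, where \<eta> = "wedge_pow \<xi> a" and q = "k * a" and vs = vs] Suc by simp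
qed

text \<open>More than n basis indices contain a repetition. This is what makes the Taylor expansion
  finite and restricts its multiindices.\<close>

lemma form_inner_above_dimension:
  fixes C :: "('n::finite) form"
  assumes "C \<in> alt_forms N" "CARD('n) < N"
  shows "form_inner N C \<eta> = 0"
proof -
  have "C (bas I) = 0" if "length I = N" for I :: "'n list"
  proof -
    have "\<not> distinct I"
      using that assms(2) distinct_card[of I] card_mono[of UNIV "set I"] by auto
    then have "\<not> distinct (bas I)"
      by (simp add: distinct_map)
    then show ?thesis
      by (rule alt_forms_not_distinct[OF assms(1)])
  qed
  then show ?thesis
    by (simp add: form_inner_def)
qed

section \<open>Iterated differences along decomposable forms\<close>

definition sc :: "real \<Rightarrow> (nat \<Rightarrow> ('n::finite) form) \<Rightarrow> nat \<Rightarrow> 'n form" where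
  "sc t \<eta> = (\<lambda>i vs. t * \<eta> i vs)"

text \<open>The slope is written out as the unit difference, so that \<open>dif\<close> acts as a
  directional derivative along such directions.\<close>

definition affine_along :: "((nat \<Rightarrow> ('n::finite) form) \<Rightarrow> real) \<Rightarrow> (nat \<Rightarrow> 'n form) \<Rightarrow> bool" where
  "affine_along g \<eta> \<longleftrightarrow> (\<forall>\<zeta> t. g (\<zeta> + sc t \<eta>) = g \<zeta> + t * (g (\<zeta> + \<eta>) - g \<zeta>))"

definition dif :: "(nat \<Rightarrow> ('n::finite) form) \<Rightarrow> ((nat \<Rightarrow> 'n form) \<Rightarrow> real) \<Rightarrow> (nat \<Rightarrow> 'n form) \<Rightarrow> real" where
  "dif \<eta> g \<zeta> = g (\<zeta> + \<eta>) - g \<zeta>"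

definition emb :: "nat \<Rightarrow> ('n::finite) form \<Rightarrow> nat \<Rightarrow> 'n form" where
  "emb i \<phi> = (\<lambda>j. if j = i then \<phi> else 0)"

text \<open>The base points in \<open>affine_along\<close> range over all families of functions,
  alternating or not, so that iterated differences carry no membership conditions. Composition with
  \<open>alt_proj\<close> supplies such functions.\<close>

definition ext_affine :: "(nat \<Rightarrow> nat) \<Rightarrow> ((nat \<Rightarrow> ('n::finite) form) \<Rightarrow> real) \<Rightarrow> bool" where
  "ext_affine k g \<longleftrightarrow>
     (\<forall>a \<beta>. (\<forall>i. \<beta> i \<in> alt_forms (k i - 1)) \<longrightarrow> affine_along g (\<lambda>i. ewedge a (\<beta> i)))"

lemma ext_affineD:
  "ext_affine k g \<Longrightarrow> (\<And>i. \<beta> i \<in> alt_forms (k i - 1)) \<Longrightarrow> affine_along g (\<lambda>i. ewedge a (\<beta> i))"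
  by (simp add: ext_affine_def)

lemma affine_alongD: "affine_along g \<eta> \<Longrightarrow> g (\<zeta> + sc t \<eta>) = g \<zeta> + t * dif \<eta> g \<zeta>"
  by (simp add: affine_along_def dif_def)

text \<open>\<open>\<zeta> + \<eta> + \<theta>\<close> is the midpoint of \<open>\<zeta> + 2\<eta>\<close> and \<open>\<zeta> + 2\<theta>\<close>.\<close>

lemma affine_along_parallelogram:
  assumes "affine_along g \<eta>" "affine_along g \<theta>" "affine_along g (\<theta> - \<eta>)"
  shows "g (\<zeta> + \<eta> + \<theta>) = g (\<zeta> + \<eta>) + g (\<zeta> + \<theta>) - g \<zeta>"
proof -
  let ?z = "\<zeta> + sc 2 \<eta>"
  have "?z + (\<theta> - \<eta>) = \<zeta> + \<eta> + \<theta>" "?z + sc 2 (\<theta> - \<eta>) = \<zeta> + sc 2 \<theta>"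
    by (simp_all add: fun_eq_iff sc_def algebra_simps)
  then have "g (\<zeta> + sc 2 \<theta>) = g ?z + 2 * (g (\<zeta> + \<eta> + \<theta>) - g ?z)"
    using affine_alongD[OF assms(3), of ?z 2] unfolding dif_def by metis
  then show ?thesis
    using affine_alongD[OF assms(1), of \<zeta> 2] affine_alongD[OF assms(2), of \<zeta> 2]
    unfolding dif_def by argo
qed

lemma dif_commute: "dif \<eta> (dif \<theta> g) = dif \<theta> (dif \<eta> g)"
  by (simp add: fun_eq_iff dif_def add_ac)

lemma dif_zero_fun: "dif \<eta> (\<lambda>\<zeta>. 0) = (\<lambda>\<zeta>. 0)"
  by (simp add: fun_eq_iff dif_def)

lemma affine_alongI:
  "(\<And>\<zeta> t. g (\<zeta> + sc t \<eta>) = g \<zeta> + t * dif \<eta> g \<zeta>) \<Longrightarrow> affine_along g \<eta>"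
  by (simp add: affine_along_def dif_def)

text \<open>Difference operators commute, so the class of functions affine along
  \<open>\<delta>\<close> is stable under differences. All later inductions over iterated
  differences depend on this.\<close>

lemma affine_along_dif:
  assumes "affine_along g \<delta>"
  shows "affine_along (dif \<eta> g) \<delta>"
proof (rule affine_alongI)
  fix \<zeta> t
  have "\<zeta> + sc t \<delta> + \<eta> = (\<zeta> + \<eta>) + sc t \<delta>"
    by (simp add: add_ac)
  then have "dif \<eta> g (\<zeta> + sc t \<delta>) = g ((\<zeta> + \<eta>) + sc t \<delta>) - g (\<zeta> + sc t \<delta>)"
    by (simp only: dif_def)
  also have "\<dots> = dif \<eta> g \<zeta> + t * dif \<eta> (dif \<delta> g) \<zeta>"
    unfolding affine_alongD[OF assms] by (simp add: dif_def[of \<eta>] right_diff_distrib)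
  finally show "dif \<eta> g (\<zeta> + sc t \<delta>) = dif \<eta> g \<zeta> + t * dif \<delta> (dif \<eta> g) \<zeta>"
    by (simp only: dif_commute)
qed

lemma affine_along_add:
  assumes "affine_along g \<eta>" "affine_along h \<eta>"
  shows "affine_along (\<lambda>\<zeta>. g \<zeta> + h \<zeta>) \<eta>"
  by (rule affine_alongI)
    (simp add: affine_alongD[OF assms(1)] affine_alongD[OF assms(2)] dif_def, simp add: algebra_simps)

lemma affine_along_scale: "affine_along g \<eta> \<Longrightarrow> affine_along (\<lambda>\<zeta>. c * g \<zeta>) \<eta>"
  by (rule affine_alongI) (simp add: affine_alongD dif_def, simp add: algebra_simps)

lemma ext_affine_dif: "ext_affine k g \<Longrightarrow> ext_affine k (dif \<eta> g)"
  by (simp add: ext_affine_def affine_along_dif)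

lemma ext_affine_zero: "ext_affine k (\<lambda>\<zeta>. 0)"
  by (simp add: ext_affine_def affine_along_def)

lemma ext_affine_add: "ext_affine k g \<Longrightarrow> ext_affine k h \<Longrightarrow> ext_affine k (\<lambda>\<zeta>. g \<zeta> + h \<zeta>)"
  by (simp add: ext_affine_def affine_along_add)

lemma ext_affine_scale: "ext_affine k g \<Longrightarrow> ext_affine k (\<lambda>\<zeta>. c * g \<zeta>)"
  by (simp add: ext_affine_def affine_along_scale)

lemma ext_affine_sum:
  "(\<And>x. x \<in> X \<Longrightarrow> ext_affine k (g x)) \<Longrightarrow> ext_affine k (\<lambda>\<zeta>. \<Sum>x\<in>X. g x \<zeta>)"
  by (induction X rule: infinite_finite_induct) (simp_all add: ext_affine_zero ext_affine_add)

text \<open>A perturbation of a single slot is a vectorial one whose remaining components of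
  \<open>\<beta>\<close> are zero.\<close>

lemma emb_ewedge: "emb i (ewedge a \<beta>) = (\<lambda>j. ewedge a (emb i \<beta> j))"
  by (simp add: fun_eq_iff emb_def zero_fun_def ewedge_zero_right)

lemma emb_alt_forms: "\<beta> \<in> alt_forms (k i - 1) \<Longrightarrow> emb i \<beta> j \<in> alt_forms (k j - 1)"
  by (simp add: emb_def zero_fun_def alt_forms_zero)

section \<open>Differences along decomposable directions, and their alternation in the
  covectors\<close>

lemma emb_cov_as_ewedge:
  assumes "a \<in> set as" "length as = k i"
  obtains \<beta> where "\<And>j. \<beta> j \<in> alt_forms (k j - 1)" "emb i (cov as) = (\<lambda>j. ewedge a (\<beta> j))"
proof -
  obtain p where p: "p < length as" "as ! p = a"
    using assms(1) by (auto simp: in_set_conv_nth)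
  obtain \<beta> where \<beta>: "\<beta> \<in> alt_forms (length as - 1)" "\<And>b. cov (as[p := b]) = ewedge b \<beta>"
    using cov_as_ewedge[OF p(1)] by blast
  have "cov as = ewedge a \<beta>"
    using \<beta>(2)[of a] p by (metis list_update_id)
  then show ?thesis
    using that[of "emb i \<beta>"] emb_alt_forms[of \<beta> k i] \<beta>(1) assms(2) by (simp add: emb_ewedge)
qed

lemma affine_along_emb_cov:
  assumes "ext_affine k g" "length as = k i" "1 \<le> k i"
  shows "affine_along g (emb i (cov as))"
proof -
  have "as \<noteq> []"
    using assms(2,3) by auto
  then obtain \<beta> where "\<And>j. \<beta> j \<in> alt_forms (k j - 1)" "emb i (cov as) = (\<lambda>j. ewedge (hd as) (\<beta> j))"
    using emb_cov_as_ewedge[of "hd as" as k i] assms(2) hd_in_set by blast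
  then show ?thesis
    using ext_affineD[OF assms(1), of \<beta> "hd as"] by simp
qed

text \<open>The directions \<open>?\<eta>\<close>, \<open>?\<theta>\<close> and their difference all
  contain the factor \<open>a\<close>, so the parallelogram identity applies. \<open>\<beta>\<close>
  and \<open>\<gamma>\<close> may be supported in different slots, and the difference direction then
  moves both.\<close>

lemma dif_dif_ewedge:
  assumes g: "ext_affine k g"
    and \<beta>: "\<And>i. \<beta> i \<in> alt_forms (k i - 1)" and \<gamma>: "\<And>i. \<gamma> i \<in> alt_forms (k i - 1)"
  shows "dif (\<lambda>i. ewedge a (\<beta> i)) (dif (\<lambda>i. ewedge a (\<gamma> i)) g) \<zeta> = 0"
proof -
  let ?\<eta> = "\<lambda>i. ewedge a (\<beta> i)" and ?\<theta> = "\<lambda>i. ewedge a (\<gamma> i)"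
  let ?\<delta> = "\<lambda>i vs. \<gamma> i vs + (- 1) * \<beta> i vs"
  have "?\<delta> i \<in> alt_forms (k i - 1)" for i
    by (intro alt_forms_add alt_forms_scale \<beta> \<gamma>)
  then have "affine_along g (\<lambda>i. ewedge a (?\<delta> i))"
    by (rule ext_affineD[OF g])
  moreover have "(\<lambda>i. ewedge a (?\<delta> i)) = ?\<theta> - ?\<eta>"
    by (simp add: fun_eq_iff ewedge_diff_right)
  ultimately show ?thesis
    using affine_along_parallelogram[of g ?\<eta> ?\<theta> \<zeta>] ext_affineD[OF g] \<beta> \<gamma> by (simp add: dif_def)
qed

text \<open>Here \<open>\<beta>\<close> is fixed and the covector varies: the difference of two
  directions is (b - a) \<and> \<beta>, again admissible. The parallelogram identity gives
  additivity, affinity gives homogeneity.\<close>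

lemma dif_cov_linear:
  assumes g: "ext_affine k g" and as: "length as = k i" "p < k i"
  shows "linear (\<lambda>a. dif (emb i (cov (as[p := a]))) g \<zeta>)"
proof -
  obtain \<beta> where \<beta>: "\<beta> \<in> alt_forms (k i - 1)" and cov: "\<And>a. cov (as[p := a]) = ewedge a \<beta>"
    using cov_as_ewedge[of p as] as by metis
  let ?E = "\<lambda>a. emb i (ewedge a \<beta>)"
  have E: "affine_along g (?E a)" for a
    unfolding emb_ewedge using emb_alt_forms[of \<beta> k i] \<beta> by (intro ext_affineD[OF g]) auto
  have add: "?E (a + b) = ?E a + ?E b" for a b
    by (simp add: fun_eq_iff emb_def ewedge_add_left)
  have "?E b - ?E a = ?E (b - a)" for a b
    using add[of "b - a" a] by simp
  then have "g (\<zeta> + ?E a + ?E b) = g (\<zeta> + ?E a) + g (\<zeta> + ?E b) - g \<zeta>" for a b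
    using affine_along_parallelogram[of g "?E a" "?E b" \<zeta>] E by simp
  moreover have "?E (c *\<^sub>R a) = sc c (?E a)" for c a
    by (simp add: fun_eq_iff emb_def sc_def ewedge_scale_left)
  ultimately show ?thesis
    using affine_alongD[OF E, of \<zeta>]
    by (intro linearI) (simp_all add: cov add dif_def flip: add.assoc)
qed

text \<open>\<open>L\<close> is a list of covectors, cut into consecutive blocks of lengths
  \<open>k i\<close> for the slots \<open>i\<close> in \<open>ss\<close>; each block is the
  direction of one difference. For fixed \<open>\<zeta>\<close> this has the type of a form in the
  covectors, and the zero branches follow the convention that forms vanish on lists of the wrong
  length.\<close>

fun iter_dif :: "(nat \<Rightarrow> nat) \<Rightarrow> ((nat \<Rightarrow> ('n::finite) form) \<Rightarrow> real) \<Rightarrow> nat list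
    \<Rightarrow> (nat \<Rightarrow> 'n form) \<Rightarrow> 'n form" where
  "iter_dif k g [] \<zeta> L = (if L = [] then g \<zeta> else 0)"
| "iter_dif k g (i # ss) \<zeta> L =
     (if length L < k i then 0
      else iter_dif k (dif (emb i (cov (take (k i) L))) g) ss \<zeta> (drop (k i) L))"

lemma iter_dif_length: "length L \<noteq> sum_list (map k ss) \<Longrightarrow> iter_dif k g ss \<zeta> L = 0"
  by (induction ss arbitrary: g L) auto

lemma iter_dif_linear:
  "iter_dif k (\<lambda>\<zeta>. c * g \<zeta> + d * h \<zeta>) ss \<zeta> L = c * iter_dif k g ss \<zeta> L + d * iter_dif k h ss \<zeta> L"
proof (induction ss arbitrary: g h L)
  case Nil
  then show ?case by simp
next
  case (Cons i ss)
  have "dif \<eta> (\<lambda>\<zeta>. c * g \<zeta> + d * h \<zeta>) = (\<lambda>\<zeta>. c * dif \<eta> g \<zeta> + d * dif \<eta> h \<zeta>)" for \<eta>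
    by (simp add: fun_eq_iff dif_def algebra_simps)
  then show ?case
    by (simp add: Cons.IH)
qed

lemma iter_dif_zero_fun: "iter_dif k (\<lambda>\<zeta>. 0) ss \<zeta> L = 0"
  using iter_dif_linear[of k 0 "\<lambda>\<zeta>. 0" 0 "\<lambda>\<zeta>. 0"] by simp

lemma iter_dif_add:
  "iter_dif k (\<lambda>\<zeta>. g \<zeta> + h \<zeta>) ss \<zeta> L = iter_dif k g ss \<zeta> L + iter_dif k h ss \<zeta> L"
  using iter_dif_linear[of k 1 g 1 h] by simp

lemma iter_dif_scale: "iter_dif k (\<lambda>\<zeta>. c * g \<zeta>) ss \<zeta> L = c * iter_dif k g ss \<zeta> L"
  using iter_dif_linear[of k c g 0 g] by simp

lemma iter_dif_sum:
  "iter_dif k (\<lambda>\<zeta>. \<Sum>x\<in>X. g x \<zeta>) ss \<zeta> L = (\<Sum>x\<in>X. iter_dif k (g x) ss \<zeta> L)"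
  by (induction X rule: infinite_finite_induct) (simp_all add: iter_dif_zero_fun iter_dif_add)

text \<open>Since differences commute, the annihilation of \<open>g\<close> passes to its
  differences along the earlier blocks, until the block containing \<open>a\<close> is reached; its
  direction has the form a \<and> \<beta>.\<close>

lemma iter_dif_killed:
  assumes "\<And>\<beta>. (\<And>i. \<beta> i \<in> alt_forms (k i - 1)) \<Longrightarrow> dif (\<lambda>i. ewedge a (\<beta> i)) g = (\<lambda>\<zeta>. 0)"
    and "a \<in> set L"
  shows "iter_dif k g ss \<zeta> L = 0"
  using assms
proof (induction ss arbitrary: g L)
  case Nil
  then show ?case by auto
next
  case (Cons i ss)
  show ?case
  proof (cases "length L < k i")
    case True
    then show ?thesis by simp
  next
    case False
    let ?\<eta> = "emb i (cov (take (k i) L))"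
    have "a \<in> set (take (k i) L) \<or> a \<in> set (drop (k i) L)"
      using Cons.prems(2) by (metis UnE append_take_drop_id set_append)
    then show ?thesis
    proof
      assume "a \<in> set (take (k i) L)"
      then obtain \<beta> where "\<And>j. \<beta> j \<in> alt_forms (k j - 1)" "?\<eta> = (\<lambda>j. ewedge a (\<beta> j))"
        using emb_cov_as_ewedge[of a "take (k i) L" k i] False by auto
      then have "dif ?\<eta> g = (\<lambda>\<zeta>. 0)"
        using Cons.prems(1)[of \<beta>] by simp
      then show ?thesis by (simp add: iter_dif_zero_fun)
    next
      assume a: "a \<in> set (drop (k i) L)"
      have "dif (\<lambda>j. ewedge a (\<beta> j)) (dif ?\<eta> g) = (\<lambda>\<zeta>. 0)"
        if "\<And>j. \<beta> j \<in> alt_forms (k j - 1)" for \<beta>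
        by (subst dif_commute) (simp add: Cons.prems(1)[OF that] dif_zero_fun)
      then have "iter_dif k (dif ?\<eta> g) ss \<zeta> (drop (k i) L) = 0"
        using a by (rule Cons.IH)
      then show ?thesis by simp
    qed
  qed
qed

text \<open>This alternation across all blocks lets the differences of \<open>f\<close> be paired
  with wedge products of different slots. Linearity in a covector of the first block survives the
  later differences because \<open>iter_dif\<close> is linear in \<open>g\<close>.\<close>

lemma iter_dif_alt_forms:
  assumes "ext_affine k g"
  shows "iter_dif k g ss \<zeta> \<in> alt_forms (sum_list (map k ss))"
  using assms
proof (induction ss arbitrary: g)
  case Nil
  show ?case
    by (rule alt_formsI) auto
next
  case (Cons i ss)
  let ?K = "sum_list (map k ss)"
  have IH: "iter_dif k (dif \<eta> g) ss \<zeta> \<in> alt_forms ?K" for \<eta>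
    using Cons by (simp add: ext_affine_dif)
  show ?case
  proof (rule alt_formsI)
    show "iter_dif k g (i # ss) \<zeta> vs = 0" if "length vs \<noteq> sum_list (map k (i # ss))" for vs
      using that by (rule iter_dif_length)
    show "linear (\<lambda>v. iter_dif k g (i # ss) \<zeta> (vs[p := v]))"
      if "length vs = sum_list (map k (i # ss))" "p < sum_list (map k (i # ss))" for vs p
    proof (cases "p < k i")
      case True
      define h where "h v = dif (emb i (cov ((take (k i) vs)[p := v]))) g" for v
      have l: "linear (\<lambda>v. h v \<zeta>)" for \<zeta>
        unfolding h_def using True that by (intro dif_cov_linear[OF Cons.prems]) auto
      have "h (v + w) = (\<lambda>\<zeta>. h v \<zeta> + h w \<zeta>)" "h (c *\<^sub>R v) = (\<lambda>\<zeta>. c * h v \<zeta>)" for v w c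
        by (simp_all add: fun_eq_iff linear_add[OF l] linear_scale[OF l])
      then have "linear (\<lambda>v. iter_dif k (h v) ss \<zeta> (drop (k i) vs))"
        by (intro linearI) (simp_all add: iter_dif_add iter_dif_scale)
      then show ?thesis
        using True that by (simp add: h_def take_update_swap)
    next
      case False
      then show ?thesis
        using alt_forms_linear[OF IH[of "emb i (cov (take (k i) vs))"], of "drop (k i) vs" "p - k i"] that
        by (simp add: drop_update_swap)
    qed
    show "iter_dif k g (i # ss) \<zeta> vs = 0"
      if "length vs = sum_list (map k (i # ss))" "p < q" "q < sum_list (map k (i # ss))"
        "vs ! p = vs ! q" for vs p q
    proof -
      let ?\<eta> = "emb i (cov (take (k i) vs))"
      \<comment> \<open>The equal covectors lie both in the first block, one in the first and one in
        a later block, or both in later blocks.\<close>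
      consider "q < k i" | "p < k i" "k i \<le> q" | "k i \<le> p"
        using that by linarith
      then have "iter_dif k (dif ?\<eta> g) ss \<zeta> (drop (k i) vs) = 0"
      proof cases
        case 1
        have "\<not> distinct (take (k i) vs)"
          using 1 that nth_eq_iff_index_eq[of "take (k i) vs" p q] by auto
        then have "emb i (cov (take (k i) vs)) = 0"
          by (intro ext) (simp add: emb_def cov_not_distinct)
        then have "dif ?\<eta> g = (\<lambda>\<zeta>. 0)"
          unfolding dif_def[abs_def] by (simp only: add_0_right diff_self)
        then show ?thesis by (simp add: iter_dif_zero_fun)
      next
        case 2
        have "vs ! p = take (k i) vs ! p"
          using 2 by simp
        then have "vs ! p \<in> set (take (k i) vs)"
          using 2 that by (metis length_take min.absorb2 nth_mem le_add1 list.simps(9) sum_list.Cons)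
        moreover have "length (take (k i) vs) = k i"
          using that(1) by simp
        ultimately obtain \<gamma> where \<gamma>: "\<And>j. \<gamma> j \<in> alt_forms (k j - 1)" "?\<eta> = (\<lambda>j. ewedge (vs ! p) (\<gamma> j))"
          using emb_cov_as_ewedge[of "vs ! p" "take (k i) vs" k i] by blast
        have "vs ! p = drop (k i) vs ! (q - k i)"
          using 2 that by simp
        then have "vs ! p \<in> set (drop (k i) vs)"
          using 2 that by (metis diff_less_mono length_drop nth_mem)
        \<comment> \<open>The first block has already consumed the common covector, so every further
          difference along a direction containing it is a vanishing mixed difference.\<close>
        moreover have "dif (\<lambda>j. ewedge (vs ! p) (\<beta> j)) (dif ?\<eta> g) = (\<lambda>\<zeta>. 0)"
          if "\<And>j. \<beta> j \<in> alt_forms (k j - 1)" for \<beta>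
          unfolding \<gamma>(2) using dif_dif_ewedge[OF Cons.prems that \<gamma>(1)] by blast
        ultimately show ?thesis
          by (rule iter_dif_killed[rotated])
      next
        case 3
        then show ?thesis
          using that by (intro alt_forms_repeat[OF IH, of "p - k i" "q - k i"]) auto
      qed
      then show ?thesis by simp
    qed
  qed
qed

section \<open>Slot derivatives: the derivative in one slot, written as a combination of
  differences\<close>

definition slot_deriv :: "(nat \<Rightarrow> nat) \<Rightarrow> nat \<Rightarrow> ('n::finite) form
    \<Rightarrow> ((nat \<Rightarrow> 'n form) \<Rightarrow> real) \<Rightarrow> (nat \<Rightarrow> 'n form) \<Rightarrow> real" where
  "slot_deriv k i \<xi> g \<zeta> =
     (\<Sum>I | length I = k i. \<xi> (bas I) / fact (k i) * dif (emb i (cov (bas I))) g \<zeta>)"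

lemma ext_affine_slot_deriv: "ext_affine k g \<Longrightarrow> ext_affine k (slot_deriv k i \<xi> g)"
  unfolding slot_deriv_def by (intro ext_affine_sum ext_affine_scale ext_affine_dif)

lemma ext_affine_slot_deriv_pow: "ext_affine k g \<Longrightarrow> ext_affine k ((slot_deriv k i \<xi> ^^ a) g)"
  by (induction a) (simp_all add: ext_affine_slot_deriv)

text \<open>Contracting the first block with \<open>\<xi>\<close> weights the first differences with
  the coefficients of \<open>\<xi>\<close> in its expansion, which gives \<open>slot_deriv\<close>;
  the rest of the pairing is linear in the function being differenced.\<close>

lemma form_inner_iter_dif_wedge:
  assumes g: "ext_affine k g" and \<xi>: "\<And>vs. length vs \<noteq> k i \<Longrightarrow> \<xi> vs = 0"
    and N: "N = sum_list (map k ss)"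
  shows "form_inner (k i + N) (iter_dif k g (i # ss) \<zeta>) (\<xi> \<and>\<^sub>f R)
    = form_inner N (iter_dif k (slot_deriv k i \<xi> g) ss \<zeta>) R"
proof -
  let ?h = "\<lambda>I. dif (emb i (cov (bas I))) g"
  have "form_inner (k i + N) (iter_dif k g (i # ss) \<zeta>) (\<xi> \<and>\<^sub>f R)
      = form_inner (k i) (\<lambda>us. form_inner N (\<lambda>vs. iter_dif k g (i # ss) \<zeta> (us @ vs)) R) \<xi>"
    using iter_dif_alt_forms[OF g, of "i # ss" \<zeta>] N by (intro form_inner_wedge[OF _ \<xi>]) simp_all
  also have "\<dots> = (\<Sum>I | length I = k i. \<xi> (bas I) / fact (k i) * form_inner N (iter_dif k (?h I) ss \<zeta>) R)"
    by (simp add: form_inner_def[of "k i"] sum_divide_distrib mult.commute)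
  also have "\<dots> = (\<Sum>I | length I = k i. \<Sum>J | length J = N.
      (\<xi> (bas I) / fact (k i) * iter_dif k (?h I) ss \<zeta> (bas J)) * (R (bas J) / fact N))"
    by (simp add: form_inner_def[of N] sum_divide_distrib sum_distrib_left mult.assoc)
  also have "\<dots> = (\<Sum>J | length J = N. \<Sum>I | length I = k i.
      (\<xi> (bas I) / fact (k i) * iter_dif k (?h I) ss \<zeta> (bas J)) * (R (bas J) / fact N))"
    by (rule sum.swap)
  also have "\<dots> = form_inner N (iter_dif k (slot_deriv k i \<xi> g) ss \<zeta>) R"
    unfolding slot_deriv_def[abs_def] form_inner_def[of N] iter_dif_sum iter_dif_scale
      sum_divide_distrib sum_distrib_right
    by simp
  finally show ?thesis .
qed

lemma form_inner_0_form_one: "form_inner 0 C form_one = C []"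
  by (simp add: form_inner_def form_one_def)

lemma form_inner_wedge_form_one_left:
  "C \<in> alt_forms N \<Longrightarrow> form_inner N C (form_one \<and>\<^sub>f R) = form_inner N C R"
  using form_inner_wedge[of C 0 N form_one R] by (simp add: form_one_def form_inner_def[of 0])

lemma form_inner_iter_dif_wedge_pow:
  assumes g: "ext_affine k g" and \<xi>: "\<And>vs. length vs \<noteq> k i \<Longrightarrow> \<xi> vs = 0"
    and N: "N = sum_list (map k ss)"
  shows "form_inner (k i * a + N) (iter_dif k g (replicate a i @ ss) \<zeta>) (wedge_pow \<xi> a \<and>\<^sub>f R)
    = form_inner N (iter_dif k ((slot_deriv k i \<xi> ^^ a) g) ss \<zeta>) R"
  using g
proof (induction a arbitrary: g)
  case 0
  then show ?case
    using iter_dif_alt_forms[of k g ss] N by (simp add: form_inner_wedge_form_one_left)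
next
  case (Suc a)
  let ?C = "iter_dif k g (replicate (Suc a) i @ ss) \<zeta>"
  have len: "sum_list (map k (replicate a i @ ss)) = k i * a + N"
    by (simp add: N sum_list_replicate)
  have "?C \<in> alt_forms (k i + (k i * a + N))"
    using iter_dif_alt_forms[OF Suc.prems, of "replicate (Suc a) i @ ss" \<zeta>] len by simp
  then have "form_inner (k i + (k i * a + N)) ?C ((\<xi> \<and>\<^sub>f wedge_pow \<xi> a) \<and>\<^sub>f R)
      = form_inner (k i + (k i * a + N)) ?C (\<xi> \<and>\<^sub>f (wedge_pow \<xi> a \<and>\<^sub>f R))"
    by (rule form_inner_wedge_assoc[OF _ \<xi>]) (use wedge_pow_length[of "k i" \<xi>, OF \<xi>] in auto)
  also have "\<dots> = form_inner (k i * a + N) (iter_dif k (slot_deriv k i \<xi> g) (replicate a i @ ss) \<zeta>)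
      (wedge_pow \<xi> a \<and>\<^sub>f R)"
    using form_inner_iter_dif_wedge[OF Suc.prems \<xi> len[symmetric], where \<zeta> = \<zeta>] by simp
  also have "\<dots> = form_inner N (iter_dif k ((slot_deriv k i \<xi> ^^ Suc a) g) ss \<zeta>) R"
    using Suc.IH[OF ext_affine_slot_deriv[OF Suc.prems]] by (simp add: funpow_swap1)
  finally show ?case
    by (simp add: add.assoc del: iter_dif.simps)
qed

text \<open>The pairing with \<xi> to the power \<alpha> is the mixed derivative of multidegree
  \<open>\<alpha>\<close>: slots are peeled off from the left, and the slot list repeats
  \<open>j\<close> exactly \<open>\<alpha> j\<close> times in the order of the wedge
  factors.\<close>

lemma form_inner_iter_dif_multi:
  assumes "ext_affine k g" and "\<And>j vs. j \<in> set js \<Longrightarrow> length vs \<noteq> k j \<Longrightarrow> \<xi> j vs = 0"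
  shows "form_inner (\<Sum>j\<leftarrow>js. k j * \<alpha> j)
      (iter_dif k g (concat (map (\<lambda>j. replicate (\<alpha> j) j) js)) \<zeta>)
      (foldr (\<and>\<^sub>f) (map (\<lambda>j. wedge_pow (\<xi> j) (\<alpha> j)) js) form_one)
    = fold (\<lambda>j. slot_deriv k j (\<xi> j) ^^ \<alpha> j) js g \<zeta>"
  using assms
proof (induction js arbitrary: g)
  case Nil
  then show ?case by (simp add: form_inner_0_form_one)
next
  case (Cons j js)
  have "(\<Sum>j\<leftarrow>js. k j * \<alpha> j) = sum_list (map k (concat (map (\<lambda>j. replicate (\<alpha> j) j) js)))"
    by (induction js) (simp_all add: sum_list_replicate)
  then show ?case
    using form_inner_iter_dif_wedge_pow[OF Cons.prems(1), where i = j and \<xi> = "\<xi> j"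
        and ss = "concat (map (\<lambda>j. replicate (\<alpha> j) j) js)" and a = "\<alpha> j" and \<zeta> = \<zeta>]
      Cons.prems Cons.IH[OF ext_affine_slot_deriv_pow[OF Cons.prems(1)]]
    by simp
qed

text \<open>The iterated slot derivative is the pairing of a wedge power with an alternating form of
  degree \<open>k i * a\<close> in the covectors, and that form is zero.\<close>

lemma slot_deriv_pow_above_dimension:
  fixes g :: "(nat \<Rightarrow> ('n::finite) form) \<Rightarrow> real"
  assumes "ext_affine k g" "\<And>vs. length vs \<noteq> k i \<Longrightarrow> \<xi> vs = 0" "CARD('n) < k i * a"
  shows "(slot_deriv k i \<xi> ^^ a) g = (\<lambda>\<zeta>. 0)"
proof
  fix \<zeta>
  have "iter_dif k g (replicate a i @ []) \<zeta> \<in> alt_forms (k i * a)"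
    using iter_dif_alt_forms[OF assms(1), of "replicate a i" \<zeta>]
    by (simp add: sum_list_replicate mult.commute)
  then show "(slot_deriv k i \<xi> ^^ a) g \<zeta> = 0"
    using form_inner_iter_dif_wedge_pow[where k = k and i = i and \<xi> = \<xi>,
        OF assms(1,2), where N = 0 and ss = "[]" and a = a and \<zeta> = \<zeta> and R = form_one]
      form_inner_above_dimension[OF _ assms(3)]
    by (simp add: form_inner_0_form_one)
qed

text \<open>Differentiability has to come from affinity. The decomposable terms of
  \<open>\<xi>\<close> are added one at a time; exact affinity along the new one expresses
  \<open>g\<close> as \<open>u t + t * ?c x * v t\<close>, and the product rule applies. The
  induction is general in \<open>g\<close> because \<open>v\<close> comes from a difference of
  \<open>g\<close>.\<close>

lemma has_real_derivative_along_slot: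
  assumes "ext_affine k g" "\<xi> \<in> alt_forms (k i)" "1 \<le> k i"
  shows "((\<lambda>t. g (\<zeta> + sc t (emb i \<xi>))) has_real_derivative
      slot_deriv k i \<xi> g (\<zeta> + sc t (emb i \<xi>))) (at t)"
proof -
  let ?\<eta> = "\<lambda>I. emb i (cov (bas I))" and ?c = "\<lambda>I. \<xi> (bas I) / fact (k i)"
  define S where "S X = emb i (\<lambda>vs. \<Sum>I\<in>X. ?c I * cov (bas I) vs)" for X
  have "((\<lambda>t. g (\<zeta> + sc t (S X))) has_real_derivative
      (\<Sum>I\<in>X. ?c I * dif (?\<eta> I) g (\<zeta> + sc t (S X)))) (at t)"
    if "finite X" "X \<subseteq> {I. length I = k i}" for X
    using that assms(1)
  proof (induction X arbitrary: g rule: finite_induct)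
    case empty
    have "sc t (S {}) = 0" for t
      by (simp add: S_def sc_def emb_def fun_eq_iff)
    then show ?case by simp
  next
    case (insert x X)
    have x: "length (bas x) = k i"
      using insert by simp
    have aff: "h (\<zeta> + sc s (?\<eta> x)) = h \<zeta> + s * dif (?\<eta> x) h \<zeta>" if "ext_affine k h" for h \<zeta> s
      by (rule affine_alongD, rule affine_along_emb_cov) (use that x assms(3) in auto)
    have S: "\<zeta> + sc t (S (insert x X)) = (\<zeta> + sc t (S X)) + sc (t * ?c x) (?\<eta> x)" for t
      using insert by (simp add: S_def sc_def emb_def fun_eq_iff algebra_simps)
    have "bas x \<noteq> []"
      using x assms(3) by auto
    then obtain \<beta> where "\<And>j. \<beta> j \<in> alt_forms (k j - 1)" "?\<eta> x = (\<lambda>j. ewedge (hd (bas x)) (\<beta> j))"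
      using emb_cov_as_ewedge[of "hd (bas x)" "bas x" k i] x hd_in_set by blast
    \<comment> \<open>The difference along this direction does not change when the point moves along
      it, so its value at \<open>z\<close> is also its value at the new point.\<close>
    then have dd: "dif (?\<eta> x) (dif (?\<eta> x) g) \<zeta> = 0" for \<zeta>
      using dif_dif_ewedge[OF insert.prems(2), of \<beta> \<beta>] by simp
    define u v where "u t = g (\<zeta> + sc t (S X))" and "v t = dif (?\<eta> x) g (\<zeta> + sc t (S X))" for t
    define z where "z = \<zeta> + sc t (S X)"
    have u: "(u has_real_derivative (\<Sum>I\<in>X. ?c I * dif (?\<eta> I) g z)) (at t)"
      unfolding u_def z_def by (rule insert.IH) (use insert.prems in auto)
    have v: "(v has_real_derivative (\<Sum>I\<in>X. ?c I * dif (?\<eta> I) (dif (?\<eta> x) g) z)) (at t)"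
      unfolding v_def z_def by (rule insert.IH) (use insert.prems in \<open>auto intro: ext_affine_dif\<close>)
    have "((\<lambda>t. u t + t * ?c x * v t) has_real_derivative
        (\<Sum>I\<in>X. ?c I * dif (?\<eta> I) g z)
        + (t * ?c x * (\<Sum>I\<in>X. ?c I * dif (?\<eta> I) (dif (?\<eta> x) g) z) + ?c x * v t)) (at t)"
      by (rule derivative_eq_intros u v refl | simp)+
    also have "(\<lambda>t. u t + t * ?c x * v t) = (\<lambda>t. g (\<zeta> + sc t (S (insert x X))))"
      unfolding S u_def v_def aff[OF insert.prems(2)] ..
    also have "(\<Sum>I\<in>X. ?c I * dif (?\<eta> I) g z)
        + (t * ?c x * (\<Sum>I\<in>X. ?c I * dif (?\<eta> I) (dif (?\<eta> x) g) z) + ?c x * v t)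
        = (\<Sum>I\<in>insert x X. ?c I * dif (?\<eta> I) g (\<zeta> + sc t (S (insert x X))))"
    proof -
      have "dif (?\<eta> I) g (\<zeta> + sc t (S (insert x X)))
          = dif (?\<eta> I) g z + t * ?c x * dif (?\<eta> I) (dif (?\<eta> x) g) z" for I
        unfolding S aff[OF ext_affine_dif[OF insert.prems(2)]] dif_commute[of "?\<eta> x"] z_def ..
      moreover have "v t = dif (?\<eta> x) g z"
        by (simp only: v_def z_def)
      ultimately show ?thesis
        using insert.hyps dd[of z]
        by (simp add: sum.distrib sum_distrib_left distrib_left mult_ac add_ac)
    qed
    finally show ?case .
  qed
  from this[OF finite_lists_length order_refl]
  have "((\<lambda>t. g (\<zeta> + sc t (S {I. length I = k i}))) has_real_derivative
      slot_deriv k i \<xi> g (\<zeta> + sc t (S {I. length I = k i}))) (at t)"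
    by (simp add: slot_deriv_def)
  also have "S {I. length I = k i} = emb i \<xi>"
    using alt_forms_expand[OF assms(2)]
    by (simp add: S_def sum_divide_distrib[symmetric] field_simps)
  finally show ?thesis .
qed

section \<open>Taylor expansion in one slot, then in all slots\<close>

lemma expand_slot:
  fixes g :: "(nat \<Rightarrow> ('n::finite) form) \<Rightarrow> real"
  assumes "ext_affine k g" "\<xi> \<in> alt_forms (k i)" "1 \<le> k i"
  shows "g (\<zeta> + emb i \<xi>) = (\<Sum>a\<le>CARD('n). (slot_deriv k i \<xi> ^^ a) g \<zeta> / fact a)"
proof -
  let ?D = "\<lambda>a t. (slot_deriv k i \<xi> ^^ a) g (\<zeta> + sc t (emb i \<xi>))"
  have D: "DERIV (?D a) t :> ?D (Suc a) t" for a t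
    using has_real_derivative_along_slot[OF ext_affine_slot_deriv_pow[OF assms(1)] assms(2,3)]
    by (simp only: funpow.simps comp_apply)
  have "\<exists>t. \<bar>t\<bar> \<le> \<bar>1\<bar> \<and> ?D 0 1 = (\<Sum>a<Suc CARD('n). ?D a 0 / fact a * 1 ^ a)
      + ?D (Suc CARD('n)) t / fact (Suc CARD('n)) * 1 ^ Suc CARD('n)"
    by (intro Maclaurin_all_le allI D refl)
  then obtain t where T: "?D 0 1 = (\<Sum>a<Suc CARD('n). ?D a 0 / fact a * 1 ^ a)
      + ?D (Suc CARD('n)) t / fact (Suc CARD('n)) * 1 ^ Suc CARD('n)"
    by blast
  \<comment> \<open>Order n + 1 annihilates the remainder for every slot, since
    \<open>1 \<le> k i\<close>. A range common to all slots keeps the exponents a plain box; it is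
    cut down to \<open>multiindices\<close> at the end.\<close>
  have "CARD('n) < k i * Suc CARD('n)"
    using assms(3) by (cases "k i") simp_all
  then have "(slot_deriv k i \<xi> ^^ Suc CARD('n)) g = (\<lambda>\<zeta>. 0)"
    by (intro slot_deriv_pow_above_dimension assms(1)) (auto intro: alt_forms_length[OF assms(2)])
  then have "?D (Suc CARD('n)) t = 0"
    by (simp only:)
  with T have "?D 0 1 = (\<Sum>a\<le>CARD('n). ?D a 0 / fact a)"
    by (simp only: lessThan_Suc_atMost power_one mult_1_right div_0 add_0_right)
  moreover have "sc 1 \<eta> = \<eta>" "\<zeta> + sc 0 \<eta> = \<zeta>" for \<eta>
    by (simp_all add: sc_def fun_eq_iff)
  ultimately show ?thesis
    by (simp only: funpow_0)
qed

text \<open>The coefficients of the expansion in the first slot are again ext. affine functions, so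
  the remaining slots are expanded by the induction hypothesis.\<close>

lemma expand_slots:
  fixes g :: "(nat \<Rightarrow> ('n::finite) form) \<Rightarrow> real"
  assumes "ext_affine k g" "distinct js"
    and "\<And>j. j \<in> set js \<Longrightarrow> \<xi> j \<in> alt_forms (k j)" "\<And>j. j \<in> set js \<Longrightarrow> 1 \<le> k j"
  shows "g (\<zeta> + (\<lambda>j. if j \<in> set js then \<xi> j else 0))
    = (\<Sum>\<alpha>\<in>(\<Pi>\<^sub>E j\<in>set js. {..CARD('n)}).
        fold (\<lambda>j. slot_deriv k j (\<xi> j) ^^ \<alpha> j) js g \<zeta> / (\<Prod>j\<in>set js. fact (\<alpha> j)))"
  using assms
proof (induction js arbitrary: g)
  case Nil
  have "\<zeta> + (\<lambda>j. 0) = \<zeta>"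
    by (simp add: fun_eq_iff)
  then show ?case by simp
next
  case (Cons i js)
  let ?P = "\<Pi>\<^sub>E j\<in>set js. {..CARD('n)}" and ?\<xi> = "\<lambda>j. if j \<in> set js then \<xi> j else 0"
  let ?T = "\<lambda>\<alpha> g. fold (\<lambda>j. slot_deriv k j (\<xi> j) ^^ \<alpha> j) js g \<zeta>"
  let ?q = "\<lambda>\<alpha>. \<Prod>j\<in>set js. fact (\<alpha> j) :: real"
  have i: "i \<notin> set js"
    using Cons.prems by simp
  have inj: "inj_on (\<lambda>(a, \<alpha>). \<alpha>(i := a)) ({..CARD('n)} \<times> ?P)"
    using inj_combinator[OF i, of "\<lambda>_. {..CARD('n)}"] .
  have "\<zeta> + (\<lambda>j. if j \<in> set (i # js) then \<xi> j else 0) = (\<zeta> + ?\<xi>) + emb i (\<xi> i)"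
    using i by (auto simp: fun_eq_iff emb_def)
  then have "g (\<zeta> + (\<lambda>j. if j \<in> set (i # js) then \<xi> j else 0))
      = (\<Sum>a\<le>CARD('n). (slot_deriv k i (\<xi> i) ^^ a) g (\<zeta> + ?\<xi>) / fact a)"
    by (simp only:) (rule expand_slot, use Cons.prems in auto)
  also have "\<dots> = (\<Sum>a\<le>CARD('n). \<Sum>\<alpha>\<in>?P. ?T \<alpha> ((slot_deriv k i (\<xi> i) ^^ a) g) / (fact a * ?q \<alpha>))"
    using Cons.prems
    by (simp add: Cons.IH[OF ext_affine_slot_deriv_pow] sum_divide_distrib mult.commute)
  also have "\<dots> = (\<Sum>(a, \<alpha>)\<in>{..CARD('n)} \<times> ?P. ?T \<alpha> ((slot_deriv k i (\<xi> i) ^^ a) g) / (fact a * ?q \<alpha>))"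
    by (rule sum.cartesian_product)
  also have "\<dots> = (\<Sum>\<alpha>\<in>(\<lambda>(a, \<alpha>). \<alpha>(i := a)) ` ({..CARD('n)} \<times> ?P).
      fold (\<lambda>j. slot_deriv k j (\<xi> j) ^^ \<alpha> j) (i # js) g \<zeta> / (\<Prod>j\<in>set (i # js). fact (\<alpha> j)))"
    unfolding sum.reindex[OF inj]
  proof (rule sum.cong[OF refl], clarsimp, goal_cases)
    case (1 a \<alpha>)
    have "fold (\<lambda>j. slot_deriv k j (\<xi> j) ^^ (if j = i then a else \<alpha> j)) js h
        = fold (\<lambda>j. slot_deriv k j (\<xi> j) ^^ \<alpha> j) js h" for h
      using i by (intro fold_cong) auto
    moreover have "(\<Prod>j\<in>set js. fact (if j = i then a else \<alpha> j)) = ?q \<alpha>"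
      using i by (intro prod.cong) auto
    ultimately show ?case
      using i by simp
  qed
  also have "(\<lambda>(a, \<alpha>). \<alpha>(i := a)) ` ({..CARD('n)} \<times> ?P) = (\<Pi>\<^sub>E j\<in>set (i # js). {..CARD('n)})"
    by (simp add: PiE_insert_eq)
  finally show ?case .
qed

text \<open>Composing \<open>f\<close> with this projection onto \<open>form_prod m k\<close> makes it a function on a vector space.\<close>

definition alt_proj :: "nat \<Rightarrow> (nat \<Rightarrow> nat) \<Rightarrow> (nat \<Rightarrow> ('n::finite) form) \<Rightarrow> nat \<Rightarrow> 'n form" where
  "alt_proj m k \<zeta> = (\<lambda>i\<in>{1..m}. \<lambda>vs.
     inverse (fact (k i)) * (\<Sum>I | length I = k i. \<zeta> i (bas I) * cov (bas I) vs))"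

lemma alt_proj_form_prod:
  fixes \<zeta> :: "nat \<Rightarrow> ('n::finite) form"
  shows "alt_proj m k \<zeta> \<in> form_prod m k"
proof -
  have "cov (bas I) \<in> alt_forms (k i)" if "length I = k i" for I :: "'n list" and i
    using cov_alt_forms[of "bas I"] that by simp
  then show ?thesis
    unfolding alt_proj_def form_prod_def
    by (auto intro!: alt_forms_scale alt_forms_sum)
qed

lemma alt_proj_eq:
  assumes "\<And>i. i \<in> {1..m} \<Longrightarrow> \<zeta> i \<in> alt_forms (k i)"
  shows "alt_proj m k \<zeta> = restrict \<zeta> {1..m}"
  using alt_forms_expand[OF assms] by (auto simp: alt_proj_def restrict_def fun_eq_iff)

lemma alt_proj_add: "alt_proj m k (\<zeta> + \<eta>) = (\<lambda>i\<in>{1..m}. \<lambda>vs. alt_proj m k \<zeta> i vs + alt_proj m k \<eta> i vs)"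
  by (auto simp: alt_proj_def restrict_def fun_eq_iff sum.distrib algebra_simps)

lemma alt_proj_sc: "i \<in> {1..m} \<Longrightarrow> alt_proj m k (sc t \<eta>) i vs = t * alt_proj m k \<eta> i vs"
  by (simp add: alt_proj_def sc_def sum_distrib_left algebra_simps)

text \<open>The direction is already alternating on \<open>{1..m}\<close>, so the projection fixes
  it there and maps each line in this direction to a line of the kind that
  \<open>vectorially_ext_one_affine\<close> controls.\<close>

lemma ext_affine_alt_proj:
  fixes f :: "(nat \<Rightarrow> ('n::finite) form) \<Rightarrow> real"
  assumes f: "vectorially_ext_one_affine m k f" and k: "\<And>i. i \<in> {1..m} \<Longrightarrow> 1 \<le> k i"
  shows "ext_affine k (\<lambda>\<zeta>. f (alt_proj m k \<zeta>))"
  unfolding ext_affine_def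
proof (intro allI impI)
  fix a and \<beta> :: "nat \<Rightarrow> 'n form"
  assume \<beta>: "\<forall>i. \<beta> i \<in> alt_forms (k i - 1)"
  let ?\<eta> = "\<lambda>i. ewedge a (\<beta> i)"
  have \<eta>: "?\<eta> i \<in> alt_forms (k i)" if "i \<in> {1..m}" for i
    using ewedge_alt_forms[of "\<beta> i" "k i - 1" a] \<beta> k[OF that] by simp
  have "\<exists>A B. \<forall>t. f (alt_proj m k (\<zeta> + sc t ?\<eta>)) = A + B * t" for \<zeta>
  proof -
    have "restrict \<beta> {1..m} \<in> form_prod m (\<lambda>i. k i - 1)"
      using \<beta> by (auto simp: form_prod_def)
    then have "\<exists>A B. \<forall>t. f (\<lambda>i\<in>{1..m}. \<lambda>vs. alt_proj m k \<zeta> i vs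
        + t * (cov [a] \<and>\<^sub>f restrict \<beta> {1..m} i) vs) = A + B * t"
      using f[unfolded vectorially_ext_one_affine_def, rule_format,
          OF alt_proj_form_prod cov_singleton(1)] by blast
    then obtain A B where AB: "\<And>t. f (\<lambda>i\<in>{1..m}. \<lambda>vs. alt_proj m k \<zeta> i vs
        + t * (cov [a] \<and>\<^sub>f restrict \<beta> {1..m} i) vs) = A + B * t"
      by blast
    have "alt_proj m k ?\<eta> = restrict ?\<eta> {1..m}"
      by (rule alt_proj_eq) (rule \<eta>)
    moreover have "?\<eta> i = cov [a] \<and>\<^sub>f \<beta> i" for i
      using ewedge_eq_wedge \<beta> by blast
    ultimately have "alt_proj m k (\<zeta> + sc t ?\<eta>) = (\<lambda>i\<in>{1..m}. \<lambda>vs. alt_proj m k \<zeta> i vs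
        + t * (cov [a] \<and>\<^sub>f restrict \<beta> {1..m} i) vs)" for t
      unfolding alt_proj_add
      by (intro restrict_ext ext)
        (simp add: alt_proj_sc del: cov.simps)
    then show ?thesis
      using AB by auto
  qed
  then show "affine_along (\<lambda>\<zeta>. f (alt_proj m k \<zeta>)) ?\<eta>"
    unfolding affine_along_def
  proof (intro allI)
    fix \<zeta> t
    obtain A B where AB: "f (alt_proj m k (\<zeta> + sc t ?\<eta>)) = A + B * t" for t
      using \<open>\<And>\<zeta>. \<exists>A B. \<forall>t. f (alt_proj m k (\<zeta> + sc t ?\<eta>)) = A + B * t\<close> by metis
    \<comment> \<open>Evaluation at t = 0 and t = 1 identifies the unspecified constants and yields
      the slope as a unit difference.\<close>
    have "sc 1 ?\<eta> = ?\<eta>" "\<zeta> + sc 0 ?\<eta> = \<zeta>"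
      by (simp_all add: sc_def fun_eq_iff)
    then have "f (alt_proj m k (\<zeta> + ?\<eta>)) = A + B" "f (alt_proj m k \<zeta>) = A"
      using AB[of 1] AB[of 0] by (metis mult_1_right, metis mult_zero_right add_0_right)
    then show "f (alt_proj m k (\<zeta> + sc t ?\<eta>))
        = f (alt_proj m k \<zeta>) + t * (f (alt_proj m k (\<zeta> + ?\<eta>)) - f (alt_proj m k \<zeta>))"
      by (simp add: AB)
  qed
qed

section \<open>The representation formula\<close>

lemma form_inner_divide_left: "form_inner k (\<lambda>vs. \<omega> vs / c) \<eta> = form_inner k \<omega> \<eta> / c"
  by (simp add: form_inner_def sum_divide_distrib mult.commute)

lemma ext_one_affine_representation:
  fixes f :: "(nat \<Rightarrow> ('n::finite) form) \<Rightarrow> real"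
  assumes f: "vectorially_ext_one_affine m k f" and k: "\<And>i. i \<in> {1..m} \<Longrightarrow> 1 \<le> k i"
  shows "\<exists>c. (\<forall>\<alpha>\<in>multiindices CARD('n) m k. c \<alpha> \<in> alt_forms (multi_degree m k \<alpha>)) \<and>
         (\<forall>\<xi>\<in>form_prod m k.
            f \<xi> = (\<Sum>\<alpha>\<in>multiindices CARD('n) m k.
                     form_inner (multi_degree m k \<alpha>) (c \<alpha>) (multi_wedge_pow m \<xi> \<alpha>)))"
proof -
  define g where "g \<zeta> = f (alt_proj m k \<zeta>)" for \<zeta>
  have g: "ext_affine k g"
    unfolding g_def using f k by (rule ext_affine_alt_proj)
  let ?js = "[1..<Suc m]"
  have set_js: "set ?js = {1..m}"
    by auto
  \<comment> \<open>The coefficients are those of the Taylor expansion at the origin; the factorials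
    of \<open>\<alpha>\<close> are divided out in \<open>c\<close>.\<close>
  define C where "C \<alpha> = iter_dif k g (concat (map (\<lambda>j. replicate (\<alpha> j) j) ?js)) 0" for \<alpha>
  define c where "c \<alpha> vs = C \<alpha> vs / (\<Prod>i=1..m. fact (\<alpha> i))" for \<alpha> vs
  have deg: "multi_degree m k \<alpha> = (\<Sum>j\<leftarrow>?js. k j * \<alpha> j)" for \<alpha>
    by (simp only: multi_degree_def sum_list_distinct_conv_sum_set[OF distinct_upt] set_js)
  have "sum_list (map k (concat (map (\<lambda>j. replicate (\<alpha> j) j) js))) = (\<Sum>j\<leftarrow>js. k j * \<alpha> j)" for js \<alpha>
    by (induction js) (simp_all add: sum_list_replicate)
  then have C: "C \<alpha> \<in> alt_forms (multi_degree m k \<alpha>)" for \<alpha>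
    using iter_dif_alt_forms[OF g, of "concat (map (\<lambda>j. replicate (\<alpha> j) j) ?js)" 0]
    unfolding C_def deg by simp
  have c: "c \<alpha> \<in> alt_forms (multi_degree m k \<alpha>)" for \<alpha>
    unfolding c_def divide_inverse mult.commute[of _ "inverse _"] by (intro alt_forms_scale C)
  have "f \<xi> = (\<Sum>\<alpha>\<in>multiindices CARD('n) m k.
      form_inner (multi_degree m k \<alpha>) (c \<alpha>) (multi_wedge_pow m \<xi> \<alpha>))" if "\<xi> \<in> form_prod m k" for \<xi>
  proof -
    have \<xi>: "\<xi> j \<in> alt_forms (k j)" if "j \<in> {1..m}" for j
      using \<open>\<xi> \<in> form_prod m k\<close> that by (auto simp: form_prod_def)
    let ?\<xi> = "\<lambda>j. if j \<in> set ?js then \<xi> j else 0"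
    let ?F = "\<lambda>\<alpha>. form_inner (multi_degree m k \<alpha>) (c \<alpha>) (multi_wedge_pow m \<xi> \<alpha>)"
    have "alt_proj m k (0 + ?\<xi>) = restrict (0 + ?\<xi>) {1..m}"
      by (rule alt_proj_eq) (use \<xi> set_js in auto)
    also have "\<dots> = \<xi>"
      using that set_js by (auto simp: form_prod_def PiE_def extensional_def fun_eq_iff)
    finally have "f \<xi> = g (0 + ?\<xi>)"
      unfolding g_def by (rule arg_cong[symmetric])
    also have "\<dots> = (\<Sum>\<alpha>\<in>(\<Pi>\<^sub>E j\<in>set ?js. {..CARD('n)}).
        fold (\<lambda>j. slot_deriv k j (\<xi> j) ^^ \<alpha> j) ?js g 0 / (\<Prod>j\<in>set ?js. fact (\<alpha> j)))"
      by (rule expand_slots[OF g distinct_upt]) (use \<xi> k set_js in auto)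
    also have "\<dots> = (\<Sum>\<alpha>\<in>(\<Pi>\<^sub>E j\<in>{1..m}. {..CARD('n)}). ?F \<alpha>)"
    proof (unfold set_js, intro sum.cong refl)
      fix \<alpha>
      have "form_inner (multi_degree m k \<alpha>) (C \<alpha>) (multi_wedge_pow m \<xi> \<alpha>)
          = fold (\<lambda>j. slot_deriv k j (\<xi> j) ^^ \<alpha> j) ?js g 0"
        unfolding deg C_def multi_wedge_pow_def
        by (rule form_inner_iter_dif_multi[OF g]) (use alt_forms_length[OF \<xi>] set_js in auto)
      then show "fold (\<lambda>j. slot_deriv k j (\<xi> j) ^^ \<alpha> j) ?js g 0 / (\<Prod>j\<in>{1..m}. fact (\<alpha> j)) = ?F \<alpha>"
        unfolding c_def[abs_def] form_inner_divide_left by (simp only:)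
    qed
    \<comment> \<open>Total degree at most n forces each \<open>\<alpha> i\<close> to be at most n
      div \<open>k i\<close>. The part of the box outside \<open>multiindices\<close> thus has total
      degree above n, where the pairing vanishes.\<close>
    also have "\<dots> = (\<Sum>\<alpha>\<in>multiindices CARD('n) m k. ?F \<alpha>)"
    proof (rule sum.mono_neutral_right)
      have "(\<Pi>\<^sub>E i\<in>{1..m}. {0..CARD('n) div k i}) \<subseteq> (\<Pi>\<^sub>E j\<in>{1..m}. {..CARD('n)})"
        by (intro PiE_mono) (auto intro: order_trans[OF _ div_le_dividend])
      then show "multiindices CARD('n) m k \<subseteq> (\<Pi>\<^sub>E j\<in>{1..m}. {..CARD('n)})"
        unfolding multiindices_def by blast
      show "\<forall>\<alpha>\<in>(\<Pi>\<^sub>E j\<in>{1..m}. {..CARD('n)}) - multiindices CARD('n) m k. ?F \<alpha> = 0"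
      proof
        fix \<alpha> assume \<alpha>: "\<alpha> \<in> (\<Pi>\<^sub>E j\<in>{1..m}. {..CARD('n)}) - multiindices CARD('n) m k"
        have "CARD('n) < multi_degree m k \<alpha>"
        proof (rule ccontr)
          assume "\<not> CARD('n) < multi_degree m k \<alpha>"
          then have le: "multi_degree m k \<alpha> \<le> CARD('n)" by simp
          have "\<alpha> i \<le> CARD('n) div k i" if "i \<in> {1..m}" for i
          proof -
            have "k i * \<alpha> i \<le> multi_degree m k \<alpha>"
              unfolding multi_degree_def using that by (intro member_le_sum) auto
            then show ?thesis
              using le k[OF that] by (simp add: less_eq_div_iff_mult_less_eq mult.commute)
          qed
          then have "\<alpha> \<in> multiindices CARD('n) m k"
            using \<alpha> le by (simp add: multiindices_def PiE_iff)
          then show False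
            using \<alpha> by simp
        qed
        then show "?F \<alpha> = 0"
          by (rule form_inner_above_dimension[OF c])
      qed
    qed (auto intro: finite_PiE)
    finally show ?thesis .
  qed
  then show ?thesis
    using c by blast
qed

section \<open>Oscillating functions\<close>

lemma lborel_integral_translate:
  fixes f :: "'a::euclidean_space \<Rightarrow> real"
  assumes "f \<in> borel_measurable borel"
  shows "(\<integral>x. f (c + x) \<partial>lborel) = (\<integral>x. f x \<partial>lborel)"
proof -
  have "(\<integral>x. f x \<partial>distr lborel borel ((+) c)) = (\<integral>x. f (c + x) \<partial>lborel)"
    by (rule integral_distr) (use assms in auto)
  then show ?thesis
    by (simp add: lborel_distr_plus)
qed

lemma lborel_integrable_translate:
  fixes f :: "'a::euclidean_space \<Rightarrow> real"
  assumes "integrable lborel f"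
  shows "integrable lborel (\<lambda>x. f (c + x))"
proof -
  have "integrable (distr lborel borel ((+) c)) f"
    using assms by (simp add: lborel_distr_plus)
  then show ?thesis
    by (subst (asm) integrable_distr_eq) (use assms in \<open>auto dest: borel_measurable_integrable\<close>)
qed

lemma tendsto_indicator_open:
  fixes T :: "'a::real_normed_vector set"
  assumes "open T" "\<delta> \<longlonglongrightarrow> 0" "x \<in> T"
  shows "(\<lambda>\<nu>. indicator T (\<delta> \<nu> + x) :: real) \<longlonglongrightarrow> 1"
proof -
  have "(\<lambda>\<nu>. \<delta> \<nu> + x) \<longlonglongrightarrow> 0 + x"
    by (intro tendsto_intros assms)
  then have "\<forall>\<^sub>F \<nu> in sequentially. \<delta> \<nu> + x \<in> T"
    using assms by (auto simp: tendsto_def)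
  then show ?thesis
    by (intro tendsto_eventually) (auto elim!: eventually_mono)
qed

text \<open>Translating by \<open>\<delta> \<nu>\<close> flips the sign of \<open>s \<nu>\<close>, so twice the integral is at most the measure of
  the symmetric difference of \<open>T\<close> and its translate.\<close>

lemma antiperiodic_integral_open:
  fixes s :: "nat \<Rightarrow> 'a::euclidean_space \<Rightarrow> real" and T :: "'a set"
  assumes meas: "\<And>\<nu>. s \<nu> \<in> borel_measurable borel" and bnd: "\<And>\<nu> x. \<bar>s \<nu> x\<bar> \<le> 1"
    and anti: "\<And>\<nu> x. s \<nu> (\<delta> \<nu> + x) = - s \<nu> x" and \<delta>: "\<delta> \<longlonglongrightarrow> 0"
    and T: "open T" "emeasure lborel T < \<infinity>"
  shows "(\<lambda>\<nu>. \<integral>x. s \<nu> x * indicator T x \<partial>lborel) \<longlonglongrightarrow> 0"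
proof -
  let ?i = "indicator T :: 'a \<Rightarrow> real"
  have iT: "integrable lborel ?i"
    using T by simp
  have iTd: "integrable lborel (\<lambda>x. ?i (\<delta> \<nu> + x))" for \<nu>
    by (rule lborel_integrable_translate[OF iT])
  have iTT: "integrable lborel (\<lambda>x. ?i x * ?i (\<delta> \<nu> + x))" for \<nu>
  proof (rule Bochner_Integration.integrable_bound[OF iT])
    show "(\<lambda>x. ?i x * ?i (\<delta> \<nu> + x)) \<in> borel_measurable lborel"
      by (intro borel_measurable_times borel_measurable_integrable iT iTd)
  qed (auto simp: indicator_def)
  have is1: "integrable lborel (\<lambda>x. s \<nu> x * ?i x)" for \<nu>
  proof (rule Bochner_Integration.integrable_bound[OF iT])
    show "(\<lambda>x. s \<nu> x * ?i x) \<in> borel_measurable lborel"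
      using meas by (intro borel_measurable_times[OF _ borel_measurable_integrable[OF iT]]) simp
  qed (use bnd in \<open>auto simp: indicator_def\<close>)
  have is2: "integrable lborel (\<lambda>x. s \<nu> x * ?i (\<delta> \<nu> + x))" for \<nu>
  proof (rule Bochner_Integration.integrable_bound[OF iTd])
    show "(\<lambda>x. s \<nu> x * ?i (\<delta> \<nu> + x)) \<in> borel_measurable lborel"
      using meas by (intro borel_measurable_times[OF _ borel_measurable_integrable[OF iTd]]) simp
  qed (use bnd in \<open>auto simp: indicator_def\<close>)
  have le: "\<bar>\<integral>x. s \<nu> x * ?i x \<partial>lborel\<bar> \<le> (\<integral>x. ?i x \<partial>lborel) - (\<integral>x. ?i x * ?i (\<delta> \<nu> + x) \<partial>lborel)" for \<nu>
  proof -
    have "(\<integral>x. s \<nu> x * ?i x \<partial>lborel) = (\<integral>x. s \<nu> (\<delta> \<nu> + x) * ?i (\<delta> \<nu> + x) \<partial>lborel)"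
      by (rule lborel_integral_translate[symmetric]) (use meas T in auto)
    then have "2 * (\<integral>x. s \<nu> x * ?i x \<partial>lborel)
        = (\<integral>x. s \<nu> x * ?i x \<partial>lborel) - (\<integral>x. s \<nu> x * ?i (\<delta> \<nu> + x) \<partial>lborel)"
      by (simp add: anti)
    also have "\<dots> = (\<integral>x. s \<nu> x * ?i x - s \<nu> x * ?i (\<delta> \<nu> + x) \<partial>lborel)"
      by (rule Bochner_Integration.integral_diff[OF is1 is2, symmetric])
    finally have "2 * \<bar>\<integral>x. s \<nu> x * ?i x \<partial>lborel\<bar>
        = \<bar>\<integral>x. s \<nu> x * ?i x - s \<nu> x * ?i (\<delta> \<nu> + x) \<partial>lborel\<bar>"
      by linarith
    also have "\<dots> \<le> (\<integral>x. \<bar>s \<nu> x * ?i x - s \<nu> x * ?i (\<delta> \<nu> + x)\<bar> \<partial>lborel)"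
      by (rule integral_abs_bound)
    also have "\<dots> \<le> (\<integral>x. ?i x + ?i (\<delta> \<nu> + x) - 2 * (?i x * ?i (\<delta> \<nu> + x)) \<partial>lborel)"
    proof (rule integral_mono)
      show "\<bar>s \<nu> x * ?i x - s \<nu> x * ?i (\<delta> \<nu> + x)\<bar> \<le> ?i x + ?i (\<delta> \<nu> + x) - 2 * (?i x * ?i (\<delta> \<nu> + x))" for x
        using bnd[of \<nu> x] by (auto simp: indicator_def)
    qed (intro integrable_abs Bochner_Integration.integrable_diff Bochner_Integration.integrable_add
        integrable_mult_right is1 is2 iT iTd iTT)+
    also have "\<dots> = (\<integral>x. ?i x \<partial>lborel) + (\<integral>x. ?i (\<delta> \<nu> + x) \<partial>lborel)
        - 2 * (\<integral>x. ?i x * ?i (\<delta> \<nu> + x) \<partial>lborel)"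
      using iT iTd iTT
      by (subst Bochner_Integration.integral_diff) (auto simp: Bochner_Integration.integral_add)
    also have "(\<integral>x. ?i (\<delta> \<nu> + x) \<partial>lborel) = (\<integral>x. ?i x \<partial>lborel)"
      by (rule lborel_integral_translate) (use T in auto)
    finally show ?thesis by linarith
  qed
  \<comment> \<open>The factor \<open>?i x\<close> requires pointwise convergence only on the open
    set \<open>T\<close>, so its boundary does not enter.\<close>
  have "(\<lambda>\<nu>. \<integral>x. ?i x * ?i (\<delta> \<nu> + x) \<partial>lborel) \<longlonglongrightarrow> (\<integral>x. ?i x \<partial>lborel)"
  proof (rule integral_dominated_convergence[where w = ?i])
    show "AE x in lborel. (\<lambda>\<nu>. ?i x * ?i (\<delta> \<nu> + x)) \<longlonglongrightarrow> ?i x"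
      using tendsto_indicator_open[OF T(1) \<delta>] by (intro AE_I2) (auto simp: indicator_def)
    show "?i \<in> borel_measurable lborel"
      by (rule borel_measurable_integrable[OF iT])
    show "(\<lambda>x. ?i x * ?i (\<delta> \<nu> + x)) \<in> borel_measurable lborel" for \<nu>
      by (rule borel_measurable_integrable[OF iTT])
  qed (rule iT, simp add: indicator_def)
  then have "(\<lambda>\<nu>. (\<integral>x. ?i x \<partial>lborel) - (\<integral>x. ?i x * ?i (\<delta> \<nu> + x) \<partial>lborel)) \<longlonglongrightarrow> 0"
    using tendsto_diff[OF tendsto_const, of _ "\<integral>x. ?i x \<partial>lborel" sequentially "\<integral>x. ?i x \<partial>lborel"] by fastforce
  then show ?thesis
    by (rule Lim_null_comparison[rotated]) (use le in \<open>auto intro!: always_eventually\<close>)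
qed

text \<open>A Riemann-Lebesgue lemma. The oscillation is bounded by 1, so the property is stable
  under approximation in L1, which is \<open>approx\<close>. Outer regularity reduces measurable
  sets to open ones, and a second use of \<open>approx\<close> handles limits of simple
  functions.\<close>

lemma antiperiodic_integral:
  fixes s :: "nat \<Rightarrow> 'a::euclidean_space \<Rightarrow> real" and f :: "'a \<Rightarrow> real"
  assumes meas: "\<And>\<nu>. s \<nu> \<in> borel_measurable borel" and bnd: "\<And>\<nu> x. \<bar>s \<nu> x\<bar> \<le> 1"
    and anti: "\<And>\<nu> x. s \<nu> (\<delta> \<nu> + x) = - s \<nu> x" and \<delta>: "\<delta> \<longlonglongrightarrow> 0"
    and f: "integrable lebesgue f"
  shows "(\<lambda>\<nu>. \<integral>x. s \<nu> x * f x \<partial>lebesgue) \<longlonglongrightarrow> 0"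
proof -
  have meas': "s \<nu> \<in> borel_measurable lebesgue" for \<nu>
    using meas[of \<nu>] by (auto intro: measurable_completion)
  have int: "integrable lebesgue (\<lambda>x. s \<nu> x * g x)" if "integrable lebesgue g" for g \<nu>
    by (rule Bochner_Integration.integrable_bound[OF that])
      (use meas' bnd that in \<open>auto simp: abs_mult intro!: mult_left_le_one_le\<close>)
  have diff: "\<bar>(\<integral>x. s \<nu> x * g x \<partial>lebesgue) - (\<integral>x. s \<nu> x * h x \<partial>lebesgue)\<bar> \<le> (\<integral>x. \<bar>g x - h x\<bar> \<partial>lebesgue)"
    if "integrable lebesgue g" "integrable lebesgue h" for g h \<nu>
  proof -
    have "(\<integral>x. s \<nu> x * g x \<partial>lebesgue) - (\<integral>x. s \<nu> x * h x \<partial>lebesgue) = (\<integral>x. s \<nu> x * (g x - h x) \<partial>lebesgue)"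
      using int that by (simp add: right_diff_distrib)
    also have "\<bar>\<dots>\<bar> \<le> (\<integral>x. \<bar>s \<nu> x * (g x - h x)\<bar> \<partial>lebesgue)"
      by (rule integral_abs_bound)
    also have "\<dots> \<le> (\<integral>x. \<bar>g x - h x\<bar> \<partial>lebesgue)"
      using int that bnd
      by (intro integral_mono integrable_abs) (auto simp: abs_mult intro!: mult_left_le_one_le)
    finally show ?thesis .
  qed
  have approx: "(\<lambda>\<nu>. \<integral>x. s \<nu> x * g x \<partial>lebesgue) \<longlonglongrightarrow> 0"
    if g: "integrable lebesgue g"
      and ex: "\<And>e::real. e > 0 \<Longrightarrow> \<exists>h. integrable lebesgue h \<and> (\<integral>x. \<bar>g x - h x\<bar> \<partial>lebesgue) \<le> e \<and>
        (\<lambda>\<nu>. \<integral>x. s \<nu> x * h x \<partial>lebesgue) \<longlonglongrightarrow> 0" for g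
  proof (rule LIMSEQ_I)
    fix r :: real assume "0 < r"
    then obtain h where h: "integrable lebesgue h" "(\<integral>x. \<bar>g x - h x\<bar> \<partial>lebesgue) \<le> r / 2"
      "(\<lambda>\<nu>. \<integral>x. s \<nu> x * h x \<partial>lebesgue) \<longlonglongrightarrow> 0"
      using ex[of "r / 2"] by auto
    then obtain N where "\<bar>\<integral>x. s \<nu> x * h x \<partial>lebesgue\<bar> < r / 2" if "\<nu> \<ge> N" for \<nu>
      using LIMSEQ_D[OF h(3), of "r / 2"] \<open>0 < r\<close> by auto
    then have "\<bar>\<integral>x. s \<nu> x * g x \<partial>lebesgue\<bar> < r" if "\<nu> \<ge> N" for \<nu>
      using diff[OF g h(1), of \<nu>] h(2) that by fastforce
    then show "\<exists>N. \<forall>\<nu>\<ge>N. norm ((\<integral>x. s \<nu> x * g x \<partial>lebesgue) - 0) < r"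
      by auto
  qed
  show ?thesis
    using f
  proof (induction f rule: integrable_induct)
    case (base A c)
    have mul: "(\<lambda>\<nu>. \<integral>x. s \<nu> x * (indicator A x *\<^sub>R c) \<partial>lebesgue)
        = (\<lambda>\<nu>. (\<integral>x. s \<nu> x * indicator A x \<partial>lebesgue) * c)"
      by (simp flip: mult.assoc)
    have "(\<lambda>\<nu>. \<integral>x. s \<nu> x * indicator A x \<partial>lebesgue) \<longlonglongrightarrow> 0"
    proof (rule approx)
      show "integrable lebesgue (indicator A :: 'a \<Rightarrow> real)"
        using base by simp
      fix e :: real assume "e > 0"
      then obtain T where T: "open T" "A \<subseteq> T" "T - A \<in> lmeasurable" "emeasure lebesgue (T - A) < ennreal e"
        using sets_lebesgue_outer_open[OF base(1)] by blast
      have "emeasure lebesgue T \<le> emeasure lebesgue A + emeasure lebesgue (T - A)"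
        using T base by (metis Un_Diff_cancel emeasure_subadditive fmeasurableD sup.absorb2)
      also have "\<dots> < \<infinity>"
        using T(3) base(2) by (auto simp: fmeasurable_def)
      finally have fin: "emeasure lebesgue T < \<infinity>" .
      then have finb: "emeasure lborel T < \<infinity>"
        using T(1) by simp
      have "(\<integral>x. s \<nu> x * indicator T x \<partial>lebesgue) = (\<integral>x. s \<nu> x * indicator T x \<partial>lborel)" for \<nu>
        by (rule integral_completion) (use meas T in auto)
      then have lim: "(\<lambda>\<nu>. \<integral>x. s \<nu> x * indicator T x \<partial>lebesgue) \<longlonglongrightarrow> 0"
        using antiperiodic_integral_open[of s \<delta> T, OF meas bnd anti \<delta> T(1) finb] by simp
      have "(\<integral>x. \<bar>indicator A x - indicator T x :: real\<bar> \<partial>lebesgue) = (\<integral>x. indicator (T - A) x \<partial>lebesgue)"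
        using T(2) by (intro Bochner_Integration.integral_cong) (auto simp: indicator_def)
      also have "\<dots> = measure lebesgue (T - A)"
        by simp
      also have "\<dots> \<le> e"
        using T(4) \<open>e > 0\<close> unfolding measure_def by (intro enn2real_leI) auto
      finally show "\<exists>h. integrable lebesgue h \<and> (\<integral>x. \<bar>indicator A x - h x\<bar> \<partial>lebesgue) \<le> e \<and>
          (\<lambda>\<nu>. \<integral>x. s \<nu> x * h x \<partial>lebesgue) \<longlonglongrightarrow> 0"
        using lim fin T(1) by (intro exI[of _ "indicator T"]) auto
    qed
    then show ?case
      unfolding mul by (rule tendsto_mult_left_zero)
  next
    case (add f g)
    then show ?case
      using int tendsto_add[of _ 0 sequentially _ 0] by (simp add: distrib_left)
  next
    case (lim f g)
    show ?case
    proof (rule approx[OF lim(4)])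
      fix e :: real assume "e > 0"
      have "(\<lambda>i. \<integral>x. \<bar>f x - g i x\<bar> \<partial>lebesgue) \<longlonglongrightarrow> integral\<^sup>L lebesgue (\<lambda>x :: 'a. \<bar>0 :: real\<bar>)"
      \<comment> \<open>The constant 3 arises because the approximants of
        \<open>integrable_induct\<close> are bounded by twice the limit.\<close>
      proof (rule integral_dominated_convergence[where w = "\<lambda>x. 3 * \<bar>f x\<bar>"])
        show "AE x in lebesgue. (\<lambda>i. \<bar>f x - g i x\<bar>) \<longlonglongrightarrow> \<bar>0\<bar>"
        proof (rule AE_I2)
          fix x :: 'a assume "x \<in> space lebesgue"
          then have "(\<lambda>i. \<bar>f x - g i x\<bar>) \<longlonglongrightarrow> \<bar>f x - f x\<bar>"
            by (intro tendsto_rabs tendsto_diff tendsto_const lim(2))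
          then show "(\<lambda>i. \<bar>f x - g i x\<bar>) \<longlonglongrightarrow> \<bar>0\<bar>"
            by simp
        qed
        show "AE x in lebesgue. norm \<bar>f x - g i x\<bar> \<le> 3 * \<bar>f x\<bar>" for i
        proof (intro AE_I2)
          fix x :: 'a assume "x \<in> space lebesgue"
          then have "\<bar>g i x\<bar> \<le> 2 * \<bar>f x\<bar>"
            using lim(3)[of x i] by simp
          then show "norm \<bar>f x - g i x\<bar> \<le> 3 * \<bar>f x\<bar>"
            by simp
        qed
      qed (use lim in auto)
      then have "(\<lambda>i. \<integral>x. \<bar>f x - g i x\<bar> \<partial>lebesgue) \<longlonglongrightarrow> 0"
        by simp
      then have "\<forall>\<^sub>F i in sequentially. (\<integral>x. \<bar>f x - g i x\<bar> \<partial>lebesgue) < e"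
        using \<open>e > 0\<close> by (rule order_tendstoD)
      then obtain i where "(\<integral>x. \<bar>f x - g i x\<bar> \<partial>lebesgue) < e"
        by (auto simp: eventually_sequentially)
      then show "\<exists>h. integrable lebesgue h \<and> (\<integral>x. \<bar>f x - h x\<bar> \<partial>lebesgue) \<le> e \<and>
          (\<lambda>\<nu>. \<integral>x. s \<nu> x * h x \<partial>lebesgue) \<longlonglongrightarrow> 0"
        using lim by (intro exI[of _ "g i"]) auto
    qed
  qed
qed

section \<open>Square and triangle waves\<close>

definition square_wave :: "real \<Rightarrow> real" where
  "square_wave s = (if even \<lfloor>s\<rfloor> then 1 else - 1)"

text \<open>The distance to the nearest even integer, which is
  \<open>2 * \<lfloor>(s + 1) / 2\<rfloor>\<close>.\<close>

definition triangle_wave :: "real \<Rightarrow> real" where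
  "triangle_wave s = \<bar>s - 2 * real_of_int \<lfloor>(s + 1) / 2\<rfloor>\<bar>"

lemma square_wave_add_one: "square_wave (s + 1) = - square_wave s"
  by (simp add: square_wave_def)

lemma abs_square_wave: "\<bar>square_wave s\<bar> = 1"
  by (simp add: square_wave_def)

lemma square_wave_measurable [measurable]: "square_wave \<in> borel_measurable borel"
  unfolding square_wave_def[abs_def] by measurable

lemma floor_half:
  fixes s :: real
  shows "2 * real_of_int \<lfloor>(s + 1) / 2\<rfloor> \<le> s + 1" "s + 1 < 2 * real_of_int \<lfloor>(s + 1) / 2\<rfloor> + 2"
proof -
  obtain j where j: "j = \<lfloor>(s + 1) / 2\<rfloor>" by blast
  have "real_of_int j \<le> (s + 1) / 2" "(s + 1) / 2 < real_of_int j + 1"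
    unfolding j by (rule of_int_floor_le, rule real_of_int_floor_add_one_gt)
  then show "2 * real_of_int \<lfloor>(s + 1) / 2\<rfloor> \<le> s + 1" "s + 1 < 2 * real_of_int \<lfloor>(s + 1) / 2\<rfloor> + 2"
    unfolding j[symmetric] by (simp_all add: field_simps)
qed

text \<open>For the Lipschitz bound: as with any distance function, one inserts the even integer
  nearest to the other point.\<close>

lemma triangle_wave_le: "triangle_wave s \<le> \<bar>s - 2 * real_of_int j\<bar>"
proof -
  let ?j = "\<lfloor>(s + 1) / 2\<rfloor>"
  have 1: "\<bar>s - 2 * real_of_int ?j\<bar> \<le> 1"
    using floor_half[of s] by linarith
  consider "j = ?j" | "j \<le> ?j - 1" | "?j + 1 \<le> j"
    by linarith
  then show ?thesis
    unfolding triangle_wave_def by cases (use 1 in linarith)+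
qed

lemma triangle_wave_bounds: "0 \<le> triangle_wave s" "triangle_wave s \<le> 1"
  using floor_half[of s] unfolding triangle_wave_def by linarith+

lemma triangle_wave_lipschitz: "\<bar>triangle_wave s - triangle_wave t\<bar> \<le> \<bar>s - t\<bar>"
proof -
  have "triangle_wave s \<le> triangle_wave t + \<bar>s - t\<bar>" for s t
    using triangle_wave_le[of s "\<lfloor>(t + 1) / 2\<rfloor>"] unfolding triangle_wave_def[of t] by linarith
  from this[of s t] this[of t s] show ?thesis by linarith
qed

lemma triangle_wave_deriv:
  assumes "s \<notin> \<int>"
  shows "(triangle_wave has_real_derivative square_wave s) (at s)"
proof -
  define i where "i = \<lfloor>s\<rfloor>"
  have s: "s \<in> {real_of_int i<..<real_of_int i + 1}"
    using assms floor_correct[of s] Ints_of_int[of "\<lfloor>s\<rfloor>"] unfolding i_def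
    by (metis greaterThanLessThan_iff of_int_1 of_int_add order_le_less)
  have lin: "((\<lambda>y. c * (y - d)) has_real_derivative c) (at s)" for c d :: real
    by (auto intro!: derivative_eq_intros)
  show ?thesis
  proof (cases "even i")
    case True
    then obtain j where j: "i = 2 * j" by blast
    have eq: "1 * (y - 2 * real_of_int j) = triangle_wave y" if "y \<in> {real_of_int i<..<real_of_int i + 1}" for y
    proof -
      have "\<lfloor>(y + 1) / 2\<rfloor> = j"
        using that j by (simp add: floor_eq_iff field_simps)
      then show ?thesis
        using that j by (simp add: triangle_wave_def)
    qed
    have "(triangle_wave has_real_derivative 1) (at s)"
      by (rule has_field_derivative_transform_within_open[OF lin[of 1 "2 * real_of_int j"] _ s eq]) auto
    then show ?thesis
      using True by (simp add: square_wave_def i_def[symmetric])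
  next
    case False
    then obtain j where j: "i = 2 * j + 1" by (elim oddE)
    have eq: "- 1 * (y - 2 * (real_of_int j + 1)) = triangle_wave y" if "y \<in> {real_of_int i<..<real_of_int i + 1}" for y
    proof -
      have "\<lfloor>(y + 1) / 2\<rfloor> = j + 1"
        using that j by (simp add: floor_eq_iff field_simps)
      then show ?thesis
        using that j by (simp add: triangle_wave_def)
    qed
    have "(triangle_wave has_real_derivative - 1) (at s)"
      by (rule has_field_derivative_transform_within_open[OF lin[of "- 1" "2 * (real_of_int j + 1)"] _ s eq]) auto
    then show ?thesis
      using False by (simp add: square_wave_def i_def[symmetric])
  qed
qed

text \<open>The exceptional set is a countable union of parallel hyperplanes. It will carry the
  kinks of the triangle wave.\<close>

lemma AE_inner_notin_Ints:
  fixes a :: "'a::euclidean_space"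
  assumes "a \<noteq> 0"
  shows "AE x in lborel. a \<bullet> x \<notin> \<int>"
proof -
  have "AE x in lebesgue. a \<bullet> x \<noteq> real_of_int j" for j
    using negligible_hyperplane[of a "real_of_int j"] assms
    by (auto simp: negligible_iff_null_sets intro: AE_I')
  then have "AE x in lebesgue. \<forall>j. a \<bullet> x \<noteq> real_of_int j"
    by (simp add: AE_all_countable)
  then show ?thesis
    unfolding AE_completion_iff by (auto simp: Ints_def)
qed

lemma square_wave_weakly_null:
  fixes a :: "'a::euclidean_space"
  assumes a: "a \<noteq> 0" and f: "integrable lebesgue f"
  shows "(\<lambda>\<nu>. \<integral>x. square_wave (real (Suc \<nu>) * (a \<bullet> x)) * f x \<partial>lebesgue) \<longlonglongrightarrow> 0"
\<comment> \<open>This shift raises \<open>real (Suc \<nu>) * (a \<bullet> x)\<close> by exactly 1,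
  half a period of the square wave.\<close>
proof (rule antiperiodic_integral[where \<delta> = "\<lambda>\<nu>. (1 / real (Suc \<nu>)) *\<^sub>R (a /\<^sub>R (a \<bullet> a))"])
  show "square_wave (real (Suc \<nu>) * (a \<bullet> ((1 / real (Suc \<nu>)) *\<^sub>R (a /\<^sub>R (a \<bullet> a)) + x)))
      = - square_wave (real (Suc \<nu>) * (a \<bullet> x))" for \<nu> x
  proof -
    have "real (Suc \<nu>) * (a \<bullet> ((1 / real (Suc \<nu>)) *\<^sub>R (a /\<^sub>R (a \<bullet> a)) + x)) = real (Suc \<nu>) * (a \<bullet> x) + 1"
      using a by (simp add: inner_add_right distrib_left del: of_nat_Suc)
    then show ?thesis by (simp only: square_wave_add_one)
  qed
  have "(\<lambda>\<nu>. (1 / real (Suc \<nu>)) *\<^sub>R (a /\<^sub>R (a \<bullet> a))) \<longlonglongrightarrow> 0 *\<^sub>R (a /\<^sub>R (a \<bullet> a))"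
    by (intro tendsto_intros lim_1_over_n[THEN LIMSEQ_Suc])
  then show "(\<lambda>\<nu>. (1 / real (Suc \<nu>)) *\<^sub>R (a /\<^sub>R (a \<bullet> a))) \<longlonglongrightarrow> 0"
    by simp
qed (use f in \<open>auto simp: abs_square_wave\<close>)

section \<open>Test functions and weak derivatives\<close>

lemma integral_lebesgue_on_eq_lborel:
  fixes f :: "'a::euclidean_space \<Rightarrow> real"
  assumes "f \<in> borel_measurable borel" "S \<in> sets lebesgue" "\<And>x. x \<notin> S \<Longrightarrow> f x = 0"
  shows "integral\<^sup>L (lebesgue_on S) f = integral\<^sup>L lborel f"
proof -
  have "integral\<^sup>L (lebesgue_on S) f = integral\<^sup>L lebesgue (\<lambda>x. indicator S x *\<^sub>R f x)"
    using assms(2) by (intro integral_restrict_space) auto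
  also have "(\<lambda>x. indicator S x *\<^sub>R f x) = f"
    using assms(3) by (auto simp: indicator_def fun_eq_iff)
  also have "integral\<^sup>L lebesgue f = integral\<^sup>L lborel f"
    using assms(1) by (intro integral_completion) auto
  finally show ?thesis .
qed

lemma integrable_compact_support:
  fixes f :: "'a::euclidean_space \<Rightarrow> real"
  assumes "continuous_on UNIV f" "\<And>x. x \<notin> cball 0 R \<Longrightarrow> f x = 0"
  shows "integrable lborel f"
proof -
  have "integrable lborel (\<lambda>x. indicator (cball 0 R) x *\<^sub>R f x)"
    by (rule borel_integrable_compact) (use assms(1) in \<open>auto intro: continuous_on_subset\<close>)
  also have "(\<lambda>x. indicator (cball 0 R) x *\<^sub>R f x) = f"
    using assms(2) by (auto simp: indicator_def fun_eq_iff)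
  finally show ?thesis .
qed

lemma dir_deriv_eq: "(f has_derivative f') (at x) \<Longrightarrow> dir_deriv v f x = f' v"
  by (simp add: dir_deriv_def frechet_derivative_at[symmetric])

lemma dir_deriv_works:
  "f differentiable (at x) \<Longrightarrow> (f has_derivative (\<lambda>v. dir_deriv v f x)) (at x)"
  unfolding dir_deriv_def by (simp add: frechet_derivative_works)

lemma dir_deriv_line:
  assumes "f differentiable (at (x + h *\<^sub>R v))"
  shows "((\<lambda>h. f (x + h *\<^sub>R v)) has_real_derivative dir_deriv v f (x + h *\<^sub>R v)) (at h)"
proof -
  let ?D = "\<lambda>w. dir_deriv w f (x + h *\<^sub>R v)"
  have D: "(f has_derivative ?D) (at (x + h *\<^sub>R v))"
    by (rule dir_deriv_works[OF assms])
  have "((\<lambda>h. x + h *\<^sub>R v) has_derivative (\<lambda>t. t *\<^sub>R v)) (at h)"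
    by (auto intro!: derivative_eq_intros)
  from diff_chain_at[OF this D] have "((\<lambda>h. f (x + h *\<^sub>R v)) has_derivative (\<lambda>t. ?D (t *\<^sub>R v))) (at h)"
    by (simp add: comp_def)
  moreover have "?D (t *\<^sub>R v) = ?D v * t" for t
    using linear_scale[OF has_derivative_linear[OF D], of t v] by simp
  ultimately show ?thesis
    by (simp add: has_field_derivative_def mult_commute_abs)
qed

lemma has_real_derivative_sequentially:
  assumes "(f has_real_derivative D) (at 0)" "h \<longlonglongrightarrow> 0" "\<And>j::nat. h j \<noteq> 0"
  shows "(\<lambda>j. (f (h j) - f 0) / h j) \<longlonglongrightarrow> D"
proof -
  have "(\<lambda>t. (f (0 + t) - f 0) / t) \<midarrow>0\<rightarrow> D"
    using assms(1) by (simp add: DERIV_def)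
  moreover have "filterlim h (at 0) sequentially"
    using assms(2,3) by (simp add: filterlim_at)
  ultimately show ?thesis
    using filterlim_compose[of "\<lambda>t. (f (0 + t) - f 0) / t" "nhds D" "at 0" h sequentially] by simp
qed

context
  fixes \<phi> :: "real ^ ('n::finite) \<Rightarrow> real" and \<Omega>
  assumes \<phi>: "\<phi> \<in> test_functions \<Omega>"
begin

lemma test_function_differentiable: "\<phi> differentiable (at x)"
  using \<phi> by (simp add: test_functions_def smooth_def) (metis fold_simps(1))

lemma test_function_dir_deriv_differentiable: "dir_deriv v \<phi> differentiable (at x)"
  using \<phi> by (simp add: test_functions_def smooth_def) (metis fold_simps)

lemma test_function_continuous: "continuous_on UNIV \<phi>" "continuous_on UNIV (dir_deriv v \<phi>)"
  using test_function_differentiable test_function_dir_deriv_differentiable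
  by (simp_all add: continuous_at_imp_continuous_on differentiable_imp_continuous_within)

lemma test_function_measurable:
  "\<phi> \<in> borel_measurable borel" "dir_deriv v \<phi> \<in> borel_measurable borel"
  using test_function_continuous by (auto intro: borel_measurable_continuous_onI)

lemma test_function_outside: "x \<notin> closure {x. \<phi> x \<noteq> 0} \<Longrightarrow> \<phi> x = 0"
  using closure_subset[of "{x. \<phi> x \<noteq> 0}"] by auto

lemma test_function_dir_deriv_outside: "x \<notin> closure {x. \<phi> x \<noteq> 0} \<Longrightarrow> dir_deriv v \<phi> x = 0"
proof -
  assume "x \<notin> closure {x. \<phi> x \<noteq> 0}"
  then have x: "x \<in> - closure {x. \<phi> x \<noteq> 0}"
    by simp
  have "(\<phi> has_derivative (\<lambda>v. 0)) (at x)"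
  proof (rule has_derivative_transform_within_open[OF has_derivative_const _ x])
    show "0 = \<phi> y" if "y \<in> - closure {x. \<phi> x \<noteq> 0}" for y
      using test_function_outside[of y] that by (metis ComplD)
  qed auto
  then show ?thesis
    by (rule dir_deriv_eq)
qed

lemma test_function_zero:
  "x \<notin> \<Omega> \<Longrightarrow> \<phi> x = 0" "x \<notin> \<Omega> \<Longrightarrow> dir_deriv v \<phi> x = 0"
proof -
  have "closure {x. \<phi> x \<noteq> 0} \<subseteq> \<Omega>"
    using \<phi> by (simp add: test_functions_def)
  then show "x \<notin> \<Omega> \<Longrightarrow> \<phi> x = 0" "x \<notin> \<Omega> \<Longrightarrow> dir_deriv v \<phi> x = 0"
    using test_function_outside test_function_dir_deriv_outside by blast+
qed

lemma test_function_support: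
  obtains r where "r \<ge> 0" "closure {x. \<phi> x \<noteq> 0} \<subseteq> cball 0 r"
proof -
  have "bounded (closure {x. \<phi> x \<noteq> 0})"
    using \<phi> by (auto simp: test_functions_def intro: compact_imp_bounded)
  then obtain r where "r > 0" "closure {x. \<phi> x \<noteq> 0} \<subseteq> cball 0 r"
    by (auto simp: bounded_pos subset_iff mem_cball_0)
  then show ?thesis
    using that[of r] by simp
qed

lemma test_function_integrable: "integrable lborel \<phi>"
  using test_function_support integrable_compact_support[OF test_function_continuous(1)]
    test_function_outside by (metis subsetD)

lemma test_function_dir_deriv_bounded:
  obtains M where "\<And>x. \<bar>dir_deriv v \<phi> x\<bar> \<le> M"
proof -
  have "compact (dir_deriv v \<phi> ` closure {x. \<phi> x \<noteq> 0})"
    using \<phi> test_function_continuous(2)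
    by (intro compact_continuous_image) (auto simp: test_functions_def intro: continuous_on_subset)
  then obtain M where M: "M > 0" "\<And>y. y \<in> dir_deriv v \<phi> ` closure {x. \<phi> x \<noteq> 0} \<Longrightarrow> norm y \<le> M"
    by (metis bounded_pos compact_imp_bounded)
  then have "\<bar>dir_deriv v \<phi> x\<bar> \<le> M" for x
    using test_function_dir_deriv_outside[of x v] by (cases "x \<in> closure {x. \<phi> x \<noteq> 0}") auto
  then show ?thesis by (rule that)
qed

text \<open>The difference quotient is moved from \<open>\<phi>\<close> to \<open>u\<close> by translation, and both sides pass to the limit by
  dominated convergence.\<close>

lemma weak_derivative_of_lipschitz:
  assumes lip: "\<And>x y. \<bar>u x - u y\<bar> \<le> C * norm (x - y)"
    and D: "D \<in> borel_measurable borel"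
      "AE x in lborel. ((\<lambda>h. u (x + h *\<^sub>R v)) has_real_derivative D x) (at 0)"
  shows "(\<integral>x. u x * dir_deriv v \<phi> x \<partial>lborel) = - (\<integral>x. D x * \<phi> x \<partial>lborel)"
proof -
  \<comment> \<open>Steps of length at most 1 keep all translates of the support of
    \<open>\<phi>\<close> in one ball, of radius \<open>r + norm v\<close>, which gives an
    integrable majorant.\<close>
  define h where "h j = 1 / real (Suc j)" for j
  have h: "0 < h j" "h j \<le> 1" for j
    by (simp_all add: h_def)
  have h0: "h \<longlonglongrightarrow> 0"
    unfolding h_def by (rule lim_1_over_n[THEN LIMSEQ_Suc])
  obtain r where r: "r \<ge> 0" "closure {x. \<phi> x \<noteq> 0} \<subseteq> cball 0 r"
    by (rule test_function_support)
  obtain M where M: "\<And>x. \<bar>dir_deriv v \<phi> x\<bar> \<le> M"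
    using test_function_dir_deriv_bounded[of v] by blast
  have M0: "0 \<le> M"
    using M[of 0] by linarith
  have uc: "continuous_on UNIV u"
  proof (rule continuous_on_iff[THEN iffD2], intro ballI allI impI)
    fix x and e :: real assume "e > 0"
    have "\<bar>u y - u x\<bar> < e" if "dist y x < e / (\<bar>C\<bar> + 1)" for y
    proof -
      have "\<bar>u y - u x\<bar> \<le> (\<bar>C\<bar> + 1) * norm (y - x)"
        using lip[of y x] by (meson abs_ge_self add_increasing2 mult_right_mono norm_ge_zero order_trans zero_le_one)
      also have "\<dots> < e"
        using that by (simp add: dist_norm field_simps)
      finally show ?thesis .
    qed
    then show "\<exists>d>0. \<forall>y\<in>UNIV. dist y x < d \<longrightarrow> dist (u y) (u x) < e"
      using \<open>e > 0\<close> by (intro exI[of _ "e / (\<bar>C\<bar> + 1)"]) (auto simp: dist_real_def)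
  qed
  note cont = continuous_on_compose2[OF uc _ subset_UNIV]
    continuous_on_compose2[OF test_function_continuous(1) _ subset_UNIV]
  have out: "\<phi> x = 0" "dir_deriv v \<phi> x = 0" if "x \<notin> cball 0 r" for x
    using that r test_function_outside test_function_dir_deriv_outside by blast+
  have out': "\<phi> (x + h j *\<^sub>R v) = 0" "\<phi> x = 0" if "x \<notin> cball 0 (r + norm v)" for x j
  proof -
    have "norm (h j *\<^sub>R v) \<le> norm v"
      using h[of j] by (simp add: mult_left_le_one_le)
    moreover have "norm x \<le> norm (x + h j *\<^sub>R v) + norm (h j *\<^sub>R v)"
      using norm_triangle_ineq4[of "x + h j *\<^sub>R v" "h j *\<^sub>R v"] by simp
    moreover have "r + norm v < norm x"
      using that by simp
    ultimately have "r < norm (x + h j *\<^sub>R v)" "r < norm x"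
      using norm_ge_zero[of v] by linarith+
    then show "\<phi> (x + h j *\<^sub>R v) = 0" "\<phi> x = 0"
      by (auto intro!: out(1))
  qed
  have i1: "integrable lborel (\<lambda>x. u x * \<phi> (x + h j *\<^sub>R v))" for j
    by (rule integrable_compact_support[where R = "r + norm v"])
      (auto intro!: continuous_intros cont simp: out')
  have i2: "integrable lborel (\<lambda>x. u (x - h j *\<^sub>R v) * \<phi> x)" for j
    by (rule integrable_compact_support[where R = r]) (auto intro!: continuous_intros cont simp: out)
  have i3: "integrable lborel (\<lambda>x. u x * \<phi> x)"
    by (rule integrable_compact_support[where R = r]) (auto intro!: continuous_intros cont simp: out)
  define s t where "s j x = u x * ((\<phi> (x + h j *\<^sub>R v) - \<phi> x) / h j)"
    and "t j x = (u (x - h j *\<^sub>R v) - u x) / h j * \<phi> x" for j x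
  have st: "(\<integral>x. s j x \<partial>lborel) = (\<integral>x. t j x \<partial>lborel)" for j
  proof -
    have "(\<integral>x. u (- (h j *\<^sub>R v) + x) * \<phi> (- (h j *\<^sub>R v) + x + h j *\<^sub>R v) \<partial>lborel)
        = (\<integral>x. u x * \<phi> (x + h j *\<^sub>R v) \<partial>lborel)"
      by (rule lborel_integral_translate[where f = "\<lambda>x. u x * \<phi> (x + h j *\<^sub>R v)"])
        (use i1[THEN borel_measurable_integrable] in auto)
    then have eq: "(\<integral>x. u x * \<phi> (x + h j *\<^sub>R v) \<partial>lborel) = (\<integral>x. u (x - h j *\<^sub>R v) * \<phi> x \<partial>lborel)"
      by simp
    have "(\<integral>x. s j x \<partial>lborel) = (\<integral>x. (u x * \<phi> (x + h j *\<^sub>R v) - u x * \<phi> x) / h j \<partial>lborel)"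
      by (simp add: s_def right_diff_distrib)
    also have "\<dots> = ((\<integral>x. u x * \<phi> (x + h j *\<^sub>R v) \<partial>lborel) - (\<integral>x. u x * \<phi> x \<partial>lborel)) / h j"
      using i1 i3 by (simp add: Bochner_Integration.integral_diff)
    also have "\<dots> = (\<integral>x. (u (x - h j *\<^sub>R v) * \<phi> x - u x * \<phi> x) / h j \<partial>lborel)"
      using i2 i3 by (simp add: Bochner_Integration.integral_diff eq)
    also have "\<dots> = (\<integral>x. t j x \<partial>lborel)"
      by (simp add: t_def left_diff_distrib)
    finally show ?thesis .
  qed
  have "(\<lambda>j. \<integral>x. s j x \<partial>lborel) \<longlonglongrightarrow> (\<integral>x. u x * dir_deriv v \<phi> x \<partial>lborel)"
  proof (rule integral_dominated_convergence[where w = "\<lambda>x. indicator (cball 0 (r + norm v)) x *\<^sub>R (\<bar>u x\<bar> * M)"])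
    show "(\<lambda>x. u x * dir_deriv v \<phi> x) \<in> borel_measurable lborel"
      using borel_measurable_continuous_onI[OF uc] test_function_measurable by simp
    show "s j \<in> borel_measurable lborel" for j
      unfolding s_def[abs_def]
      by (simp, intro borel_measurable_continuous_onI continuous_intros cont) (use h(1)[of j] in auto)
    show "integrable lborel (\<lambda>x. indicator (cball 0 (r + norm v)) x *\<^sub>R (\<bar>u x\<bar> * M))"
      by (rule borel_integrable_compact) (auto intro!: continuous_intros cont)
    show "AE x in lborel. (\<lambda>j. s j x) \<longlonglongrightarrow> u x * dir_deriv v \<phi> x"
    proof (intro AE_I2)
      fix x
      have "(\<lambda>j. (\<phi> (x + h j *\<^sub>R v) - \<phi> (x + 0 *\<^sub>R v)) / h j) \<longlonglongrightarrow> dir_deriv v \<phi> (x + 0 *\<^sub>R v)"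
        by (rule has_real_derivative_sequentially[OF dir_deriv_line[OF test_function_differentiable] h0])
          (use h in \<open>simp add: less_imp_neq[symmetric]\<close>)
      then show "(\<lambda>j. s j x) \<longlonglongrightarrow> u x * dir_deriv v \<phi> x"
        unfolding s_def by (intro tendsto_mult tendsto_const) simp
    qed
    show "AE x in lborel. norm (s j x) \<le> indicator (cball 0 (r + norm v)) x *\<^sub>R (\<bar>u x\<bar> * M)" for j
    proof (intro AE_I2)
      fix x
      show "norm (s j x) \<le> indicator (cball 0 (r + norm v)) x *\<^sub>R (\<bar>u x\<bar> * M)"
      proof (cases "x \<in> cball 0 (r + norm v)")
        case True
        \<comment> \<open>The mean value theorem bounds the difference quotients of
          \<open>\<phi>\<close> by \<open>M\<close>, uniformly in the step.\<close>
        have "\<exists>z. 0 < z \<and> z < h j \<and> \<phi> (x + h j *\<^sub>R v) - \<phi> (x + 0 *\<^sub>R v)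
            = (h j - 0) * dir_deriv v \<phi> (x + z *\<^sub>R v)"
          by (rule MVT2[OF h(1)]) (rule dir_deriv_line[OF test_function_differentiable])
        then obtain z where "(\<phi> (x + h j *\<^sub>R v) - \<phi> x) / h j = dir_deriv v \<phi> (x + z *\<^sub>R v)"
          using h(1)[of j] by (auto simp: field_simps)
        then have "norm (s j x) \<le> \<bar>u x\<bar> * M"
          using M by (simp add: s_def abs_mult mult_left_mono)
        then show ?thesis using True by simp
      next
        case False
        then show ?thesis by (simp add: s_def out')
      qed
    qed
  qed
  moreover have "(\<lambda>j. \<integral>x. t j x \<partial>lborel) \<longlonglongrightarrow> (\<integral>x. - D x * \<phi> x \<partial>lborel)"
  proof (rule integral_dominated_convergence[where w = "\<lambda>x. C * norm v * \<bar>\<phi> x\<bar>"])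
    show "(\<lambda>x. - D x * \<phi> x) \<in> borel_measurable lborel"
      using D test_function_measurable by simp
    show "t j \<in> borel_measurable lborel" for j
      unfolding t_def[abs_def]
      by (simp, intro borel_measurable_continuous_onI continuous_intros cont) (use h(1)[of j] in auto)
    show "integrable lborel (\<lambda>x. C * norm v * \<bar>\<phi> x\<bar>)"
      using test_function_integrable by (intro integrable_mult_right integrable_abs)
    show "AE x in lborel. (\<lambda>j. t j x) \<longlonglongrightarrow> - D x * \<phi> x"
      using D(2)
    proof eventually_elim
      case (elim x)
      \<comment> \<open>After the translation \<open>u\<close> is shifted by \<open>- h j\<close>;
        the quotient with this negative step tends to \<open>D x\<close>, hence the minus sign of
        the integration by parts.\<close>
      have "(\<lambda>j. (u (x + (- h j) *\<^sub>R v) - u (x + 0 *\<^sub>R v)) / (- h j)) \<longlonglongrightarrow> D x"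
        by (rule has_real_derivative_sequentially[OF elim])
          (use h tendsto_minus[OF h0] in \<open>simp_all add: less_imp_neq[symmetric]\<close>)
      then have "(\<lambda>j. - ((u (x + (- h j) *\<^sub>R v) - u (x + 0 *\<^sub>R v)) / (- h j)) * \<phi> x) \<longlonglongrightarrow> - D x * \<phi> x"
        by (intro tendsto_intros)
      then show ?case
        by (simp add: t_def)
    qed
    show "AE x in lborel. norm (t j x) \<le> C * norm v * \<bar>\<phi> x\<bar>" for j
    proof (intro AE_I2)
      fix x
      have "\<bar>u (x - h j *\<^sub>R v) - u x\<bar> \<le> C * (h j * norm v)"
        using lip[of "x - h j *\<^sub>R v" x] h(1)[of j] by simp
      then have "\<bar>(u (x - h j *\<^sub>R v) - u x) / h j\<bar> \<le> C * norm v"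
        using h(1)[of j] by (simp add: field_simps)
      then show "norm (t j x) \<le> C * norm v * \<bar>\<phi> x\<bar>"
        unfolding t_def real_norm_def abs_mult by (rule mult_right_mono) simp
    qed
  qed
  ultimately have "(\<integral>x. u x * dir_deriv v \<phi> x \<partial>lborel) = (\<integral>x. - D x * \<phi> x \<partial>lborel)"
    using st LIMSEQ_unique by simp
  then show ?thesis
    by simp
qed

end

section \<open>A smooth bump function\<close>

definition exp_recip :: "nat \<Rightarrow> real \<Rightarrow> real" where
  "exp_recip k t = (if 0 < t then exp (- 1 / t) / t ^ k else 0)"

text \<open>The powers of t are carried along so that the family is closed under differentiation. At
  the origin the right difference quotient is x ^ (k + 1) / exp x at x = 1 / h, which tends to
  0.\<close>

lemma exp_recip_deriv:
  "(exp_recip k has_real_derivative exp_recip (k + 2) t - real k * exp_recip (k + 1) t) (at t)"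
proof -
  consider "t < 0" | "t = 0" | "0 < t" by linarith
  then show ?thesis
  proof cases
    case 1
    have "(exp_recip k has_real_derivative 0) (at t)"
      by (rule has_field_derivative_transform_within_open[OF DERIV_const open_lessThan[of 0]])
        (use 1 in \<open>auto simp: exp_recip_def\<close>)
    then show ?thesis
      using 1 by (simp add: exp_recip_def)
  next
    case 2
    have "((\<lambda>x::real. x ^ (k + 1) / exp x) \<longlongrightarrow> 0) at_top"
      by (rule tendsto_power_div_exp_0)
    from filterlim_compose[OF this filterlim_inverse_at_top_right]
    have "((\<lambda>h::real. inverse h ^ (k + 1) / exp (inverse h)) \<longlongrightarrow> 0) (at_right 0)" .
    then have "((\<lambda>h. (exp_recip k (0 + h) - exp_recip k 0) / h) \<longlongrightarrow> 0) (at_right 0)"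
      by (rule Lim_transform_eventually)
        (auto simp: eventually_at_right_field exp_recip_def field_simps exp_minus intro!: exI[of _ 1])
    moreover have "((\<lambda>h. (exp_recip k (0 + h) - exp_recip k 0) / h) \<longlongrightarrow> 0) (at_left 0)"
      by (rule Lim_transform_eventually[OF tendsto_const])
        (auto simp: eventually_at_left_field exp_recip_def intro!: exI[of _ "- 1"])
    ultimately have "(exp_recip k has_real_derivative 0) (at 0)"
      unfolding DERIV_def by (simp add: filterlim_at_split)
    then show ?thesis
      using 2 by (simp add: exp_recip_def)
  next
    case 3
    define p c where "p = t ^ k" and "c = exp (- 1 / t)"
    have "((\<lambda>t. exp (- 1 / t)) has_real_derivative c / (t * t)) (at t)"
      unfolding c_def using 3 by (auto intro!: derivative_eq_intros)
    moreover have "((\<lambda>t. t ^ k) has_real_derivative real k * p / t) (at t)"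
    proof -
      have "real k * p / t = real k * t ^ (k - Suc 0)"
        using 3 by (cases k) (simp_all add: p_def)
      then show ?thesis
        using DERIV_pow[of k t UNIV] by simp
    qed
    ultimately have "((\<lambda>t. exp (- 1 / t) / t ^ k) has_real_derivative
        (c / (t * t) * t ^ k - exp (- 1 / t) * (real k * p / t)) / (t ^ k * t ^ k)) (at t)"
      using 3 by (intro DERIV_divide) simp_all
    moreover have "(c / (t * t) * p - c * (real k * p / t)) / (p * p) = c / (p * t * t) - real k * (c / (p * t))"
      using 3 by (simp add: p_def field_simps)
    ultimately have "((\<lambda>t. exp (- 1 / t) / t ^ k) has_real_derivative
        exp (- 1 / t) / t ^ (k + 2) - real k * (exp (- 1 / t) / t ^ (k + 1))) (at t)"
      by (simp add: p_def c_def power_add power2_eq_square mult_ac)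
    then have "(exp_recip k has_real_derivative
        exp (- 1 / t) / t ^ (k + 2) - real k * (exp (- 1 / t) / t ^ (k + 1))) (at t)"
      by (rule has_field_derivative_transform_within_open[OF _ open_greaterThan[of 0]])
        (use 3 in \<open>auto simp: exp_recip_def\<close>)
    then show ?thesis
      using 3 by (simp add: exp_recip_def)
  qed
qed

text \<open>An algebra containing a bump function supported in the ball around \<open>p\<close> of squared radius \<open>r\<close>, and closed
  under all directional derivatives.\<close>

inductive_set bump_algebra :: "real ^ 'n \<Rightarrow> real \<Rightarrow> (real ^ ('n::finite) \<Rightarrow> real) set" for p r where
  const: "(\<lambda>x. c) \<in> bump_algebra p r"
| inner: "(\<lambda>x. a \<bullet> x) \<in> bump_algebra p r"
| exp_recip: "(\<lambda>x. exp_recip k (r - (x - p) \<bullet> (x - p))) \<in> bump_algebra p r"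
| add: "f \<in> bump_algebra p r \<Longrightarrow> g \<in> bump_algebra p r \<Longrightarrow> (\<lambda>x. f x + g x) \<in> bump_algebra p r"
| mult: "f \<in> bump_algebra p r \<Longrightarrow> g \<in> bump_algebra p r \<Longrightarrow> (\<lambda>x. f x * g x) \<in> bump_algebra p r"

lemma bump_algebra_derivative:
  "f \<in> bump_algebra p r \<Longrightarrow>
    \<exists>D. (\<forall>x. (f has_derivative (\<lambda>v. D v x)) (at x)) \<and> (\<forall>v. D v \<in> bump_algebra p r)"
proof (induction rule: bump_algebra.induct)
  case (const c)
  show ?case
    by (rule exI[of _ "\<lambda>v x. 0"]) (auto intro: bump_algebra.const)
next
  case (inner a)
  show ?case
    by (rule exI[of _ "\<lambda>v x. a \<bullet> v"]) (auto intro: bump_algebra.const intro!: derivative_eq_intros)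
next
  case (exp_recip k)
  let ?q = "\<lambda>x. r - (x - p) \<bullet> (x - p)"
  \<comment> \<open>The inner derivative, - 2 times the product of \<open>v\<close> with
    \<open>x - p\<close>, is spelled out in the generators so that the closure rules apply to
    \<open>D v\<close> as written.\<close>
  define D where "D v x = (exp_recip (k + 2) (?q x) + (- real k) * exp_recip (k + 1) (?q x))
    * ((- 2 * (v \<bullet> x)) + 2 * (p \<bullet> v))" for v x
  have "((\<lambda>x. exp_recip k (?q x)) has_derivative (\<lambda>v. D v x)) (at x)" for x
  proof -
    have "(?q has_derivative (\<lambda>v. - 2 * (v \<bullet> x) + 2 * (p \<bullet> v))) (at x)"
      by (auto intro!: derivative_eq_intros simp: inner_diff_left inner_diff_right inner_commute algebra_simps)
    from has_derivative_compose[OF this, of "exp_recip k"] exp_recip_deriv[of k "?q x"]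
    show ?thesis
      unfolding has_field_derivative_def D_def by (simp add: mult_commute_abs)
  qed
  moreover have "D v \<in> bump_algebra p r" for v
  proof -
    show ?thesis
      unfolding D_def[abs_def]
      by (intro bump_algebra.mult bump_algebra.add bump_algebra.exp_recip bump_algebra.const
          bump_algebra.inner)
  qed
  ultimately show ?case by blast
next
  case (add f g)
  then obtain D E where "\<And>x. (f has_derivative (\<lambda>v. D v x)) (at x)" "\<And>v. D v \<in> bump_algebra p r"
    "\<And>x. (g has_derivative (\<lambda>v. E v x)) (at x)" "\<And>v. E v \<in> bump_algebra p r" by blast
  then show ?case
    by (intro exI[of _ "\<lambda>v x. D v x + E v x"]) (auto intro: bump_algebra.add has_derivative_add)
next
  case (mult f g)
  then obtain D E where DE: "\<And>x. (f has_derivative (\<lambda>v. D v x)) (at x)" "\<And>v. D v \<in> bump_algebra p r"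
    "\<And>x. (g has_derivative (\<lambda>v. E v x)) (at x)" "\<And>v. E v \<in> bump_algebra p r" by blast
  then have "((\<lambda>x. f x * g x) has_derivative (\<lambda>v. f x * E v x + D v x * g x)) (at x)" for x
    by (intro has_derivative_mult)
  moreover have "(\<lambda>x. f x * E v x + D v x * g x) \<in> bump_algebra p r" for v
    by (intro bump_algebra.add bump_algebra.mult DE mult.hyps)
  ultimately show ?case
    by (intro exI[of _ "\<lambda>v x. f x * E v x + D v x * g x"]) blast
qed

lemma bump_algebra_smooth:
  assumes "f \<in> bump_algebra p r"
  shows "smooth f"
proof -
  have step: "g differentiable (at x) \<and> dir_deriv v g \<in> bump_algebra p r"
    if "g \<in> bump_algebra p r" for g v x
  proof -
    obtain D where D: "\<And>x. (g has_derivative (\<lambda>v. D v x)) (at x)" "\<And>v. D v \<in> bump_algebra p r"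
      using bump_algebra_derivative[OF \<open>g \<in> bump_algebra p r\<close>] by blast
    have "dir_deriv v g = D v"
      using dir_deriv_eq[OF D(1)] by blast
    then show ?thesis
      using D by (auto simp: differentiable_def)
  qed
  have "fold dir_deriv vs f \<in> bump_algebra p r" for vs
    using assms by (induction vs arbitrary: f) (use step in auto)
  then show ?thesis
    unfolding smooth_def using step by blast
qed

text \<open>Testing a constant against such a function recovers the constant, which turns
  convergence of distributions into an equation between numbers. Nonemptiness of
  \<open>\<Omega>\<close> supplies the ball that carries the bump.\<close>

lemma test_function_exists:
  fixes \<Omega> :: "(real ^ ('n::finite)) set"
  assumes "open \<Omega>" "\<Omega> \<noteq> {}"
  shows "\<exists>\<phi>\<in>test_functions \<Omega>. (LINT x|lebesgue_on \<Omega>. \<phi> x) \<noteq> 0"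
proof -
  obtain p where "p \<in> \<Omega>"
    using assms(2) by blast
  then obtain e where e: "e > 0" "cball p e \<subseteq> \<Omega>"
    using assms(1) open_contains_cball by blast
  define \<phi> where "\<phi> x = exp_recip 0 (e\<^sup>2 - (x - p) \<bullet> (x - p))" for x
  have pos: "\<phi> x \<noteq> 0 \<longleftrightarrow> x \<in> ball p e" "0 \<le> \<phi> x" for x
  proof -
    have "(x - p) \<bullet> (x - p) < e\<^sup>2 \<longleftrightarrow> dist p x < e"
      using e(1) by (simp add: dist_norm norm_minus_commute power2_norm_eq_inner[symmetric] abs_le_square_iff
          flip: not_le)
    then show "\<phi> x \<noteq> 0 \<longleftrightarrow> x \<in> ball p e" "0 \<le> \<phi> x"
      by (auto simp: \<phi>_def exp_recip_def)
  qed
  have "\<phi> \<in> bump_algebra p (e\<^sup>2)"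
    unfolding \<phi>_def[abs_def] by (rule bump_algebra.exp_recip)
  moreover have "{x. \<phi> x \<noteq> 0} = ball p e"
    using pos by auto
  ultimately have \<phi>: "\<phi> \<in> test_functions \<Omega>"
    using e bump_algebra_smooth by (auto simp: test_functions_def closure_ball)
  have "(LINT x|lebesgue_on \<Omega>. \<phi> x) = integral\<^sup>L lborel \<phi>"
    using test_function_measurable[OF \<phi>] test_function_zero[OF \<phi>] assms(1)
    by (intro integral_lebesgue_on_eq_lborel) auto
  moreover have "integral\<^sup>L lborel \<phi> \<noteq> 0"
  proof
    assume "integral\<^sup>L lborel \<phi> = 0"
    then have "AE x in lborel. \<phi> x = 0"
      using integral_nonneg_eq_0_iff_AE[OF test_function_integrable[OF \<phi>]] pos by simp
    then have "AE x in lborel. x \<notin> ball p e"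
      by eventually_elim (use pos in auto)
    then have "ball p e \<in> null_sets lebesgue"
      by (subst (asm) AE_iff_null_sets[symmetric]) (auto intro: null_sets_completionI)
    then show False
      using open_not_negligible[of "ball p e"] e(1) by (simp add: negligible_iff_null_sets)
  qed
  ultimately have "(LINT x|lebesgue_on \<Omega>. \<phi> x) \<noteq> 0"
    by metis
  then show ?thesis
    using \<phi> by (rule bexI)
qed

section \<open>Oscillating exterior derivatives\<close>

text \<open>Subtracting \<open>g 0\<close> turns the midpoint equation into Cauchy's functional
  equation, whose continuous solutions are linear.\<close>

lemma midpoint_affine_continuous_imp_affine:
  fixes g :: "real \<Rightarrow> real"
  assumes mid: "\<And>t s. g t = (g (t + s) + g (t - s)) / 2" and cont: "continuous_on UNIV g"
  shows "\<exists>a b. \<forall>t. g t = a + b * t"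
proof -
  define h where "h t = g t - g 0" for t
  have h: "2 * h x = h (x + y) + h (x - y)" for x y
    using mid[of x y] by (simp add: h_def)
  have h0: "h 0 = 0"
    by (simp add: h_def)
  have odd: "h (- x) = - h x" for x
    using h[of 0 x] h0 by simp
  \<comment> \<open>In the sum of the equations centred at \<open>x\<close> and at \<open>y\<close>,
    the terms \<open>h (x - y)\<close> and \<open>h (y - x)\<close> cancel.\<close>
  have add: "h (x + y) = h x + h y" for x y
    using h[of x y] h[of y x] odd[of "x - y"] by (simp add: add.commute)
  have nat: "h (real n * x) = real n * h x" for n x
    by (induction n) (simp_all add: h0 add distrib_right)
  have int: "h (real_of_int j * x) = real_of_int j * h x" for j x
  proof (cases "j \<ge> 0")
    case True
    then show ?thesis using nat[of "nat j" x] by simp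
  next
    case False
    then show ?thesis using nat[of "nat (- j)" x] odd[of "real_of_int j * x"] by simp
  qed
  have lin: "h x = x * h 1" for x
  proof -
    \<comment> \<open>Rational approximations of \<open>x\<close>, at which linearity is already
      available.\<close>
    let ?q = "\<lambda>n. real_of_int \<lfloor>real (Suc n) * x\<rfloor> / real (Suc n)"
    have q: "h (?q n) = ?q n * h 1" for n
    proof -
      have "real (Suc n) * h (?q n) = h (real_of_int \<lfloor>real (Suc n) * x\<rfloor> * 1)"
        using nat[of "Suc n" "?q n"] by simp
      then show ?thesis
        unfolding int by (simp add: field_simps)
    qed
    have lim: "?q \<longlonglongrightarrow> x"
    proof (rule LIMSEQ_I)
      fix r :: real assume "r > 0"
      then obtain N where N: "1 / real (Suc N) < r"
        using reals_Archimedean[of r] by (auto simp: inverse_eq_divide)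
      have "norm (?q n - x) < r" if "n \<ge> N" for n
      proof -
        have "\<bar>real_of_int \<lfloor>real (Suc n) * x\<rfloor> - real (Suc n) * x\<bar> \<le> 1"
          by linarith
        moreover have "?q n - x = (real_of_int \<lfloor>real (Suc n) * x\<rfloor> - real (Suc n) * x) / real (Suc n)"
          by (simp add: diff_divide_distrib del: of_nat_Suc)
        ultimately have "\<bar>?q n - x\<bar> \<le> 1 / real (Suc n)"
          by (simp only: abs_divide abs_of_nat) (intro divide_right_mono, simp_all)
        also have "\<dots> \<le> 1 / real (Suc N)"
          using that by (simp add: frac_le)
        finally show ?thesis using N by simp
      qed
      then show "\<exists>N. \<forall>n\<ge>N. norm (?q n - x) < r" by blast
    qed
    have "isCont h x"
      unfolding h_def using cont by (intro continuous_intros) (simp add: continuous_on_eq_continuous_at)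
    then have "(\<lambda>n. h (?q n)) \<longlonglongrightarrow> h x"
      using lim by (rule isCont_tendsto_compose)
    moreover have "(\<lambda>n. h (?q n)) \<longlonglongrightarrow> x * h 1"
      unfolding q by (intro tendsto_mult lim tendsto_const)
    ultimately show ?thesis
      by (rule LIMSEQ_unique)
  qed
  have "g t = g 0 + h 1 * t" for t
    using lin[of t] by (simp add: h_def algebra_simps)
  then show ?thesis by blast
qed

section \<open>Potentials, their weak exterior derivatives, and weak star limits\<close>

lemma borel_measurable_lebesgue_on:
  fixes u :: "'a::euclidean_space \<Rightarrow> real"
  assumes "u \<in> borel_measurable borel"
  shows "u \<in> borel_measurable (lebesgue_on S)"
  using assms by (intro measurable_restrict_space1 measurable_completion) simp

lemma L_inf_formsI:
  fixes \<omega> :: "real ^ 'n \<Rightarrow> ('n::finite) form"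
  assumes "\<And>x. \<omega> x \<in> alt_forms k" "\<And>vs. (\<lambda>x. \<omega> x vs) \<in> borel_measurable borel"
    and bnd: "\<And>vs. \<exists>B. \<forall>x\<in>\<Omega>. \<bar>\<omega> x vs\<bar> \<le> B" and \<Omega>: "open \<Omega>"
  shows "\<omega> \<in> L_inf_forms \<Omega> k"
proof -
  have "\<exists>B. \<forall>vs. \<forall>x\<in>\<Omega>. \<bar>\<omega> x vs\<bar> \<le> B vs"
    using bnd by (intro choice) blast
  then obtain B where B: "\<And>vs x. x \<in> \<Omega> \<Longrightarrow> \<bar>\<omega> x vs\<bar> \<le> B vs"
    by blast
  have "form_norm k (\<omega> x) \<le> sqrt ((\<Sum>I | length I = k. B (bas I) * B (bas I)) / fact k)" if "x \<in> \<Omega>" for x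
  proof -
    have "\<omega> x vs * \<omega> x vs \<le> B vs * B vs" for vs
      using mult_mono[OF B[OF that, of vs] B[OF that, of vs]] order_trans[OF abs_ge_zero B[OF that, of vs]]
      by (simp add: abs_mult_self_eq)
    then show ?thesis
      unfolding form_norm_def form_inner_def
      by (intro real_sqrt_le_mono divide_right_mono sum_mono) auto
  qed
  then have "AE x in lebesgue_on \<Omega>. form_norm k (\<omega> x)
      \<le> sqrt ((\<Sum>I | length I = k. B (bas I) * B (bas I)) / fact k)"
    by (intro AE_I2) simp
  then show ?thesis
    using assms by (auto simp: L_inf_forms_def intro: borel_measurable_lebesgue_on)
qed

lemma alt_forms_hd_bound:
  fixes \<xi> :: "('n::finite) form"
  assumes "\<xi> \<in> alt_forms k"
  obtains B where "B \<ge> 0" "\<And>x. \<bar>\<xi> (x # ws)\<bar> \<le> B * norm x"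
proof -
  obtain B where "B > 0" "\<And>x. norm (\<xi> (x # ws)) \<le> B * norm x"
    using linear_bounded_pos[OF alt_forms_linear_hd[OF assms]] by blast
  then show ?thesis
    using that[of B] by simp
qed

lemma integrable_bounded_mult:
  fixes u f :: "'a \<Rightarrow> real"
  assumes "integrable M f" "u \<in> borel_measurable M" "\<And>x. x \<in> space M \<Longrightarrow> \<bar>u x\<bar> \<le> B"
  shows "integrable M (\<lambda>x. u x * f x)"
proof (rule Bochner_Integration.integrable_bound)
  show "integrable M (\<lambda>x. B * f x)"
    using assms(1) by simp
  show "AE x in M. norm (u x * f x) \<le> norm (B * f x)"
  proof (intro AE_I2)
    fix x assume "x \<in> space M"
    then have "\<bar>u x\<bar> \<le> \<bar>B\<bar>"
      using assms(3)[of x] by linarith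
    then show "norm (u x * f x) \<le> norm (B * f x)"
      by (simp add: abs_mult mult_right_mono)
  qed
qed (use assms in auto)

text \<open>The exterior derivative of the linear part \<open>\<xi> (x # ws)\<close> collects p + 1
  equal terms \<open>\<xi>\<close>, hence the division by p + 1. The second summand contributes
  d\<tau> \<and> \<beta>.\<close>

definition potential_form :: "('n::finite) form \<Rightarrow> 'n form \<Rightarrow> nat \<Rightarrow> (real ^ 'n \<Rightarrow> real) \<Rightarrow> real ^ 'n \<Rightarrow> 'n form" where
  "potential_form \<xi> \<beta> p \<tau> x = (\<lambda>ws. \<xi> (x # ws) / real (Suc p) + \<tau> x * \<beta> ws)"

text \<open>The exterior derivative of \<open>potential_form\<close> when the gradient of \<tau> is
  \<sigma> times \<open>a\<close>.\<close>

definition field_form :: "('n::finite) form \<Rightarrow> 'n form \<Rightarrow> real ^ 'n \<Rightarrow> (real ^ 'n \<Rightarrow> real) \<Rightarrow> real ^ 'n \<Rightarrow> 'n form" where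
  "field_form \<xi> \<beta> a \<sigma> x = (\<lambda>vs. \<xi> vs + \<sigma> x * ewedge a \<beta> vs)"

context
  fixes \<Omega> :: "(real ^ ('n::finite)) set" and \<xi> \<beta> :: "'n form" and a :: "real ^ 'n" and p :: nat
  assumes \<Omega>: "open \<Omega>" "bounded \<Omega>"
    and \<xi>: "\<xi> \<in> alt_forms (Suc p)" and \<beta>: "\<beta> \<in> alt_forms p"
begin

lemma continuous_alt_forms_hd: "continuous_on UNIV (\<lambda>x. \<xi> (x # ws))"
  by (rule linear_continuous_on[OF linear_conv_bounded_linear[THEN iffD1, OF alt_forms_linear_hd[OF \<xi>]]])

lemma potential_L_inf:
  assumes "\<tau> \<in> borel_measurable borel" "\<And>x. \<bar>\<tau> x\<bar> \<le> T"
  shows "potential_form \<xi> \<beta> p \<tau> \<in> L_inf_forms \<Omega> p"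
proof (rule L_inf_formsI[OF _ _ _ \<Omega>(1)])
  show "potential_form \<xi> \<beta> p \<tau> x \<in> alt_forms p" for x
    unfolding potential_form_def divide_inverse mult.commute[of _ "inverse _"]
    by (intro alt_forms_add alt_forms_scale \<beta> alt_forms_Cons \<xi>)
  show "(\<lambda>x. potential_form \<xi> \<beta> p \<tau> x vs) \<in> borel_measurable borel" for vs
    unfolding potential_form_def using assms(1) borel_measurable_continuous_onI[OF continuous_alt_forms_hd]
    by simp
  show "\<exists>B. \<forall>x\<in>\<Omega>. \<bar>potential_form \<xi> \<beta> p \<tau> x vs\<bar> \<le> B" for vs
  proof -
    obtain B where B: "B \<ge> 0" "\<And>x. \<bar>\<xi> (x # vs)\<bar> \<le> B * norm x"
      using alt_forms_hd_bound[OF \<xi>] by blast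
    obtain R where R: "\<And>x. x \<in> \<Omega> \<Longrightarrow> norm x \<le> R"
      using \<Omega>(2) by (auto simp: bounded_iff)
    have "\<bar>potential_form \<xi> \<beta> p \<tau> x vs\<bar> \<le> B * R / real (Suc p) + T * \<bar>\<beta> vs\<bar>" if "x \<in> \<Omega>" for x
    proof -
      have "\<bar>\<xi> (x # vs)\<bar> \<le> B * R"
        using B(2)[of x] mult_left_mono[OF R[OF that] B(1)] by linarith
      then have "\<bar>\<xi> (x # vs) / real (Suc p)\<bar> \<le> B * R / real (Suc p)"
        by (simp add: abs_divide divide_right_mono)
      moreover have "\<bar>\<tau> x * \<beta> vs\<bar> \<le> T * \<bar>\<beta> vs\<bar>"
        using assms(2) by (simp add: abs_mult mult_right_mono)
      ultimately show ?thesis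
        unfolding potential_form_def by linarith
    qed
    then show ?thesis by blast
  qed
qed

lemma field_L_inf:
  assumes "\<sigma> \<in> borel_measurable borel" "\<And>x. \<bar>\<sigma> x\<bar> \<le> S"
  shows "field_form \<xi> \<beta> a \<sigma> \<in> L_inf_forms \<Omega> (Suc p)"
proof (rule L_inf_formsI[OF _ _ _ \<Omega>(1)])
  show "field_form \<xi> \<beta> a \<sigma> x \<in> alt_forms (Suc p)" for x
    unfolding field_form_def by (intro alt_forms_add alt_forms_scale \<xi> ewedge_alt_forms \<beta>)
  show "(\<lambda>x. field_form \<xi> \<beta> a \<sigma> x vs) \<in> borel_measurable borel" for vs
    unfolding field_form_def using assms(1) by simp
  show "\<exists>B. \<forall>x\<in>\<Omega>. \<bar>field_form \<xi> \<beta> a \<sigma> x vs\<bar> \<le> B" for vs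
  proof (intro exI ballI)
    fix x
    have "\<bar>\<sigma> x * ewedge a \<beta> vs\<bar> \<le> S * \<bar>ewedge a \<beta> vs\<bar>"
      using assms(2) by (simp add: abs_mult mult_right_mono)
    then show "\<bar>field_form \<xi> \<beta> a \<sigma> x vs\<bar> \<le> \<bar>\<xi> vs\<bar> + S * \<bar>ewedge a \<beta> vs\<bar>"
      unfolding field_form_def by linarith
  qed
qed

text \<open>Each component of the potential is Lipschitz and is integrated by parts separately, with
  its almost everywhere derivative \<open>D i\<close>; the signed sum of these is the field.\<close>

lemma field_is_weak_ext_deriv:
  assumes \<tau>: "\<And>x y. \<bar>\<tau> x - \<tau> y\<bar> \<le> L * norm (x - y)"
    and \<sigma>: "\<sigma> \<in> borel_measurable borel" "\<And>x. \<bar>\<sigma> x\<bar> \<le> S"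
    and deriv: "\<And>v. AE x in lborel. ((\<lambda>h. \<tau> (x + h *\<^sub>R v)) has_real_derivative \<sigma> x * (a \<bullet> v)) (at 0)"
  shows "is_weak_ext_deriv \<Omega> (potential_form \<xi> \<beta> p \<tau>) (field_form \<xi> \<beta> a \<sigma>)"
  unfolding is_weak_ext_deriv_def
proof (intro ballI allI)
  fix \<phi> and vs :: "(real ^ 'n) list" assume \<phi>: "\<phi> \<in> test_functions \<Omega>"
  let ?ws = "\<lambda>i. take i vs @ drop (Suc i) vs"
  show "(LINT x|lebesgue_on \<Omega>. field_form \<xi> \<beta> a \<sigma> x vs * \<phi> x) =
     - (\<Sum>i<length vs. (- 1) ^ i *
          (LINT x|lebesgue_on \<Omega>. potential_form \<xi> \<beta> p \<tau> x (?ws i) * dir_deriv (vs ! i) \<phi> x))"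
  proof (cases "length vs = Suc p")
    case False
    have "field_form \<xi> \<beta> a \<sigma> x vs = 0" for x
      using False alt_forms_length[OF \<xi>] alt_forms_length[OF ewedge_alt_forms[OF \<beta>]] by (simp add: field_form_def)
    moreover have "potential_form \<xi> \<beta> p \<tau> x (?ws i) = 0" if "i < length vs" for i x
      using that False alt_forms_length[OF \<xi>] alt_forms_length[OF \<beta>] by (simp add: potential_form_def)
    ultimately show ?thesis by simp
  next
    case True
    define D where "D i x = \<xi> (vs ! i # ?ws i) / real (Suc p) + \<sigma> x * (a \<bullet> vs ! i) * \<beta> (?ws i)" for i x
    have D_meas: "D i \<in> borel_measurable borel" for i
      unfolding D_def[abs_def] using \<sigma>(1) by simp
    have by_parts: "(\<integral>x. potential_form \<xi> \<beta> p \<tau> x (?ws i) * dir_deriv (vs ! i) \<phi> x \<partial>lborel) = - (\<integral>x. D i x * \<phi> x \<partial>lborel)" for i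
    proof -
      note l = alt_forms_linear_hd[OF \<xi>, of "?ws i"]
      obtain B where B: "B \<ge> 0" "\<And>x. \<bar>\<xi> (x # ?ws i)\<bar> \<le> B * norm x"
        using alt_forms_hd_bound[OF \<xi>] by blast
      show ?thesis
      proof (rule weak_derivative_of_lipschitz[OF \<phi> _ D_meas])
        show "\<bar>potential_form \<xi> \<beta> p \<tau> x (?ws i) - potential_form \<xi> \<beta> p \<tau> y (?ws i)\<bar>
            \<le> (B / real (Suc p) + L * \<bar>\<beta> (?ws i)\<bar>) * norm (x - y)" for x y
        proof -
          have "potential_form \<xi> \<beta> p \<tau> x (?ws i) - potential_form \<xi> \<beta> p \<tau> y (?ws i)
              = \<xi> ((x - y) # ?ws i) / real (Suc p) + (\<tau> x - \<tau> y) * \<beta> (?ws i)"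
            by (simp add: potential_form_def linear_diff[OF l] diff_divide_distrib left_diff_distrib)
          moreover have "\<bar>\<xi> ((x - y) # ?ws i) / real (Suc p)\<bar> \<le> B * norm (x - y) / real (Suc p)"
            using B(2)[of "x - y"] by (simp add: abs_divide divide_right_mono)
          moreover have "\<bar>(\<tau> x - \<tau> y) * \<beta> (?ws i)\<bar> \<le> L * norm (x - y) * \<bar>\<beta> (?ws i)\<bar>"
            using \<tau> by (simp add: abs_mult mult_right_mono)
          moreover have "(B / real (Suc p) + L * \<bar>\<beta> (?ws i)\<bar>) * norm (x - y)
              = B * norm (x - y) / real (Suc p) + L * norm (x - y) * \<bar>\<beta> (?ws i)\<bar>"
            by (simp add: algebra_simps)
          ultimately show ?thesis
            by linarith
        qed
        show "AE x in lborel. ((\<lambda>h. potential_form \<xi> \<beta> p \<tau> (x + h *\<^sub>R vs ! i) (?ws i)) has_real_derivative D i x) (at 0)"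
          using deriv[of "vs ! i"]
        proof eventually_elim
          case (elim x)
          have "(\<lambda>h. potential_form \<xi> \<beta> p \<tau> (x + h *\<^sub>R vs ! i) (?ws i))
              = (\<lambda>h. (\<xi> (x # ?ws i) + h * \<xi> (vs ! i # ?ws i)) / real (Suc p) + \<tau> (x + h *\<^sub>R vs ! i) * \<beta> (?ws i))"
            by (simp add: potential_form_def linear_add[OF l] linear_scale[OF l])
          moreover have "((\<lambda>h. (\<xi> (x # ?ws i) + h * \<xi> (vs ! i # ?ws i)) / real (Suc p)) has_real_derivative
              \<xi> (vs ! i # ?ws i) / real (Suc p)) (at 0)"
            by (auto intro!: derivative_eq_intros)
          ultimately show ?case
            unfolding D_def using DERIV_add[OF _ DERIV_cmult_right[OF elim]] by simp
        qed
      qed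
    qed
    have int: "integrable lborel (\<lambda>x. D i x * \<phi> x)" for i
    proof (rule integrable_bounded_mult[OF test_function_integrable[OF \<phi>]])
      show "D i \<in> borel_measurable lborel"
        using D_meas by simp
      show "\<bar>D i x\<bar> \<le> \<bar>\<xi> (vs ! i # ?ws i) / real (Suc p)\<bar> + S * (\<bar>a \<bullet> vs ! i\<bar> * \<bar>\<beta> (?ws i)\<bar>)" for x
      proof -
        have "\<bar>\<sigma> x * (a \<bullet> vs ! i) * \<beta> (?ws i)\<bar> \<le> S * (\<bar>a \<bullet> vs ! i\<bar> * \<bar>\<beta> (?ws i)\<bar>)"
          unfolding abs_mult mult.assoc using \<sigma>(2) by (intro mult_right_mono) auto
        then show ?thesis
          unfolding D_def by linarith
      qed
    qed
    \<comment> \<open>In the part with \<open>\<xi>\<close> all terms agree after moving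
      \<open>vs ! i\<close> to the front, and their number cancels p + 1. The part with
      \<open>\<sigma>\<close> is the expansion of \<open>ewedge\<close>.\<close>
    have sum_D: "(\<Sum>i<length vs. (- 1) ^ i * D i x) = field_form \<xi> \<beta> a \<sigma> x vs" for x
    proof -
      have "(\<Sum>i<length vs. (- 1) ^ i * (\<xi> (vs ! i # ?ws i) / real (Suc p))) = (\<Sum>i<length vs. \<xi> vs / real (Suc p))"
        using alt_forms_nth_to_front[OF \<xi>, of _ vs] by (intro sum.cong) simp_all
      also have "\<dots> = \<xi> vs"
        using True by simp
      finally show ?thesis
        by (simp add: D_def field_form_def ewedge_expand distrib_left sum.distrib sum_distrib_left mult_ac)
    qed
    have on: "(LINT x|lebesgue_on \<Omega>. u x * w x) = (\<integral>x. u x * w x \<partial>lborel)"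
      if "u \<in> borel_measurable borel" "w \<in> borel_measurable borel" "\<And>x. x \<notin> \<Omega> \<Longrightarrow> w x = 0"
      for u w :: "real ^ 'n \<Rightarrow> real"
      using that \<Omega>(1) by (intro integral_lebesgue_on_eq_lborel) auto
    have "\<tau> \<in> borel_measurable borel"
    proof (rule borel_measurable_continuous_onI)
      \<comment> \<open>\<open>lipschitz_on\<close> asks for a nonnegative constant, and this one
        visibly is.\<close>
      have "(\<bar>L\<bar> + 1)-lipschitz_on UNIV \<tau>"
      proof (rule lipschitz_onI)
        show "dist (\<tau> x) (\<tau> y) \<le> (\<bar>L\<bar> + 1) * dist x y" for x y
        proof -
          have "L * norm (x - y) \<le> (\<bar>L\<bar> + 1) * norm (x - y)"
            by (rule mult_right_mono) simp_all
          then show ?thesis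
            using \<tau>[of x y] by (simp add: dist_norm)
        qed
      qed simp
      then show "continuous_on UNIV \<tau>"
        by (rule lipschitz_on_continuous_on)
    qed
    then have pot: "(\<lambda>x. potential_form \<xi> \<beta> p \<tau> x ws) \<in> borel_measurable borel" for ws
      unfolding potential_form_def using borel_measurable_continuous_onI[OF continuous_alt_forms_hd] by simp
    have "(LINT x|lebesgue_on \<Omega>. field_form \<xi> \<beta> a \<sigma> x vs * \<phi> x) = (\<integral>x. field_form \<xi> \<beta> a \<sigma> x vs * \<phi> x \<partial>lborel)"
      using \<sigma>(1) by (intro on test_function_measurable[OF \<phi>] test_function_zero[OF \<phi>]) (simp add: field_form_def)
    also have "\<dots> = (\<integral>x. (\<Sum>i<length vs. (- 1) ^ i * (D i x * \<phi> x)) \<partial>lborel)"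
      by (simp add: sum_distrib_right mult.assoc flip: sum_D)
    also have "\<dots> = (\<Sum>i<length vs. (- 1) ^ i * (\<integral>x. D i x * \<phi> x \<partial>lborel))"
      using int by (subst Bochner_Integration.integral_sum) auto
    also have "\<dots> = - (\<Sum>i<length vs. (- 1) ^ i *
        (\<integral>x. potential_form \<xi> \<beta> p \<tau> x (?ws i) * dir_deriv (vs ! i) \<phi> x \<partial>lborel))"
      by (simp add: by_parts sum_negf)
    also have "\<dots> = - (\<Sum>i<length vs. (- 1) ^ i *
        (LINT x|lebesgue_on \<Omega>. potential_form \<xi> \<beta> p \<tau> x (?ws i) * dir_deriv (vs ! i) \<phi> x))"
      using test_function_measurable[OF \<phi>] test_function_zero[OF \<phi>] pot by (simp add: on)
    finally show ?thesis .
  qed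
qed

lemma form_inner_add_left: "form_inner q (\<lambda>vs. \<omega> vs + c * \<eta> vs) \<psi> = form_inner q \<omega> \<psi> + c * form_inner q \<eta> \<psi>"
  by (simp add: form_inner_def sum.distrib sum_distrib_left algebra_simps add_divide_distrib)

lemma integrable_form_inner:
  assumes "\<psi> \<in> L_1_forms \<Omega> q" "\<And>vs. (\<lambda>x. \<omega> x vs) \<in> borel_measurable borel"
    and "\<And>vs. \<exists>B. \<forall>x\<in>\<Omega>. \<bar>\<omega> x vs\<bar> \<le> B"
  shows "integrable (lebesgue_on \<Omega>) (\<lambda>x. form_inner q (\<omega> x) (\<psi> x))"
proof -
  have "integrable (lebesgue_on \<Omega>) (\<lambda>x. \<omega> x vs * \<psi> x vs)" for vs
  proof -
    obtain B where "\<And>x. x \<in> \<Omega> \<Longrightarrow> \<bar>\<omega> x vs\<bar> \<le> B"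
      using assms(3) by blast
    then show ?thesis
      using assms(1,2) by (intro integrable_bounded_mult[where B = B])
        (auto simp: L_1_forms_def intro: borel_measurable_lebesgue_on)
  qed
  then show ?thesis
    unfolding form_inner_def by simp
qed

text \<open>The perturbation of the potential is uniformly small, at the rate \<open>T\<close>, so
  boundedness of the pairing with an integrable form suffices.\<close>

lemma potential_weak_star_converges:
  assumes "\<And>\<nu>. \<tau> \<nu> \<in> borel_measurable borel" "\<And>\<nu> x. \<bar>\<tau> \<nu> x\<bar> \<le> T \<nu>" "T \<longlonglongrightarrow> 0"
  shows "weak_star_converges \<Omega> p (\<lambda>\<nu>. potential_form \<xi> \<beta> p (\<tau> \<nu>)) (potential_form \<xi> \<beta> p (\<lambda>x. 0))"
  unfolding weak_star_converges_def
proof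
  fix \<psi> assume \<psi>: "\<psi> \<in> L_1_forms \<Omega> p"
  let ?F = "\<lambda>x. form_inner p (potential_form \<xi> \<beta> p (\<lambda>x. 0) x) (\<psi> x)" and ?G = "\<lambda>x. form_inner p \<beta> (\<psi> x)"
  have "potential_form \<xi> \<beta> p (\<tau> \<nu>) x = (\<lambda>ws. potential_form \<xi> \<beta> p (\<lambda>x. 0) x ws + \<tau> \<nu> x * \<beta> ws)" for \<nu> x
    by (simp add: potential_form_def)
  then have split: "form_inner p (potential_form \<xi> \<beta> p (\<tau> \<nu>) x) (\<psi> x) = ?F x + \<tau> \<nu> x * ?G x" for \<nu> x
    by (simp only: form_inner_add_left)
  have F: "integrable (lebesgue_on \<Omega>) ?F"
  proof (rule integrable_form_inner[OF \<psi>])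
    show "(\<lambda>x. potential_form \<xi> \<beta> p (\<lambda>x. 0) x vs) \<in> borel_measurable borel" for vs
      unfolding potential_form_def using borel_measurable_continuous_onI[OF continuous_alt_forms_hd] by simp
    show "\<exists>B. \<forall>x\<in>\<Omega>. \<bar>potential_form \<xi> \<beta> p (\<lambda>x. 0) x vs\<bar> \<le> B" for vs
    proof -
      have "compact (closure \<Omega>)"
        using \<Omega>(2) by simp
      then have "bounded ((\<lambda>x. \<xi> (x # vs) / real (Suc p)) ` closure \<Omega>)"
        by (intro compact_imp_bounded compact_continuous_image continuous_on_divide continuous_on_const
            continuous_on_subset[OF continuous_alt_forms_hd]) auto
      then show ?thesis
        using closure_subset[of \<Omega>] by (fastforce simp: bounded_iff potential_form_def)
    qed
  qed
  have G: "integrable (lebesgue_on \<Omega>) ?G"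
    by (rule integrable_form_inner[OF \<psi>]) auto
  have \<tau>G: "integrable (lebesgue_on \<Omega>) (\<lambda>x. \<tau> \<nu> x * ?G x)" for \<nu>
    using assms by (intro integrable_bounded_mult[OF G, where B = "T \<nu>"] borel_measurable_lebesgue_on)
  have le: "\<bar>LINT x|lebesgue_on \<Omega>. \<tau> \<nu> x * ?G x\<bar> \<le> T \<nu> * (LINT x|lebesgue_on \<Omega>. \<bar>?G x\<bar>)" for \<nu>
  proof -
    have "\<bar>LINT x|lebesgue_on \<Omega>. \<tau> \<nu> x * ?G x\<bar> \<le> (LINT x|lebesgue_on \<Omega>. \<bar>\<tau> \<nu> x * ?G x\<bar>)"
      by (rule integral_abs_bound)
    also have "\<dots> \<le> (LINT x|lebesgue_on \<Omega>. T \<nu> * \<bar>?G x\<bar>)"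
      using assms(2) by (intro integral_mono integrable_abs \<tau>G integrable_mult_right G)
        (auto simp: abs_mult intro: mult_right_mono)
    finally show ?thesis by simp
  qed
  have "(\<lambda>\<nu>. T \<nu> * (LINT x|lebesgue_on \<Omega>. \<bar>?G x\<bar>)) \<longlonglongrightarrow> 0"
    by (rule tendsto_mult_left_zero[OF assms(3)])
  then have "(\<lambda>\<nu>. LINT x|lebesgue_on \<Omega>. \<tau> \<nu> x * ?G x) \<longlonglongrightarrow> 0"
    by (rule Lim_null_comparison[rotated]) (use le in \<open>auto intro!: always_eventually\<close>)
  then have "(\<lambda>\<nu>. (LINT x|lebesgue_on \<Omega>. ?F x) + (LINT x|lebesgue_on \<Omega>. \<tau> \<nu> x * ?G x))
      \<longlonglongrightarrow> (LINT x|lebesgue_on \<Omega>. ?F x) + 0"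
    by (intro tendsto_add tendsto_const)
  then show "(\<lambda>\<nu>. LINT x|lebesgue_on \<Omega>. form_inner p (potential_form \<xi> \<beta> p (\<tau> \<nu>) x) (\<psi> x))
      \<longlonglongrightarrow> (LINT x|lebesgue_on \<Omega>. ?F x)"
    unfolding split using F \<tau>G by simp
qed

text \<open>Unlike the potential, the field need not become small; its convergence rests on
  cancellation against integrable functions, which is the assumption \<open>null\<close>.\<close>

lemma field_weak_star_converges:
  assumes null: "\<And>G. integrable (lebesgue_on \<Omega>) G \<Longrightarrow> (\<lambda>\<nu>. LINT x|lebesgue_on \<Omega>. \<sigma> \<nu> x * G x) \<longlonglongrightarrow> 0"
    and \<sigma>: "\<And>\<nu>. \<sigma> \<nu> \<in> borel_measurable borel" "\<And>\<nu> x. \<bar>\<sigma> \<nu> x\<bar> \<le> S"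
  shows "weak_star_converges \<Omega> (Suc p) (\<lambda>\<nu>. field_form \<xi> \<beta> a (\<sigma> \<nu>)) (field_form \<xi> \<beta> a (\<lambda>x. 0))"
  unfolding weak_star_converges_def
proof
  fix \<psi> assume \<psi>: "\<psi> \<in> L_1_forms \<Omega> (Suc p)"
  let ?F = "\<lambda>x. form_inner (Suc p) \<xi> (\<psi> x)" and ?G = "\<lambda>x. form_inner (Suc p) (ewedge a \<beta>) (\<psi> x)"
  have F: "integrable (lebesgue_on \<Omega>) ?F" and G: "integrable (lebesgue_on \<Omega>) ?G"
    by (rule integrable_form_inner[OF \<psi>]; auto)+
  have "integrable (lebesgue_on \<Omega>) (\<lambda>x. \<sigma> \<nu> x * ?G x)" for \<nu>
    using \<sigma> by (intro integrable_bounded_mult[OF G, where B = S] borel_measurable_lebesgue_on)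
  moreover have "(\<lambda>\<nu>. (LINT x|lebesgue_on \<Omega>. ?F x) + (LINT x|lebesgue_on \<Omega>. \<sigma> \<nu> x * ?G x))
      \<longlonglongrightarrow> (LINT x|lebesgue_on \<Omega>. ?F x) + 0"
    by (intro tendsto_add tendsto_const null G)
  ultimately show "(\<lambda>\<nu>. LINT x|lebesgue_on \<Omega>. form_inner (Suc p) (field_form \<xi> \<beta> a (\<sigma> \<nu>) x) (\<psi> x))
      \<longlonglongrightarrow> (LINT x|lebesgue_on \<Omega>. form_inner (Suc p) (field_form \<xi> \<beta> a (\<lambda>x. 0) x) (\<psi> x))"
    using F unfolding field_form_def form_inner_add_left by simp
qed

end

section \<open>The mean value identity from weak continuity, and affinity\<close>

lemma square_wave_weakly_null_on:
  fixes a :: "'a::euclidean_space"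
  assumes "a \<noteq> 0" "open \<Omega>" "integrable (lebesgue_on \<Omega>) G"
  shows "(\<lambda>\<nu>. LINT x|lebesgue_on \<Omega>. square_wave (real (Suc \<nu>) * (a \<bullet> x)) * G x) \<longlonglongrightarrow> 0"
proof -
  have \<Omega>: "\<Omega> \<inter> space lebesgue \<in> sets lebesgue"
    using assms(2) by auto
  have "integrable lebesgue (\<lambda>x. indicator \<Omega> x *\<^sub>R G x)"
    using assms(3) integrable_restrict_space[OF \<Omega>, of G] by simp
  from square_wave_weakly_null[OF assms(1) this] show ?thesis
    by (simp add: integral_restrict_space[OF \<Omega>] mult_ac)
qed

text \<open>Amplitude \<open>s / real (Suc \<nu>)\<close> and frequency
  \<open>real (Suc \<nu>)\<close> cancel, so the derivative keeps its size as the wave shrinks. The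
  kinks lie on a null set of hyperplanes.\<close>

lemma triangle_wave_along_deriv:
  fixes a :: "'a::euclidean_space"
  assumes "a \<noteq> 0"
  shows "AE x in lborel. ((\<lambda>h. s / real (Suc \<nu>) * triangle_wave (real (Suc \<nu>) * (a \<bullet> (x + h *\<^sub>R v))))
    has_real_derivative s * square_wave (real (Suc \<nu>) * (a \<bullet> x)) * (a \<bullet> v)) (at 0)"
proof -
  let ?N = "real (Suc \<nu>)"
  have "AE x in lborel. (?N *\<^sub>R a) \<bullet> x \<notin> \<int>"
    using assms by (intro AE_inner_notin_Ints) (simp del: of_nat_Suc)
  then show ?thesis
  proof eventually_elim
    case (elim x)
    then have "(triangle_wave has_real_derivative square_wave (?N * (a \<bullet> x))) (at (?N * (a \<bullet> (x + 0 *\<^sub>R v))))"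
      using triangle_wave_deriv by simp
    moreover have "((\<lambda>h. ?N * (a \<bullet> (x + h *\<^sub>R v))) has_real_derivative ?N * (a \<bullet> v)) (at 0)"
      by (auto intro!: derivative_eq_intros simp: inner_add_right)
    ultimately have "((\<lambda>h. triangle_wave (?N * (a \<bullet> (x + h *\<^sub>R v)))) has_real_derivative
        square_wave (?N * (a \<bullet> x)) * (?N * (a \<bullet> v))) (at 0)"
      by (rule DERIV_chain2)
    from DERIV_cmult[OF this, of "s / ?N"] show ?case
      by (simp add: mult_ac del: of_nat_Suc)
  qed
qed

lemma weakly_continuous_mean:
  fixes \<Omega> :: "(real ^ ('n::finite)) set" and f :: "(nat \<Rightarrow> 'n form) \<Rightarrow> real"
  assumes k: "\<And>i. i \<in> {1..m} \<Longrightarrow> 1 \<le> k i"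
    and \<Omega>: "open \<Omega>" "bounded \<Omega>" "\<Omega> \<noteq> {}"
    and f: "weakly_continuous_W_d_inf m k \<Omega> f"
    and \<xi>: "\<And>i. i \<in> {1..m} \<Longrightarrow> \<xi> i \<in> alt_forms (k i)"
    and \<beta>: "\<And>i. i \<in> {1..m} \<Longrightarrow> \<beta> i \<in> alt_forms (k i - 1)" and a: "a \<noteq> 0"
  shows "f (restrict \<xi> {1..m}) = (f (\<lambda>i\<in>{1..m}. \<lambda>vs. \<xi> i vs + s * ewedge a (\<beta> i) vs)
    + f (\<lambda>i\<in>{1..m}. \<lambda>vs. \<xi> i vs + (- s) * ewedge a (\<beta> i) vs)) / 2"
proof -
  let ?F = "\<lambda>t. f (\<lambda>i\<in>{1..m}. \<lambda>vs. \<xi> i vs + t * ewedge a (\<beta> i) vs)"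
  \<comment> \<open>One scalar wave drives all slots simultaneously, which is why the directions a
    \<and> \<beta> share the covector \<open>a\<close>.\<close>
  define q where "q \<nu> x = square_wave (real (Suc \<nu>) * (a \<bullet> x))" for \<nu> x
  define \<tau> where "\<tau> \<nu> x = s / real (Suc \<nu>) * triangle_wave (real (Suc \<nu>) * (a \<bullet> x))" for \<nu> x
  define \<sigma> where "\<sigma> \<nu> x = s * q \<nu> x" for \<nu> x
  have q_meas: "q \<nu> \<in> borel_measurable borel" for \<nu>
    unfolding q_def[abs_def] by measurable
  have q_null: "(\<lambda>\<nu>. LINT x|lebesgue_on \<Omega>. q \<nu> x * G x) \<longlonglongrightarrow> 0" if "integrable (lebesgue_on \<Omega>) G" for G
    unfolding q_def by (rule square_wave_weakly_null_on[OF a \<Omega>(1) that])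
  have \<sigma>_meas: "\<sigma> \<nu> \<in> borel_measurable borel" for \<nu>
    unfolding \<sigma>_def[abs_def] using q_meas by simp
  have \<sigma>_bound: "\<bar>\<sigma> \<nu> x\<bar> \<le> \<bar>s\<bar>" for \<nu> x
    by (simp add: \<sigma>_def q_def abs_mult abs_square_wave)
  have \<sigma>_null: "(\<lambda>\<nu>. LINT x|lebesgue_on \<Omega>. \<sigma> \<nu> x * G x) \<longlonglongrightarrow> 0" if "integrable (lebesgue_on \<Omega>) G" for G
    using tendsto_mult_right_zero[OF q_null[OF that], of s] by (simp add: \<sigma>_def mult.assoc)
  have \<tau>_lip: "\<bar>\<tau> \<nu> x - \<tau> \<nu> y\<bar> \<le> (\<bar>s\<bar> * norm a) * norm (x - y)" for \<nu> x y
  proof -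
    let ?N = "real (Suc \<nu>)"
    have "\<tau> \<nu> x - \<tau> \<nu> y = s / ?N * (triangle_wave (?N * (a \<bullet> x)) - triangle_wave (?N * (a \<bullet> y)))"
      by (simp only: \<tau>_def right_diff_distrib)
    then have "\<bar>\<tau> \<nu> x - \<tau> \<nu> y\<bar> = \<bar>s\<bar> / ?N * \<bar>triangle_wave (?N * (a \<bullet> x)) - triangle_wave (?N * (a \<bullet> y))\<bar>"
      by (simp only: abs_mult abs_divide abs_of_nat)
    also have "\<dots> \<le> \<bar>s\<bar> / ?N * \<bar>?N * (a \<bullet> x) - ?N * (a \<bullet> y)\<bar>"
      by (intro mult_left_mono triangle_wave_lipschitz) simp
    also have "\<dots> = \<bar>s\<bar> * \<bar>a \<bullet> (x - y)\<bar>"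
      by (simp add: inner_diff_right abs_mult flip: right_diff_distrib del: of_nat_Suc)
    also have "\<dots> \<le> \<bar>s\<bar> * (norm a * norm (x - y))"
      by (intro mult_left_mono Cauchy_Schwarz_ineq2) simp
    finally show ?thesis by (simp add: mult.assoc)
  qed
  have \<tau>_meas: "\<tau> \<nu> \<in> borel_measurable borel" for \<nu>
  proof -
    have "triangle_wave \<in> borel_measurable borel"
      unfolding triangle_wave_def[abs_def] by measurable
    then show ?thesis
      unfolding \<tau>_def[abs_def] by measurable
  qed
  have \<tau>_bound: "\<bar>\<tau> \<nu> x\<bar> \<le> \<bar>s\<bar> / real (Suc \<nu>)" for \<nu> x
    using triangle_wave_bounds[of "real (Suc \<nu>) * (a \<bullet> x)"]
    by (simp add: \<tau>_def abs_mult divide_right_mono mult_left_le)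
  have \<tau>_null: "(\<lambda>\<nu>. \<bar>s\<bar> / real (Suc \<nu>)) \<longlonglongrightarrow> 0"
    by (rule LIMSEQ_Suc[OF lim_const_over_n])
  have \<tau>_deriv: "AE x in lborel. ((\<lambda>h. \<tau> \<nu> (x + h *\<^sub>R v)) has_real_derivative \<sigma> \<nu> x * (a \<bullet> v)) (at 0)" for \<nu> v
    using triangle_wave_along_deriv[OF a, of s \<nu> v] by (simp add: \<tau>_def \<sigma>_def q_def)

  \<comment> \<open>The truncated subtraction is exact because \<open>1 \<le> k i\<close>, so
    \<open>k i = Suc (p i)\<close>.\<close>
  define p where "p i = k i - 1" for i
  define W where "W \<tau> i = potential_form (\<xi> i) (\<beta> i) (p i) \<tau>" for \<tau> i
  define E where "E \<sigma> i = field_form (\<xi> i) (\<beta> i) a \<sigma>" for \<sigma> i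
  have forms: "\<xi> i \<in> alt_forms (Suc (p i))" "\<beta> i \<in> alt_forms (p i)" "k i = Suc (p i)" "k i - 1 = p i"
    if "i \<in> {1..m}" for i
    using \<xi>[OF that] \<beta>[OF that] k[OF that] by (simp_all add: p_def)
  note facts = potential_L_inf[OF \<Omega>(1,2) forms(1,2)] field_L_inf[OF \<Omega>(1,2) forms(1,2)]
    field_is_weak_ext_deriv[OF \<Omega>(1,2) forms(1,2)]
  have W: "W (\<tau> \<nu>) i \<in> L_inf_forms \<Omega> (p i)" "W (\<lambda>x. 0) i \<in> L_inf_forms \<Omega> (p i)"
    and E: "E (\<sigma> \<nu>) i \<in> L_inf_forms \<Omega> (Suc (p i))" "E (\<lambda>x. 0) i \<in> L_inf_forms \<Omega> (Suc (p i))"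
    and d: "is_weak_ext_deriv \<Omega> (W (\<tau> \<nu>) i) (E (\<sigma> \<nu>) i)"
      "is_weak_ext_deriv \<Omega> (W (\<lambda>x. 0) i) (E (\<lambda>x. 0) i)"
    if "i \<in> {1..m}" for i \<nu>
    unfolding W_def E_def
    using facts(1)[OF that that \<tau>_meas \<tau>_bound] facts(1)[OF that that, of "\<lambda>x. 0" 0]
      facts(2)[OF that that \<sigma>_meas \<sigma>_bound] facts(2)[OF that that, of "\<lambda>x. 0" 0]
      facts(3)[OF that that \<tau>_lip \<sigma>_meas \<sigma>_bound \<tau>_deriv]
      facts(3)[OF that that, of "\<lambda>x. 0" 0 "\<lambda>x. 0" 0]
    by simp_all
  have conv: "weak_star_converges \<Omega> (p i) (\<lambda>\<nu>. W (\<tau> \<nu>) i) (W (\<lambda>x. 0) i)"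
    "weak_star_converges \<Omega> (Suc (p i)) (\<lambda>\<nu>. E (\<sigma> \<nu>) i) (E (\<lambda>x. 0) i)" if "i \<in> {1..m}" for i
    unfolding W_def E_def
    using potential_weak_star_converges[OF \<Omega>(1,2) forms(1,2)[OF that] \<tau>_meas \<tau>_bound \<tau>_null]
      field_weak_star_converges[OF \<Omega>(1,2) forms(1,2)[OF that] \<sigma>_null \<sigma>_meas \<sigma>_bound]
    by simp_all
  have mem: "W (\<tau> \<nu>) i \<in> W_d_inf \<Omega> (p i)" "W (\<lambda>x. 0) i \<in> W_d_inf \<Omega> (p i)" if "i \<in> {1..m}" for i \<nu>
    using W E d that unfolding W_d_inf_def by blast+
  have "distr_converges \<Omega> (\<lambda>\<nu> x. f (\<lambda>i\<in>{1..m}. E (\<sigma> \<nu>) i x)) (\<lambda>x. f (\<lambda>i\<in>{1..m}. E (\<lambda>x. 0) i x))"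
    using f[unfolded weakly_continuous_W_d_inf_def, THEN conjunct2, rule_format,
        of "\<lambda>\<nu> i. W (\<tau> \<nu>) i" "\<lambda>\<nu> i. E (\<sigma> \<nu>) i" "\<lambda>i. W (\<lambda>x. 0) i" "\<lambda>i. E (\<lambda>x. 0) i"]
      mem E d conv forms(3,4) by simp
  moreover obtain \<phi> where \<phi>: "\<phi> \<in> test_functions \<Omega>" "(LINT x|lebesgue_on \<Omega>. \<phi> x) \<noteq> 0"
    using test_function_exists[OF \<Omega>(1,3)] by blast
  ultimately have lim: "(\<lambda>\<nu>. LINT x|lebesgue_on \<Omega>. f (\<lambda>i\<in>{1..m}. E (\<sigma> \<nu>) i x) * \<phi> x)
      \<longlonglongrightarrow> (LINT x|lebesgue_on \<Omega>. f (\<lambda>i\<in>{1..m}. E (\<lambda>x. 0) i x) * \<phi> x)"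
    unfolding distr_converges_def by blast
  let ?M = "(?F s + ?F (- s)) / 2" and ?D = "(?F s - ?F (- s)) / 2"
  have E0: "(\<lambda>i\<in>{1..m}. E (\<lambda>x. 0) i x) = restrict \<xi> {1..m}" for x
    by (simp add: E_def field_form_def fun_eq_iff restrict_def)
  \<comment> \<open>Any function of a variable with values 1 and - 1 is affine in it. Hence
    \<open>f\<close> along the sequence is the mean \<open>?M\<close> plus a multiple of the square
    wave, and the latter disappears in the limit.\<close>
  have E\<nu>: "f (\<lambda>i\<in>{1..m}. E (\<sigma> \<nu>) i x) = ?M + q \<nu> x * ?D" for \<nu> x
  proof -
    have "(\<lambda>i\<in>{1..m}. E (\<sigma> \<nu>) i x) = (\<lambda>i\<in>{1..m}. \<lambda>vs. \<xi> i vs + (s * q \<nu> x) * ewedge a (\<beta> i) vs)"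
      by (simp add: E_def field_form_def \<sigma>_def)
    moreover have "q \<nu> x = 1 \<or> q \<nu> x = - 1"
      by (simp add: q_def square_wave_def)
    ultimately show ?thesis
      by (auto simp: field_simps)
  qed
  have "integrable lebesgue (\<lambda>x. indicator \<Omega> x *\<^sub>R \<phi> x)"
  proof -
    have "(\<lambda>x. indicator \<Omega> x *\<^sub>R \<phi> x) = \<phi>"
      using test_function_zero(1)[OF \<phi>(1)] by (auto simp: indicator_def fun_eq_iff)
    then show ?thesis
      using test_function_integrable[OF \<phi>(1)] test_function_measurable(1)[OF \<phi>(1)]
      by (simp add: integrable_completion)
  qed
  then have \<phi>_int: "integrable (lebesgue_on \<Omega>) \<phi>"
    using \<Omega>(1) by (subst integrable_restrict_space) auto
  have q\<phi>: "integrable (lebesgue_on \<Omega>) (\<lambda>x. q \<nu> x * \<phi> x)" for \<nu>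
    by (intro integrable_bounded_mult[OF \<phi>_int, where B = 1] borel_measurable_lebesgue_on q_meas)
      (simp add: q_def abs_square_wave del: of_nat_Suc)
  have "(LINT x|lebesgue_on \<Omega>. f (\<lambda>i\<in>{1..m}. E (\<sigma> \<nu>) i x) * \<phi> x)
      = ?M * (LINT x|lebesgue_on \<Omega>. \<phi> x) + ?D * (LINT x|lebesgue_on \<Omega>. q \<nu> x * \<phi> x)" for \<nu>
  proof -
    have "(LINT x|lebesgue_on \<Omega>. f (\<lambda>i\<in>{1..m}. E (\<sigma> \<nu>) i x) * \<phi> x)
        = (LINT x|lebesgue_on \<Omega>. ?M * \<phi> x + ?D * (q \<nu> x * \<phi> x))"
      unfolding E\<nu> by (intro Bochner_Integration.integral_cong refl) (simp only: distrib_left distrib_right mult_ac)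
    also have "\<dots> = (LINT x|lebesgue_on \<Omega>. ?M * \<phi> x) + (LINT x|lebesgue_on \<Omega>. ?D * (q \<nu> x * \<phi> x))"
      by (intro Bochner_Integration.integral_add integrable_mult_right \<phi>_int q\<phi>)
    finally show ?thesis
      by (simp only: integral_mult_right_zero)
  qed
  then have "(\<lambda>\<nu>. LINT x|lebesgue_on \<Omega>. f (\<lambda>i\<in>{1..m}. E (\<sigma> \<nu>) i x) * \<phi> x)
      \<longlonglongrightarrow> ?M * (LINT x|lebesgue_on \<Omega>. \<phi> x) + ?D * 0"
    by (simp only:) (intro tendsto_intros q_null \<phi>_int)
  from LIMSEQ_unique[OF this lim]
  have "?M * (LINT x|lebesgue_on \<Omega>. \<phi> x) = f (restrict \<xi> {1..m}) * (LINT x|lebesgue_on \<Omega>. \<phi> x)"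
    unfolding E0 by (simp only: integral_mult_right_zero mult_zero_right add_0_right)
  then show ?thesis
    using \<phi>(2) by simp
qed

lemma weakly_continuous_imp_ext_one_affine:
  fixes \<Omega> :: "(real ^ ('n::finite)) set" and f :: "(nat \<Rightarrow> 'n form) \<Rightarrow> real"
  assumes k: "\<And>i. i \<in> {1..m} \<Longrightarrow> 1 \<le> k i"
    and \<Omega>: "open \<Omega>" "bounded \<Omega>" "\<Omega> \<noteq> {}"
    and f: "weakly_continuous_W_d_inf m k \<Omega> f"
  shows "vectorially_ext_one_affine m k f"
  unfolding vectorially_ext_one_affine_def
proof (intro ballI)
  fix \<xi> \<beta> :: "nat \<Rightarrow> 'n form" and \<alpha> :: "'n form"
  assume \<xi>: "\<xi> \<in> form_prod m k" and \<alpha>: "\<alpha> \<in> alt_forms 1" and \<beta>: "\<beta> \<in> form_prod m (\<lambda>i. k i - 1)"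
  define a :: "real ^ 'n" where "a = (\<chi> x. \<alpha> [axis x 1])"
  have \<xi>i: "\<xi> i \<in> alt_forms (k i)" and \<beta>i: "\<beta> i \<in> alt_forms (k i - 1)" if "i \<in> {1..m}" for i
    using \<xi> \<beta> that by (auto simp: form_prod_def)
  define z where "z t = (\<lambda>i\<in>{1..m}. \<lambda>vs. \<xi> i vs + t * ewedge a (\<beta> i) vs)" for t
  have "(\<lambda>i\<in>{1..m}. \<lambda>vs. \<xi> i vs + t * (\<alpha> \<and>\<^sub>f \<beta> i) vs) = z t" for t
    unfolding z_def by (rule restrict_ext) (simp add: a_def wedge_one_form[OF \<alpha> \<beta>i])
  moreover have "\<exists>A B. \<forall>t. f (z t) = A + B * t"
  \<comment> \<open>For \<open>a = 0\<close> there is no direction to oscillate in, but the line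
    degenerates to a point.\<close>
  proof (cases "a = 0")
    case True
    then have zt: "z t = z 0" for t
      by (simp add: z_def ewedge_expand restrict_def)
    have "f (z t) = f (z 0) + 0 * t" for t
      by (subst zt) simp
    then show ?thesis
      by blast
  next
    case False
    have ew: "ewedge a (\<beta> i) \<in> alt_forms (k i)" if "i \<in> {1..m}" for i
      using ewedge_alt_forms[OF \<beta>i[OF that], of a] k[OF that] by simp
    have z: "z t \<in> form_prod m k" for t
      unfolding z_def form_prod_def by (auto intro!: alt_forms_add alt_forms_scale \<xi>i ew)
    \<comment> \<open>The mean value identity is applied with every point \<open>z t\<close> of the
      line as centre, and \<open>\<beta>\<close> kept.\<close>
    have "f (z t) = (f (z (t + s)) + f (z (t - s))) / 2" for t s
    proof -
      have "z t i \<in> alt_forms (k i)" if "i \<in> {1..m}" for i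
        using PiE_mem[OF z[of t, unfolded form_prod_def] that] .
      note mean = weakly_continuous_mean[of m k \<Omega> f "z t" \<beta> a s, OF k \<Omega> f this \<beta>i False]
      have "restrict (z t) {1..m} = z t"
        by (simp add: z_def)
      moreover have "(\<lambda>i\<in>{1..m}. \<lambda>vs. z t i vs + c * ewedge a (\<beta> i) vs) = z (t + c)" for c
        unfolding z_def by (rule restrict_ext) (simp add: algebra_simps)
      ultimately show ?thesis
        using mean by (simp only: diff_conv_add_uminus)
    qed
    moreover have "continuous_on UNIV (\<lambda>t. f (z t))"
    proof (rule continuous_on_compose2[where g = f and f = z])
      show "continuous_on (form_prod m k) f"
        using f by (simp add: weakly_continuous_W_d_inf_def)
      \<comment> \<open>The topology is that of pointwise convergence, so continuity is checked for
        each index and each argument list; off \<open>{1..m}\<close> the value is constantly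
        \<open>undefined\<close>.\<close>
      show "continuous_on UNIV z"
      proof (rule continuous_on_coordinatewise_then_product)
        fix i
        show "continuous_on UNIV (\<lambda>t. z t i)"
        proof (cases "i \<in> {1..m}")
          case True
          have "continuous_on UNIV (\<lambda>t. z t i vs)" for vs
            unfolding z_def using True by (auto intro!: continuous_intros)
          then show ?thesis
            by (rule continuous_on_coordinatewise_then_product)
        next
          case False
          then have "(\<lambda>t. z t i) = (\<lambda>t. undefined)"
            unfolding z_def restrict_def by (simp only: if_False)
          then show ?thesis
            by (simp only: continuous_on_const)
        qed
      qed
    qed (use z in auto)
    ultimately show ?thesis
      by (rule midpoint_affine_continuous_imp_affine)
  qed
  ultimately show "\<exists>A B. \<forall>t. f (\<lambda>i\<in>{1..m}. \<lambda>vs. \<xi> i vs + t * (\<alpha> \<and>\<^sub>f \<beta> i) vs) = A + B * t"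
    by simp
qed

theorem theorem5p2:
  fixes m :: nat and k :: "nat \<Rightarrow> nat"
    and \<Omega> :: "(real ^ ('n::finite)) set"
    and f :: "(nat \<Rightarrow> 'n form) \<Rightarrow> real"
  assumes "m \<ge> 1"
    and "\<And>i. i \<in> {1..m} \<Longrightarrow> 1 \<le> k i \<and> k i \<le> CARD('n)"
    and "open \<Omega>" and "bounded \<Omega>" and "\<Omega> \<noteq> {}"
    and "weakly_continuous_W_d_inf m k \<Omega> f"
  shows "vectorially_ext_one_affine m k f \<and>
    (\<exists>c. (\<forall>\<alpha>\<in>multiindices CARD('n) m k. c \<alpha> \<in> alt_forms (multi_degree m k \<alpha>)) \<and>
         (\<forall>\<xi>\<in>form_prod m k.
            f \<xi> = (\<Sum>\<alpha>\<in>multiindices CARD('n) m k.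
                     form_inner (multi_degree m k \<alpha>) (c \<alpha>) (multi_wedge_pow m \<xi> \<alpha>))))"
proof -
  have k: "1 \<le> k i" if "i \<in> {1..m}" for i
    using assms(2)[OF that] by blast
  have "vectorially_ext_one_affine m k f"
    using k assms(3-6) by (rule weakly_continuous_imp_ext_one_affine)
  with ext_one_affine_representation[OF this k] show ?thesis
    by blast
qed

end
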